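(* Let $\Omega=B(r_0)\subset\mathbb R^2$ be an open disk of radius $r_0>0$, and let $L\in(0,2\pi r_0)$. Then the problem $$\max\{\lambda_1(\Omega\setminus K): K\subseteq\overline\Omega,\ K \text{ continuum},\ \mathcal{SM}(K)\le L\}$$ has a unique solution: the maximizer $K_{\mathrm{opt}}$ is given by the closed disk $\overline{B(r)}$ concentric to $B(r_0)$ of radius $r=L/(2\pi)$.
   Context: A continuum is a compact, connected, non-empty set. For a closed set $K\subset\mathbb R^2$ and $\epsilon>0$ let $K^{\oplus\epsilon}=\{x\in\mathbb R^2: \mathrm d_K(x)\le\epsilon\}$, where $\mathrm d_K$ is the distance function to $K$, and let $\mathcal L$ be the Lebesgue measure on $\mathbb R^2$. The outer Minkowski content of $K$ is $\mathcal{SM}(K)=\lim_{\epsilon\to0^+}\mathcal L(K^{\oplus\epsilon}\setminus K)/\epsilon\in[0,+\infty]$ whenever this limit exists; for every continuum in $\mathbb R^2$ the limit exists (possibly $+\infty$). For a bounded open set $D\subset\mathbb R^2$, $\lambda_1(D)=\min\{\int_D|\nabla u|^2/\int_D u^2: u\in H^1_0(D), u\ne0\}$ is the first Dirichlet eigenvalue of the Laplacian, with $\lambda_1(\emptyset)=+\infty$. *)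

theory Defs
  imports "HOL-Analysis.Analysis"
begin

section \<open>Continua and outer Minkowski content\<close>

definition continuum :: "'a::topological_space set \<Rightarrow> bool" where
  "continuum K \<longleftrightarrow> compact K \<and> connected K \<and> K \<noteq> {}"

text \<open>Only meant for nonempty \<open>K\<close>: the library sets \<open>infdist x {} = 0\<close>.\<close>

definition parallel_set :: "'a::metric_space set \<Rightarrow> real \<Rightarrow> 'a set" where
  "parallel_set K \<epsilon> = {x. infdist x K \<le> \<epsilon>}"

text \<open>The content is a limit in \<open>[0, \<infinity>]\<close> that need not exist for every closed set, so it is a
  relation between a set and its content, which is unique because \<open>ennreal\<close> is Hausdorff.\<close>

definition has_outer_minkowski_content :: "'a::euclidean_space set \<Rightarrow> ennreal \<Rightarrow> bool" where
  "has_outer_minkowski_content K c \<longleftrightarrow>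
     ((\<lambda>\<epsilon>. emeasure lebesgue (parallel_set K \<epsilon> - K) / ennreal \<epsilon>) \<longlongrightarrow> c) (at_right 0)"

section \<open>The Sobolev space of functions vanishing on the boundary\<close>

primrec C_k :: "nat \<Rightarrow> ('a::euclidean_space \<Rightarrow> real) \<Rightarrow> bool" where
  "C_k 0 f \<longleftrightarrow> continuous_on UNIV f"
| "C_k (Suc k) f \<longleftrightarrow> (\<forall>x. f differentiable (at x)) \<and>
     (\<forall>b\<in>Basis. C_k k (\<lambda>x. frechet_derivative f (at x) b))"

text \<open>Functions in \<open>C\<^sub>c\<^sup>\<infinity>(D)\<close> are represented by their extension by zero to the whole space.\<close>

definition test_function :: "'a::euclidean_space set \<Rightarrow> ('a \<Rightarrow> real) \<Rightarrow> bool" where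
  "test_function D \<phi> \<longleftrightarrow> (\<forall>k. C_k k \<phi>) \<and>
     compact (closure {x. \<phi> x \<noteq> 0}) \<and> closure {x. \<phi> x \<noteq> 0} \<subseteq> D"

definition gradient :: "('a::euclidean_space \<Rightarrow> real) \<Rightarrow> 'a \<Rightarrow> 'a" where
  "gradient f x = (\<Sum>b\<in>Basis. frechet_derivative f (at x) b *\<^sub>R b)"

definition L2_on :: "'a::euclidean_space set \<Rightarrow> ('a \<Rightarrow> 'b::euclidean_space) set" where
  "L2_on D = {f \<in> borel_measurable (lebesgue_on D). integrable (lebesgue_on D) (\<lambda>x. (norm (f x))\<^sup>2)}"

definition weak_gradient :: "'a::euclidean_space set \<Rightarrow> ('a \<Rightarrow> real) \<Rightarrow> ('a \<Rightarrow> 'a) \<Rightarrow> bool" where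
  "weak_gradient D u G \<longleftrightarrow> (\<forall>\<phi>. test_function D \<phi> \<longrightarrow> (\<forall>b\<in>Basis.
     (LINT x|lebesgue_on D. u x * (gradient \<phi> x \<bullet> b)) = - (LINT x|lebesgue_on D. (G x \<bullet> b) * \<phi> x)))"

text \<open>\<open>H1_gradient D u G\<close>: the function \<open>u\<close> lies in \<open>H\<^sup>1(D)\<close> and \<open>G\<close> is a version of
  \<open>\<nabla>u\<close>, which is determined only almost everywhere.\<close>

definition H1_gradient :: "'a::euclidean_space set \<Rightarrow> ('a \<Rightarrow> real) \<Rightarrow> ('a \<Rightarrow> 'a) \<Rightarrow> bool" where
  "H1_gradient D u G \<longleftrightarrow> u \<in> L2_on D \<and> G \<in> L2_on D \<and> weak_gradient D u G"

text \<open>\<open>H\<^sup>1\<^sub>0(D)\<close> is the closure of \<open>C\<^sub>c\<^sup>\<infinity>(D)\<close> in the norm of \<open>H\<^sup>1(D)\<close>.\<close>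

definition H1_0 :: "'a::euclidean_space set \<Rightarrow> ('a \<Rightarrow> real) set" where
  "H1_0 D = {u. \<exists>G. H1_gradient D u G \<and> (\<exists>\<phi>. (\<forall>n. test_function D (\<phi> n)) \<and>
     (\<lambda>n. (LINT x|lebesgue_on D. (\<phi> n x - u x)\<^sup>2)
        + (LINT x|lebesgue_on D. (norm (gradient (\<phi> n) x - G x))\<^sup>2)) \<longlonglongrightarrow> 0)}"

section \<open>The first Dirichlet eigenvalue\<close>

text \<open>The minimum is written as an infimum in \<open>[0, \<infinity>]\<close>; the two agree because the minimum is
  attained for bounded open \<open>D \<noteq> {}\<close>. The condition \<open>u \<noteq> 0\<close> is meant in \<open>L\<^sup>2(D)\<close>.\<close>

definition dirichlet_eigenvalue_1 :: "'a::euclidean_space set \<Rightarrow> ennreal" where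
  "dirichlet_eigenvalue_1 D =
     Inf {ennreal ((LINT x|lebesgue_on D. (norm (G x))\<^sup>2) / (LINT x|lebesgue_on D. (u x)\<^sup>2)) | u G.
       u \<in> H1_0 D \<and> H1_gradient D u G \<and> \<not> (AE x in lebesgue_on D. u x = 0)}"

lemma dirichlet_eigenvalue_1_empty: "dirichlet_eigenvalue_1 ({} :: 'a::euclidean_space set) = \<infinity>"
proof -
  have "AE x in lebesgue_on ({} :: 'a set). u x = (0::real)" for u
    by (rule AE_I2) simp
  then show ?thesis
    by (simp add: dirichlet_eigenvalue_1_def)
qed

section \<open>The obstacle problem\<close>

definition admissible :: "'a::euclidean_space set \<Rightarrow> real \<Rightarrow> 'a set \<Rightarrow> bool" where
  "admissible \<Omega> L K \<longleftrightarrow> K \<subseteq> closure \<Omega> \<and> continuum K \<and>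
     (\<exists>c. has_outer_minkowski_content K c \<and> c \<le> ennreal L)"

end

theory Submission
  imports Defs
begin

text \<open>The annulus between the radii \<open>r = L / (2 \<pi>)\<close> and \<open>r\<^sub>0\<close> has a positive radial eigenfunction \<open>f\<close>,
  which increases up to its maximum \<open>M\<close> at some radius \<open>\<rho>\<close> and then decreases. For an admissible \<open>K\<close>
  the test function \<open>v = min w\<^sub>1 w\<^sub>2\<close> is used, where \<open>w\<^sub>1\<close> is the increasing part of \<open>f\<close> as a
  function of the distance to \<open>K\<close>, continued by \<open>M\<close>, and \<open>w\<^sub>2\<close> is the decreasing part of \<open>f\<close> as a
  function of the distance to the centre. The energy densities \<open>e\<^sub>i = \<bar>\<nabla>w\<^sub>i\<bar>\<^sup>2 + \<lambda> (M\<^sup>2 - w\<^sub>i\<^sup>2)\<close> are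
  nonnegative and that of \<open>v\<close> is at most \<open>max e\<^sub>1 e\<^sub>2 \<le> e\<^sub>1 + e\<^sub>2\<close>, so that it does not matter how the
  two regions overlap. As \<open>e\<^sub>1\<close> is a decreasing function of the distance to \<open>K\<close>, its integral is at
  most that for the disk of radius \<open>r\<close>, because \<open>\<L>(K\<^sup>\<oplus>\<^sup>t - K) \<le> L t + \<pi> t\<^sup>2\<close> for continua of content
  at most \<open>L\<close>. The isoperimetric inequality \<open>\<L>(K) \<le> \<pi> r\<^sup>2\<close> then gives \<open>\<integral>\<bar>\<nabla>v\<bar>\<^sup>2 \<le> \<lambda> \<integral>v\<^sup>2\<close>.
  The inequality is strict unless \<open>K\<close> is the disk: either \<open>\<L>(K) < \<pi> r\<^sup>2\<close>, or \<open>K\<close> contains points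
  at distance more than \<open>r\<close> from the centre, near which something is lost in \<open>max e\<^sub>1 e\<^sub>2 \<le> e\<^sub>1 + e\<^sub>2\<close>.\<close>

section \<open>Parallel sets of plane continua\<close>

text \<open>The bound \<open>L t + \<pi> t^2\<close> must hold for continua without any regularity,
  so there is no boundary curve to work with. What connectedness does give is an Euler
  characteristic of at most 1 for unions of grid squares. In the limit of fine grids, this bounds
  the mixed second difference of the area of \<open>K\<close> under Minkowski addition of two
  segments by the area of the parallelogram that they span. Sums of many short segments approximate
  disks, and the content of \<open>K\<close> supplies the slope at \<open>t = 0\<close>. The
  constant \<open>\<lambda> M^2\<close> that makes the densities nonnegative has to be given back on
  all of the disk minus \<open>K\<close>, whose area shrinks as that of \<open>K\<close> grows; this
  is where the isoperimetric upper bound for the area of \<open>K\<close> acts. The eigenvalues are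
  compared by two one-sided estimates of different kinds. For the disk, a pointwise identity bounds
  the energy of every test function of the annulus from below. For any other \<open>K\<close>, a
  single function of smaller Rayleigh quotient suffices; the function \<open>v\<close> is Lipschitz,
  and cutting off and mollifying it yields a test function.\<close>

definition king_adjacent :: "int \<times> int \<Rightarrow> int \<times> int \<Rightarrow> bool" where
  "king_adjacent p q \<longleftrightarrow> \<bar>fst p - fst q\<bar> \<le> 1 \<and> \<bar>snd p - snd q\<bar> \<le> 1"

text \<open>Diagonal neighbours count because the cells of nearby points may touch in a corner only.
  A closure condition takes the place of paths, so that connectedness passes to sweeps, and from
  topological connectedness to cells, without choosing paths.\<close>

definition king_connected :: "(int \<times> int) set \<Rightarrow> bool" where
  "king_connected A \<longleftrightarrow> (\<forall>B \<subseteq> A. B \<noteq> {} \<longrightarrow> (\<forall>b\<in>B. \<forall>c\<in>A. king_adjacent b c \<longrightarrow> c \<in> B) \<longrightarrow> B = A)"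

text \<open>On unions of grid squares this is Minkowski addition of a horizontal segment of one grid
  unit.\<close>

definition right_sweep :: "(int \<times> int) set \<Rightarrow> (int \<times> int) set" where
  "right_sweep A = A \<union> (\<lambda>(i, j). (i + 1, j)) ` A"

definition up_sweep :: "(int \<times> int) set \<Rightarrow> (int \<times> int) set" where
  "up_sweep A = A \<union> (\<lambda>(i, j). (i, j + 1)) ` A"

lemma mem_right_sweep: "(i, j) \<in> right_sweep A \<longleftrightarrow> (i, j) \<in> A \<or> (i - 1, j) \<in> A"
  unfolding right_sweep_def by force

lemma mem_up_sweep: "(i, j) \<in> up_sweep A \<longleftrightarrow> (i, j) \<in> A \<or> (i, j - 1) \<in> A"
  unfolding up_sweep_def by force

lemma finite_sweep: "finite A \<Longrightarrow> finite (right_sweep A)" "finite A \<Longrightarrow> finite (up_sweep A)"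
  by (auto simp: right_sweep_def up_sweep_def)

lemma sweep_commute: "up_sweep (right_sweep A) = right_sweep (up_sweep A)"
  by (auto simp: mem_up_sweep mem_right_sweep)

text \<open>A cell of \<open>A\<close> and its right neighbour are adjacent and both lie in the
  sweep. Hence a set closed under adjacency contains both or neither, and is determined by its trace
  on \<open>A\<close>.\<close>

lemma king_connected_right_sweep:
  assumes "king_connected A" shows "king_connected (right_sweep A)"
  unfolding king_connected_def
proof (intro allI impI)
  fix B assume B: "B \<subseteq> right_sweep A" "B \<noteq> {}"
    and cl: "\<forall>b\<in>B. \<forall>c\<in>right_sweep A. king_adjacent b c \<longrightarrow> c \<in> B"
  have shift: "(i, j) \<in> B \<longleftrightarrow> (i + 1, j) \<in> B" if "(i, j) \<in> A" for i j
  proof -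
    have "(i, j) \<in> right_sweep A" "(i + 1, j) \<in> right_sweep A"
      using that by (auto simp: mem_right_sweep)
    moreover have "king_adjacent (i, j) (i + 1, j)" "king_adjacent (i + 1, j) (i, j)"
      by (auto simp: king_adjacent_def)
    ultimately show ?thesis using cl by blast
  qed
  have ne: "B \<inter> A \<noteq> {}"
  proof -
    obtain i j where ij: "(i, j) \<in> B" using B(2) by auto
    then have "(i, j) \<in> A \<or> (i - 1, j) \<in> A" using B(1) mem_right_sweep by blast
    then show ?thesis using ij shift[of "i - 1" j] by auto
  qed
  have "\<forall>b\<in>B \<inter> A. \<forall>c\<in>A. king_adjacent b c \<longrightarrow> c \<in> B \<inter> A"
    using cl by (auto simp: right_sweep_def)
  then have "B \<inter> A = A"
    using assms ne unfolding king_connected_def by (metis inf_le2)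
  then have "A \<subseteq> B" by auto
  then have "right_sweep A \<subseteq> B"
    using shift by (fastforce simp: right_sweep_def)
  then show "B = right_sweep A" using B(1) by auto
qed

lemma king_connected_up_sweep:
  assumes "king_connected A" shows "king_connected (up_sweep A)"
  unfolding king_connected_def
proof (intro allI impI)
  fix B assume B: "B \<subseteq> up_sweep A" "B \<noteq> {}"
    and cl: "\<forall>b\<in>B. \<forall>c\<in>up_sweep A. king_adjacent b c \<longrightarrow> c \<in> B"
  have shift: "(i, j) \<in> B \<longleftrightarrow> (i, j + 1) \<in> B" if "(i, j) \<in> A" for i j
  proof -
    have "(i, j) \<in> up_sweep A" "(i, j + 1) \<in> up_sweep A"
      using that by (auto simp: mem_up_sweep)
    moreover have "king_adjacent (i, j) (i, j + 1)" "king_adjacent (i, j + 1) (i, j)"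
      by (auto simp: king_adjacent_def)
    ultimately show ?thesis using cl by blast
  qed
  have ne: "B \<inter> A \<noteq> {}"
  proof -
    obtain i j where ij: "(i, j) \<in> B" using B(2) by auto
    then have "(i, j) \<in> A \<or> (i, j - 1) \<in> A" using B(1) mem_up_sweep by blast
    then show ?thesis using ij shift[of i "j - 1"] by auto
  qed
  have "\<forall>b\<in>B \<inter> A. \<forall>c\<in>A. king_adjacent b c \<longrightarrow> c \<in> B \<inter> A"
    using cl by (auto simp: up_sweep_def)
  then have "B \<inter> A = A"
    using assms ne unfolding king_connected_def by (metis inf_le2)
  then have "A \<subseteq> B" by auto
  then have "up_sweep A \<subseteq> B"
    using shift by (fastforce simp: up_sweep_def)
  then show "B = up_sweep A" using B(1) by auto
qed

text \<open>Connectedness of the graph is expressed by the absence of cuts.\<close>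

lemma card_vertices_le_card_edges:
  fixes s t :: "'e \<Rightarrow> 'v"
  assumes "finite W" "finite E"
    and cut: "\<And>T. T \<subseteq> W \<Longrightarrow> T \<noteq> {} \<Longrightarrow> T \<noteq> W \<Longrightarrow>
      \<exists>e\<in>E. (s e \<in> T \<and> t e \<in> W - T) \<or> (t e \<in> T \<and> s e \<in> W - T)"
  shows "card W \<le> card E + 1"
proof (cases "W = {}")
  case False
  define In where "In T = {e\<in>E. s e \<in> T \<and> t e \<in> T}" for T
  have fin: "finite (In T)" for T using assms(2) by (auto simp: In_def)
  \<comment> \<open>Vertices are added one at a time: an edge across the cut brings one new vertex
    and at least one new edge inside \<open>T\<close>.\<close>
  have grow: "\<exists>T\<subseteq>W. card T = Suc n \<and> n \<le> card (In T)" if "n < card W" for n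
    using that
  proof (induction n)
    case 0
    obtain w where "w \<in> W" using False by auto
    then show ?case by (intro exI[of _ "{w}"]) auto
  next
    case (Suc n)
    then obtain T where T: "T \<subseteq> W" "card T = Suc n" "n \<le> card (In T)" by auto
    have "T \<noteq> {}" "T \<noteq> W" using T Suc.prems by auto
    then obtain e v where ev: "e \<in> E" "v \<in> W - T" "(s e \<in> T \<and> t e = v) \<or> (t e \<in> T \<and> s e = v)"
      using cut[OF T(1)] by blast
    have "insert e (In T) \<subseteq> In (insert v T)" "e \<notin> In T" using ev by (auto simp: In_def)
    then have "Suc (card (In T)) \<le> card (In (insert v T))"
      using card_mono[OF fin, of "insert e (In T)" "insert v T"] fin by simp
    moreover have "card (insert v T) = Suc (Suc n)"
      using T ev finite_subset[OF T(1) assms(1)] by simp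
    ultimately show ?case using T ev by (intro exI[of _ "insert v T"]) auto
  qed
  have "card W > 0" using False assms(1) by auto
  then obtain T where "T \<subseteq> W" "card W - 1 \<le> card (In T)" using grow[of "card W - 1"] by auto
  moreover have "card (In T) \<le> card E" for T
    using assms(2) by (auto simp: In_def intro: card_mono)
  ultimately show ?thesis by (meson le_diff_conv le_trans)
qed simp

text \<open>Read \<open>A\<close> as a set of unit squares. Then \<open>up_sweep (right_sweep A)\<close> are the vertices,
  \<open>up_sweep A\<close> the horizontal and \<open>right_sweep A\<close> the vertical edges, indexed by their lower left
  ends, and the inequality says that the Euler characteristic is at most 1. Deleting the left edge
  of every square does not disconnect the graph, as one can go around the square.\<close>

lemma euler_characteristic_le_1:
  assumes fin: "finite A" and con: "king_connected A"
  shows "card (up_sweep (right_sweep A)) + card A \<le> card (right_sweep A) + card (up_sweep A) + 1"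
proof -
  define W where "W = up_sweep (right_sweep A)"
  define s :: "(int \<times> int) + (int \<times> int) \<Rightarrow> int \<times> int" where "s = case_sum id id"
  define t :: "(int \<times> int) + (int \<times> int) \<Rightarrow> int \<times> int"
    where "t = case_sum (\<lambda>(i, j). (i + 1, j)) (\<lambda>(i, j). (i, j + 1))"
  define E where "E = up_sweep A <+> (right_sweep A - A)"
  have finE: "finite E" using fin by (auto simp: E_def finite_sweep)
  have finW: "finite W" using fin by (auto simp: W_def finite_sweep)
  have "card W \<le> card E + 1"
  proof (rule card_vertices_le_card_edges[OF finW finE, of s t], rule ccontr)
    fix T assume T: "T \<subseteq> W" "T \<noteq> {}" "T \<noteq> W"
      and no: "\<not> (\<exists>e\<in>E. (s e \<in> T \<and> t e \<in> W - T) \<or> (t e \<in> T \<and> s e \<in> W - T))"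
    have h: "(i, j) \<in> T \<longleftrightarrow> (i + 1, j) \<in> T" if "(i, j) \<in> up_sweep A" for i j
    proof -
      have "(i, j) \<in> W" "(i + 1, j) \<in> W"
        using that by (auto simp: W_def mem_up_sweep mem_right_sweep)
      moreover have "Inl (i, j) \<in> E" using that by (auto simp: E_def)
      ultimately show ?thesis using no by (force simp: s_def t_def)
    qed
    have hv: "(i, j) \<in> T \<longleftrightarrow> (i, j + 1) \<in> T" if "(i, j) \<in> right_sweep A - A" for i j
    proof -
      have "(i, j) \<in> W" "(i, j + 1) \<in> W"
        using that by (auto simp: W_def mem_up_sweep mem_right_sweep)
      moreover have "Inr (i, j) \<in> E" using that by (auto simp: E_def)
      ultimately show ?thesis using no by (force simp: s_def t_def)
    qed
    \<comment> \<open>If \<open>T\<close> separates the ends of the left edge of a square, it also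
      separates those of the right edge, as the horizontal edges are kept. That right edge must then
      have been deleted as the left edge of another square of \<open>A\<close>, and so on for ever,
      although \<open>A\<close> is finite.\<close>
    have left: "(i, j) \<in> T \<longleftrightarrow> (i, j + 1) \<in> T" if "(i, j) \<in> A" for i j
    proof (rule ccontr)
      assume cross: "\<not> ?thesis"
      have run: "(i + int n, j) \<in> A \<and> ((i + int n, j) \<in> T \<longleftrightarrow> (i + int n, j + 1) \<notin> T)" for n
      proof (induction n)
        case 0 then show ?case using that cross by auto
      next
        case (Suc n)
        let ?k = "i + int n"
        have 1: "(?k, j) \<in> up_sweep A" "(?k, j + 1) \<in> up_sweep A"
          using Suc by (auto simp: mem_up_sweep)
        have 2: "(?k + 1, j) \<in> T \<longleftrightarrow> (?k + 1, j + 1) \<notin> T"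
          using h[OF 1(1)] h[OF 1(2)] Suc by auto
        moreover have "(?k + 1, j) \<in> A"
        proof (rule ccontr)
          assume "(?k + 1, j) \<notin> A"
          then have "(?k + 1, j) \<in> right_sweep A - A" using Suc by (auto simp: mem_right_sweep)
          then show False using hv 2 by blast
        qed
        ultimately show ?case by (simp add: add.assoc add.commute[of 1])
      qed
      have "inj (\<lambda>n. (i + int n, j))" by (auto simp: inj_def)
      moreover have "range (\<lambda>n. (i + int n, j)) \<subseteq> A" using run by auto
      ultimately show False using fin finite_subset range_inj_infinite by blast
    qed
    define B where "B = A \<inter> T"
    have corner: "((i, j) \<in> T \<longleftrightarrow> (i + 1, j) \<in> T) \<and> ((i, j) \<in> T \<longleftrightarrow> (i, j + 1) \<in> T) \<and>
        ((i, j) \<in> T \<longleftrightarrow> (i + 1, j + 1) \<in> T)" if "(i, j) \<in> A" for i j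
    proof -
      have "(i, j) \<in> up_sweep A" "(i, j + 1) \<in> up_sweep A" using that by (auto simp: mem_up_sweep)
      then show ?thesis using h left[OF that] by blast
    qed
    have corner': "(k, l) \<in> T \<longleftrightarrow> (i, j) \<in> T"
      if "(i, j) \<in> A" "k = i \<or> k = i + 1" "l = j \<or> l = j + 1" for i j k l
      using corner[OF that(1)] that by auto
    \<comment> \<open>King-adjacent squares share a corner: the vertex with coordinates
      \<open>max i k\<close> and \<open>max j l\<close>.\<close>
    have step: "c \<in> T \<longleftrightarrow> b \<in> T" if "b \<in> A" "c \<in> A" "king_adjacent b c" for b c
    proof -
      obtain i j k l where bc: "b = (i, j)" "c = (k, l)" by (metis surj_pair)
      have "(max i k, max j l) \<in> T \<longleftrightarrow> (i, j) \<in> T"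
        by (rule corner') (use that bc in \<open>auto simp: king_adjacent_def\<close>)
      moreover have "(max i k, max j l) \<in> T \<longleftrightarrow> (k, l) \<in> T"
        by (rule corner') (use that bc in \<open>auto simp: king_adjacent_def\<close>)
      ultimately show ?thesis using bc by blast
    qed
    have vertex: "\<exists>a\<in>A. w \<in> T \<longleftrightarrow> a \<in> T" if "w \<in> W" for w
    proof -
      obtain k l where w: "w = (k, l)" by (metis surj_pair)
      have "\<exists>i\<in>{k, k - 1}. \<exists>j\<in>{l, l - 1}. (i, j) \<in> A"
        using that w by (auto simp: W_def mem_up_sweep mem_right_sweep)
      then obtain i j where "(i, j) \<in> A" "k = i \<or> k = i + 1" "l = j \<or> l = j + 1" by auto
      then show ?thesis using corner' w by blast
    qed
    have "B \<noteq> {}" using T vertex by (auto simp: B_def)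
    moreover have "\<forall>b\<in>B. \<forall>c\<in>A. king_adjacent b c \<longrightarrow> c \<in> B" using step by (auto simp: B_def)
    ultimately have "B = A" using con unfolding king_connected_def by (metis B_def inf_le1)
    then have "W \<subseteq> T" using vertex by (auto simp: B_def)
    then show False using T by auto
  qed
  moreover have "card E = card (up_sweep A) + (card (right_sweep A) - card A)"
    using fin by (simp add: E_def card_Plus finite_sweep card_Diff_subset right_sweep_def)
  moreover have "card A \<le> card (right_sweep A)"
    using fin by (intro card_mono) (auto simp: finite_sweep right_sweep_def)
  ultimately show ?thesis by (simp add: W_def)
qed

lemma king_connected_sweeps:
  "king_connected A \<Longrightarrow> king_connected ((right_sweep ^^ m) A)"
  "king_connected A \<Longrightarrow> king_connected ((up_sweep ^^ n) A)"
  by (induction m, auto simp: king_connected_right_sweep)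
     (induction n, auto simp: king_connected_up_sweep)

lemma finite_sweeps:
  "finite A \<Longrightarrow> finite ((right_sweep ^^ m) A)" "finite A \<Longrightarrow> finite ((up_sweep ^^ n) A)"
  by (induction m, auto simp: finite_sweep) (induction n, auto simp: finite_sweep)

lemma mem_right_sweeps: "(i, j) \<in> (right_sweep ^^ m) A \<longleftrightarrow> (\<exists>k\<in>{0..int m}. (i - k, j) \<in> A)"
proof (induction m arbitrary: i)
  case (Suc m)
  show ?case
  proof
    assume "(i, j) \<in> (right_sweep ^^ Suc m) A"
    then obtain k where "k \<in> {0..int m}" "(i - k, j) \<in> A \<or> (i - 1 - k, j) \<in> A"
      using Suc by (auto simp: mem_right_sweep)
    then show "\<exists>k\<in>{0..int (Suc m)}. (i - k, j) \<in> A"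
      by (auto intro: bexI[of _ k] bexI[of _ "k + 1"] simp: algebra_simps)
  next
    assume "\<exists>k\<in>{0..int (Suc m)}. (i - k, j) \<in> A"
    then obtain k where k: "k \<in> {0..int (Suc m)}" "(i - k, j) \<in> A" by auto
    show "(i, j) \<in> (right_sweep ^^ Suc m) A"
    proof (cases "k = 0")
      case True
      then show ?thesis using k Suc[of i] by (auto simp: mem_right_sweep intro!: bexI[of _ 0])
    next
      case False
      then show ?thesis using k Suc[of "i - 1"]
        by (auto simp: mem_right_sweep algebra_simps intro!: bexI[of _ "k - 1"])
    qed
  qed
qed auto

lemma mem_up_sweeps: "(i, j) \<in> (up_sweep ^^ m) A \<longleftrightarrow> (\<exists>k\<in>{0..int m}. (i, j - k) \<in> A)"
proof (induction m arbitrary: j)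
  case (Suc m)
  show ?case
  proof
    assume "(i, j) \<in> (up_sweep ^^ Suc m) A"
    then obtain k where "k \<in> {0..int m}" "(i, j - k) \<in> A \<or> (i, j - 1 - k) \<in> A"
      using Suc by (auto simp: mem_up_sweep)
    then show "\<exists>k\<in>{0..int (Suc m)}. (i, j - k) \<in> A"
      by (auto intro: bexI[of _ k] bexI[of _ "k + 1"] simp: algebra_simps)
  next
    assume "\<exists>k\<in>{0..int (Suc m)}. (i, j - k) \<in> A"
    then obtain k where k: "k \<in> {0..int (Suc m)}" "(i, j - k) \<in> A" by auto
    show "(i, j) \<in> (up_sweep ^^ Suc m) A"
    proof (cases "k = 0")
      case True
      then show ?thesis using k Suc[of j] by (auto simp: mem_up_sweep intro!: bexI[of _ 0])
    next
      case False
      then show ?thesis using k Suc[of "j - 1"]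
        by (auto simp: mem_up_sweep algebra_simps intro!: bexI[of _ "k - 1"])
    qed
  qed
qed auto

text \<open>The unit case is \<open>euler_characteristic_le_1\<close>. It telescopes in both
  directions, as the two sweeps commute and preserve connectedness, and each of the
  \<open>m * n\<close> steps costs 1.\<close>

lemma card_sweeps_le:
  assumes "finite A" "king_connected A"
  shows "card ((up_sweep ^^ n) ((right_sweep ^^ m) A)) + card A
    \<le> card ((right_sweep ^^ m) A) + card ((up_sweep ^^ n) A) + m * n"
proof -
  have com: "(up_sweep ^^ n) (right_sweep B) = right_sweep ((up_sweep ^^ n) B)" for n B
    by (induction n) (auto simp: sweep_commute)
  have 1: "card ((up_sweep ^^ n) (right_sweep B)) + card B
    \<le> card (right_sweep B) + card ((up_sweep ^^ n) B) + n"
    if "finite B" "king_connected B" for B n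
  proof (induction n)
    case (Suc n)
    let ?C = "(up_sweep ^^ n) B"
    have "card (up_sweep (right_sweep ?C)) + card ?C \<le> card (right_sweep ?C) + card (up_sweep ?C) + 1"
      using that by (intro euler_characteristic_le_1 finite_sweeps king_connected_sweeps)
    then show ?case using Suc by (simp add: com)
  qed simp
  show ?thesis
  proof (induction m)
    case (Suc m)
    let ?C = "(right_sweep ^^ m) A"
    have "card ((up_sweep ^^ n) (right_sweep ?C)) + card ?C
      \<le> card (right_sweep ?C) + card ((up_sweep ^^ n) ?C) + n"
      using assms by (intro 1 finite_sweeps king_connected_sweeps)
    then show ?case using Suc by simp
  qed simp
qed

section \<open>Minkowski sums and parallel sets of compact sets\<close>

lemma set_plus_UN: "A + B = (\<Union>x\<in>A. \<Union>y\<in>B. {x + y})"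
  by (auto simp: set_plus_def)

lemma compact_set_plus:
  fixes A B :: "'a::real_normed_vector set"
  shows "compact A \<Longrightarrow> compact B \<Longrightarrow> compact (A + B)"
  using compact_sums'[of A B] by (simp add: set_plus_UN)

lemma connected_set_plus:
  fixes A B :: "'a::real_normed_vector set"
  assumes "connected A" "connected B" shows "connected (A + B)"
proof -
  have "A + B = (\<lambda>(x, y). x + y) ` (A \<times> B)" by (auto simp: set_plus_def)
  moreover have "continuous_on (A \<times> B) (\<lambda>(x, y). x + y)"
    by (simp add: case_prod_unfold continuous_intros)
  ultimately show ?thesis using connected_continuous_image connected_Times[OF assms] by metis
qed

lemma continuum_set_plus:
  fixes A B :: "'a::real_normed_vector set"
  shows "continuum A \<Longrightarrow> continuum B \<Longrightarrow> continuum (A + B)"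
  unfolding continuum_def using compact_set_plus[of A B] connected_set_plus[of A B]
  by (auto simp: set_plus_def)

lemma continuum_closed_segment: "continuum (closed_segment x (y :: 'a::real_normed_vector))"
  by (simp add: continuum_def)

lemma parallel_set_conv:
  fixes C :: "'a::heine_borel set"
  assumes "compact C" "C \<noteq> {}"
  shows "parallel_set C e = {x. \<exists>y\<in>C. dist x y \<le> e}"
proof -
  have "infdist x C \<le> e \<longleftrightarrow> (\<exists>y\<in>C. dist x y \<le> e)" for x
    by (metis infdist_attains_inf[OF compact_imp_closed[OF assms(1)] assms(2)] infdist_le2)
  then show ?thesis by (simp add: parallel_set_def)
qed

lemma parallel_set_eq_plus:
  fixes C :: "'a::euclidean_space set"
  assumes "compact C" "C \<noteq> {}"
  shows "parallel_set C e = C + cball 0 e"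
proof -
  have "(\<exists>y\<in>C. dist x y \<le> e) \<longleftrightarrow> x \<in> C + cball 0 e" for x
  proof
    assume "\<exists>y\<in>C. dist x y \<le> e"
    then obtain y where "y \<in> C" "dist x y \<le> e" by auto
    then show "x \<in> C + cball 0 e"
      using set_plus_intro[of y C "x - y" "cball 0 e"] by (simp add: dist_norm norm_minus_commute)
  next
    assume "x \<in> C + cball 0 e"
    then obtain y z where "y \<in> C" "norm z \<le> e" "x = y + z" by (auto simp: set_plus_def)
    then show "\<exists>y\<in>C. dist x y \<le> e" by (intro bexI[of _ y]) (auto simp: dist_norm)
  qed
  then show ?thesis by (auto simp: parallel_set_conv[OF assms])
qed

lemma compact_parallel_set:
  fixes C :: "'a::euclidean_space set"
  shows "compact C \<Longrightarrow> C \<noteq> {} \<Longrightarrow> compact (parallel_set C e)"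
  by (simp add: parallel_set_eq_plus compact_set_plus)

lemma parallel_set_mono: "d \<le> e \<Longrightarrow> parallel_set C d \<subseteq> parallel_set C e"
  by (auto simp: parallel_set_def)

lemma subset_parallel_set: "0 \<le> e \<Longrightarrow> C \<subseteq> parallel_set C e"
  by (auto simp: parallel_set_def)

text \<open>A compact set is the decreasing intersection of its parallel sets. This removes the
  error of the grid approximation in the limit.\<close>

lemma measure_parallel_set_tendsto:
  fixes C :: "'a::euclidean_space set"
  assumes "compact C" "C \<noteq> {}"
  shows "(\<lambda>n. measure lebesgue (parallel_set C (inverse (real (Suc n))))) \<longlonglongrightarrow> measure lebesgue C"
proof -
  let ?P = "\<lambda>n. parallel_set C (inverse (real (Suc n)))"
  have lm: "?P n \<in> lmeasurable" for n
    using compact_parallel_set[OF assms] by (rule lmeasurable_compact)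
  have "C = (\<Inter>n. ?P n)"
  proof (intro equalityI subsetI)
    fix x assume "x \<in> (\<Inter>n. ?P n)"
    then have "infdist x C \<le> inverse (real (Suc n))" for n by (auto simp: parallel_set_def)
    then have "infdist x C \<le> 0"
      using LIMSEQ_le_const[OF LIMSEQ_inverse_real_of_nat] by blast
    then have "infdist x C = 0" using infdist_nonneg[of x C] by linarith
    then show "x \<in> C"
      using in_closed_iff_infdist_zero[OF compact_imp_closed[OF assms(1)] assms(2)] by blast
  qed (auto simp: parallel_set_def)
  moreover have "(\<lambda>n. measure lebesgue (?P n)) \<longlonglongrightarrow> measure lebesgue (\<Inter>n. ?P n)"
  proof (rule Lim_measure_decseq)
    show "range ?P \<subseteq> sets lebesgue" using lm by (auto simp: fmeasurable_def)
    show "decseq ?P" by (intro decseq_SucI parallel_set_mono) (simp add: field_simps)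
    show "emeasure lebesgue (?P n) \<noteq> \<infinity>" for n using fmeasurableD2[OF lm] by simp
  qed
  ultimately show ?thesis by simp
qed

text \<open>Floors make the cells of side \<open>1 / n\<close> half-open, so that they partition the
  plane and the area of a union of cells is an exact count.\<close>

definition cell_index :: "nat \<Rightarrow> real^2 \<Rightarrow> int \<times> int" where
  "cell_index n x = (\<lfloor>real n * x$1\<rfloor>, \<lfloor>real n * x$2\<rfloor>)"

lemma cell_measure:
  assumes "n > 0"
  shows "cell_index n -` {(i, j)} \<in> lmeasurable"
    "measure lebesgue (cell_index n -` {(i, j)}) = 1 / (real n)\<^sup>2"
proof -
  let ?C = "cell_index n -` {(i, j)}"
  define l u :: "real^2" where "l = vector [i / n, j / n]" and "u = vector [(i + 1) / n, (j + 1) / n]"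
  have lu: "l$1 = i / n" "l$2 = j / n" "u$1 = (i + 1) / n" "u$2 = (j + 1) / n"
    by (auto simp: l_def u_def)
  have C: "?C = {x. i \<le> real n * x$1 \<and> real n * x$1 < i + 1 \<and> j \<le> real n * x$2 \<and> real n * x$2 < j + 1}"
    by (auto simp: cell_index_def floor_eq_iff)
  have sub: "box l u \<subseteq> ?C" "?C \<subseteq> cbox l u"
    using assms unfolding C by (auto simp: mem_box_cart forall_2 lu field_simps)
  have "?C \<in> sets borel" unfolding C by measurable
  then show lm: "?C \<in> lmeasurable"
    using bounded_subset[OF bounded_cbox sub(2)] by (intro bounded_set_imp_lmeasurable) auto
  have "cbox l u \<noteq> {}"
    using assms by (auto simp: interval_ne_empty_cart forall_2 lu field_simps)
  then have cb: "measure lebesgue (cbox l u) = 1 / (real n)\<^sup>2"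
    using assms by (simp add: content_cbox_cart UNIV_2 lu field_simps power2_eq_square)
  moreover have "measure lebesgue (box l u) = measure lebesgue (cbox l u)"
    by (simp add: measure_lborel_box_eq measure_lborel_cbox_eq)
  moreover have "measure lebesgue (box l u) \<le> measure lebesgue ?C" "measure lebesgue ?C \<le> measure lebesgue (cbox l u)"
    using sub lm by (simp_all add: measure_mono_fmeasurable fmeasurableD del: measure_completion)
  ultimately show "measure lebesgue ?C = 1 / (real n)\<^sup>2" by linarith
qed

lemma cells_measure:
  assumes "n > 0" "finite A"
  shows "cell_index n -` A \<in> lmeasurable"
    "measure lebesgue (cell_index n -` A) = card A / (real n)\<^sup>2"
proof -
  have A: "cell_index n -` A = (\<Union>a\<in>A. cell_index n -` {a})" by auto
  have 1: "cell_index n -` {a} \<in> lmeasurable" "measure lebesgue (cell_index n -` {a}) = 1 / (real n)\<^sup>2" for a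
    using cell_measure[OF assms(1), of "fst a" "snd a"] by auto
  show "cell_index n -` A \<in> lmeasurable"
    unfolding A using assms(2) 1 by (intro fmeasurable.finite_UN) auto
  have "measure lebesgue (\<Union>a\<in>A. cell_index n -` {a}) = (\<Sum>a\<in>A. measure lebesgue (cell_index n -` {a}))"
    by (intro measure_UNION' assms(2)) (use 1 in \<open>auto simp: pairwise_def disjnt_def\<close>)
  then show "measure lebesgue (cell_index n -` A) = card A / (real n)\<^sup>2"
    by (simp add: A 1)
qed

lemma abs_floor_diff_le:
  fixes x y :: real
  assumes "\<bar>x - y\<bar> < 1" shows "\<bar>\<lfloor>x\<rfloor> - \<lfloor>y\<rfloor>\<bar> \<le> 1"
proof -
  have "x < \<lfloor>y\<rfloor> + 2" "y < \<lfloor>x\<rfloor> + 2"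
    using assms floor_correct[of x] floor_correct[of y] by linarith+
  then have "\<lfloor>x\<rfloor> < \<lfloor>y\<rfloor> + 2" "\<lfloor>y\<rfloor> < \<lfloor>x\<rfloor> + 2"
    by (simp_all add: floor_less_iff)
  then show ?thesis by simp
qed

lemma king_adjacent_cell_index:
  assumes "n > 0" "dist x y < 1 / real n"
  shows "king_adjacent (cell_index n x) (cell_index n y)"
proof -
  have "\<bar>real n * x$i - real n * y$i\<bar> < 1" for i
  proof -
    have "\<bar>x$i - y$i\<bar> < 1 / n"
      using component_le_norm_cart[of "x - y" i] assms(2) by (simp add: dist_norm)
    then have "real n * \<bar>x$i - y$i\<bar> < 1" using assms(1) by (simp add: field_simps)
    then show ?thesis using assms(1) by (simp add: right_diff_distrib[symmetric] abs_mult)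
  qed
  then show ?thesis by (simp add: king_adjacent_def cell_index_def abs_floor_diff_le)
qed

text \<open>Points at distance less than \<open>1 / n\<close> have adjacent cells, so for an
  adjacency-closed \<open>B\<close> the statement that the cell of a point lies in \<open>B\<close>
  is locally constant on the connected set \<open>K\<close>.\<close>

lemma king_connected_cell_index:
  assumes "connected K" "n > 0" shows "king_connected (cell_index n ` K)"
  unfolding king_connected_def
proof (intro allI impI equalityI subsetI)
  fix B c assume B: "B \<subseteq> cell_index n ` K" "B \<noteq> {}"
    and cl: "\<forall>b\<in>B. \<forall>c\<in>cell_index n ` K. king_adjacent b c \<longrightarrow> c \<in> B"
    and c: "c \<in> cell_index n ` K"
  obtain x y where xy: "x \<in> K" "y \<in> K" "cell_index n x \<in> B" "c = cell_index n y"
    using B c by (metis (no_types, lifting) all_not_in_conv image_iff subsetD)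
  have "(cell_index n x \<in> B) = (cell_index n y \<in> B)"
  proof (rule connected_local_const[OF assms(1) xy(1,2), rule_format])
    fix z assume z: "z \<in> K"
    show "\<forall>\<^sub>F w in at z within K. (cell_index n z \<in> B) = (cell_index n w \<in> B)"
      unfolding eventually_at
    proof (intro exI[of _ "1 / real n"] conjI ballI impI)
      fix w assume w: "w \<in> K" "w \<noteq> z \<and> dist w z < 1 / real n"
      have "king_adjacent (cell_index n z) (cell_index n w)" "king_adjacent (cell_index n w) (cell_index n z)"
        using w assms(2) by (auto intro!: king_adjacent_cell_index simp: dist_commute)
      then show "(cell_index n z \<in> B) = (cell_index n w \<in> B)" using cl z w by blast
    qed (use assms(2) in auto)
  qed
  then show "c \<in> B" using xy by simp
qed auto

lemma finite_cell_index:
  assumes "bounded K" shows "finite (cell_index n ` K)"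
proof -
  obtain b where b: "norm x \<le> b" if "x \<in> K" for x using assms unfolding bounded_iff by auto
  have "cell_index n ` K \<subseteq> {- \<lceil>n * b\<rceil> - 1..\<lceil>n * b\<rceil>} \<times> {- \<lceil>n * b\<rceil> - 1..\<lceil>n * b\<rceil>}"
  proof (rule image_subsetI)
    fix x assume "x \<in> K"
    have "\<bar>real n * x$i\<bar> \<le> n * b" for i
    proof -
      have "\<bar>x$i\<bar> \<le> b" using component_le_norm_cart[of x i] b[OF \<open>x \<in> K\<close>] by linarith
      then show ?thesis by (simp add: abs_mult mult_left_mono)
    qed
    moreover have "\<lfloor>y\<rfloor> \<in> {- \<lceil>z\<rceil> - 1..\<lceil>z\<rceil>}" if "\<bar>y\<bar> \<le> z" for y z :: real
    proof -
      have "z \<le> \<lceil>z\<rceil>" by (rule le_of_int_ceiling)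
      then have "- \<lceil>z\<rceil> \<le> y" "y \<le> \<lceil>z\<rceil>" using that by linarith+
      then show ?thesis by (simp add: le_floor_iff floor_le_iff)
    qed
    ultimately have "\<lfloor>real n * x$i\<rfloor> \<in> {- \<lceil>n * b\<rceil> - 1..\<lceil>n * b\<rceil>}" for i
      by blast
    then show "cell_index n x \<in> {- \<lceil>n * b\<rceil> - 1..\<lceil>n * b\<rceil>} \<times> {- \<lceil>n * b\<rceil> - 1..\<lceil>n * b\<rceil>}"
      by (simp add: cell_index_def)
  qed
  then show ?thesis by (rule finite_subset) auto
qed

text \<open>Together with \<open>abs_diff_lt_of_floor\<close> this matches translations by at most 1
  with at most \<open>n\<close> sweeps: here the sweeps catch every translate, there they overshoot
  by at most \<open>1 / n\<close> per coordinate.\<close>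

lemma floor_shift_bounds:
  assumes "0 \<le> u" "u \<le> 1"
  shows "\<exists>k\<in>{0..int n}. \<lfloor>real n * (x + u)\<rfloor> - k = \<lfloor>real n * x\<rfloor>"
proof -
  have "real n * x \<le> real n * (x + u)" "real n * (x + u) \<le> real n * x + int n"
    using assms mult_left_mono[of u 1 "real n"] by (auto simp: algebra_simps)
  then have "\<lfloor>real n * x\<rfloor> \<le> \<lfloor>real n * (x + u)\<rfloor>" "\<lfloor>real n * (x + u)\<rfloor> \<le> \<lfloor>real n * x\<rfloor> + int n"
    using floor_mono[of "real n * x" "real n * (x + u)"] floor_mono[of "real n * (x + u)" "real n * x + int n"] by simp_all
  then show ?thesis by (intro bexI[of _ "\<lfloor>real n * (x + u)\<rfloor> - \<lfloor>real n * x\<rfloor>"]) auto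
qed

lemma abs_diff_lt_of_floor:
  assumes "n > 0" "\<lfloor>real n * x\<rfloor> - k = \<lfloor>real n * y\<rfloor>"
  shows "\<bar>x - (y + real_of_int k / real n)\<bar> \<le> 1 / real n"
proof -
  have "\<bar>real n * x - real n * y - k\<bar> \<le> 1"
    using floor_correct[of "real n * x"] floor_correct[of "real n * y"] unfolding assms(2)[symmetric] by (simp only: abs_le_iff of_int_diff) linarith
  moreover have "real n * (x - (y + k / n)) = real n * x - real n * y - k"
    using assms(1) by (simp add: field_simps)
  ultimately have "real n * \<bar>x - (y + k / n)\<bar> \<le> 1" by (metis abs_mult abs_of_nat)
  then show ?thesis using assms(1) by (simp add: field_simps)
qed

text \<open>The outer approximations of \<open>K\<close> by grid squares of side \<open>1 / n\<close> satisfy \<open>card_sweeps_le\<close>, where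
  a sweep by \<open>n\<close> steps corresponds to adding a unit segment.\<close>

lemma mixed_difference_unit_square:
  fixes K :: "(real^2) set"
  assumes "continuum K"
  defines "H \<equiv> closed_segment 0 (axis 1 1 :: real^2)" and "V \<equiv> closed_segment 0 (axis 2 1 :: real^2)"
  shows "measure lebesgue (K + H + V) + measure lebesgue K
    \<le> measure lebesgue (K + H) + measure lebesgue (K + V) + 1"
proof -
  have K: "compact K" "connected K" "K \<noteq> {}" using assms(1) by (auto simp: continuum_def)
  have H: "H = {x. 0 \<le> x$1 \<and> x$1 \<le> 1 \<and> x$2 = 0}"
  proof -
    have "x \<in> H \<longleftrightarrow> 0 \<le> x$1 \<and> x$1 \<le> 1 \<and> x$2 = 0" for x
      by (auto simp: H_def in_segment axis_def vec_eq_iff forall_2 intro: exI[of _ "x$1"])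
    then show ?thesis by auto
  qed
  have V: "V = {x. 0 \<le> x$2 \<and> x$2 \<le> 1 \<and> x$1 = 0}"
  proof -
    have "x \<in> V \<longleftrightarrow> 0 \<le> x$2 \<and> x$2 \<le> 1 \<and> x$1 = 0" for x
      by (auto simp: V_def in_segment axis_def vec_eq_iff forall_2 intro: exI[of _ "x$2"])
    then show ?thesis by auto
  qed
  have cH: "compact (K + H)" "K + H \<noteq> {}" and cV: "compact (K + V)" "K + V \<noteq> {}"
    using continuum_set_plus[OF assms(1)] continuum_closed_segment
    unfolding H_def V_def continuum_def by blast+
  \<comment> \<open>The unions of cells contain the sets on the left and stay within distance
    \<open>2 / n\<close>, that is \<open>1 / n\<close> in each coordinate, of the sums on the right.
    Both errors point in the favourable direction.\<close>
  have step: "measure lebesgue (K + H + V) + measure lebesgue K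
    \<le> measure lebesgue (parallel_set (K + H) (2 / n)) + measure lebesgue (parallel_set (K + V) (2 / n)) + 1"
    if n: "n > 0" for n :: nat
  proof -
    define A where "A = cell_index n ` K"
    have A: "finite A" "king_connected A"
      unfolding A_def using finite_cell_index compact_imp_bounded[OF K(1)] king_connected_cell_index K n by auto
    let ?R = "(right_sweep ^^ n) A" and ?U = "(up_sweep ^^ n) A" and ?Q = "(up_sweep ^^ n) ((right_sweep ^^ n) A)"
    have lm: "cell_index n -` B \<in> lmeasurable" "measure lebesgue (cell_index n -` B) = card B / (real n)\<^sup>2"
      if "B \<in> {A, ?R, ?U, ?Q}" for B
      using cells_measure[OF n, of B] that A finite_sweeps by auto
    have Q: "K + H + V \<subseteq> cell_index n -` ?Q"
    proof
      fix z assume "z \<in> K + H + V"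
      then obtain x u v where x: "x \<in> K" "u \<in> H" "v \<in> V" "z = x + u + v"
        unfolding set_plus_def by auto
      then have z: "z$1 = x$1 + u$1" "z$2 = x$2 + v$2" using H V by auto
      have "cell_index n x \<in> A" using x by (auto simp: A_def)
      moreover have "\<exists>k\<in>{0..int n}. \<lfloor>real n * z$1\<rfloor> - k = \<lfloor>real n * x$1\<rfloor>"
        "\<exists>k\<in>{0..int n}. \<lfloor>real n * z$2\<rfloor> - k = \<lfloor>real n * x$2\<rfloor>"
        unfolding z using x H V by (auto intro!: floor_shift_bounds)
      ultimately show "z \<in> cell_index n -` ?Q"
        by (simp add: cell_index_def mem_up_sweeps mem_right_sweeps) metis
    qed
    have near: "z \<in> parallel_set C (2 / n)"
      if "compact C" "y \<in> C" "\<bar>z$1 - y$1\<bar> \<le> 1 / n" "\<bar>z$2 - y$2\<bar> \<le> 1 / n" for z y :: "real^2" and C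
    proof -
      have "norm (z - y) \<le> \<bar>(z - y)$1\<bar> + \<bar>(z - y)$2\<bar>"
        using norm_le_l1_cart[of "z - y"] by (simp add: sum_2)
      then have "dist z y \<le> 2 / n" using that by (simp add: dist_norm)
      then show ?thesis using that by (subst parallel_set_conv) auto
    qed
    have R: "cell_index n -` ?R \<subseteq> parallel_set (K + H) (2 / n)"
    proof
      fix z assume "z \<in> cell_index n -` ?R"
      then obtain k where k: "k \<in> {0..int n}" "(\<lfloor>real n * z$1\<rfloor> - k, \<lfloor>real n * z$2\<rfloor>) \<in> A"
        by (auto simp: cell_index_def mem_right_sweeps)
      then obtain x where x: "x \<in> K" "\<lfloor>real n * z$1\<rfloor> - k = \<lfloor>real n * x$1\<rfloor>" "\<lfloor>real n * z$2\<rfloor> - 0 = \<lfloor>real n * x$2\<rfloor>"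
        by (auto simp: A_def cell_index_def)
      let ?h = "vector [k / n, 0] :: real^2"
      have "?h \<in> H" using k n by (auto simp: H field_simps)
      then have "x + ?h \<in> K + H" using x by auto
      then show "z \<in> parallel_set (K + H) (2 / n)"
        using near[OF cH(1), of "x + ?h" z] abs_diff_lt_of_floor[OF n x(2)] abs_diff_lt_of_floor[OF n x(3)]
        by simp
    qed
    have U: "cell_index n -` ?U \<subseteq> parallel_set (K + V) (2 / n)"
    proof
      fix z assume "z \<in> cell_index n -` ?U"
      then obtain k where k: "k \<in> {0..int n}" "(\<lfloor>real n * z$1\<rfloor>, \<lfloor>real n * z$2\<rfloor> - k) \<in> A"
        by (auto simp: cell_index_def mem_up_sweeps)
      then obtain x where x: "x \<in> K" "\<lfloor>real n * z$2\<rfloor> - k = \<lfloor>real n * x$2\<rfloor>" "\<lfloor>real n * z$1\<rfloor> - 0 = \<lfloor>real n * x$1\<rfloor>"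
        by (auto simp: A_def cell_index_def)
      let ?h = "vector [0, k / n] :: real^2"
      have "?h \<in> V" using k n by (auto simp: V field_simps)
      then have "x + ?h \<in> K + V" using x by auto
      then show "z \<in> parallel_set (K + V) (2 / n)"
        using near[OF cV(1), of "x + ?h" z] abs_diff_lt_of_floor[OF n x(2)] abs_diff_lt_of_floor[OF n x(3)]
        by simp
    qed
    have lmc: "compact S \<Longrightarrow> S \<in> sets lebesgue" for S :: "(real^2) set"
      using lmeasurable_compact by blast
    have "measure lebesgue (K + H + V) \<le> card ?Q / (real n)\<^sup>2"
      using measure_mono_fmeasurable[OF Q, of lebesgue] lm[of ?Q] compact_set_plus[OF cH(1), of V]
      by (simp add: V_def lmc)
    moreover have "measure lebesgue K \<le> card A / (real n)\<^sup>2"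
      using measure_mono_fmeasurable[of K "cell_index n -` A" lebesgue] lm[of A] K(1) by (auto simp: A_def lmc)
    moreover have "card ?R / (real n)\<^sup>2 \<le> measure lebesgue (parallel_set (K + H) (2 / n))"
      using measure_mono_fmeasurable[OF R, of lebesgue] lm[of ?R] compact_parallel_set[OF cH]
      by (simp add: fmeasurableD lmeasurable_compact)
    moreover have "card ?U / (real n)\<^sup>2 \<le> measure lebesgue (parallel_set (K + V) (2 / n))"
      using measure_mono_fmeasurable[OF U, of lebesgue] lm[of ?U] compact_parallel_set[OF cV]
      by (simp add: fmeasurableD lmeasurable_compact)
    moreover have "card ?Q / (real n)\<^sup>2 + card A / (real n)\<^sup>2 \<le> card ?R / (real n)\<^sup>2 + card ?U / (real n)\<^sup>2 + 1"
    proof -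
      have "real (card ?Q + card A) \<le> real (card ?R + card ?U + n * n)"
        using card_sweeps_le[OF A, of n n] by linarith
      then have "(card ?Q + card A) / (real n)\<^sup>2 \<le> (card ?R + card ?U + n * n) / (real n)\<^sup>2"
        by (intro divide_right_mono) auto
      then show ?thesis using n by (simp add: add_divide_distrib power2_eq_square)
    qed
    ultimately show ?thesis by linarith
  qed
  have "(\<lambda>n. measure lebesgue (parallel_set (K + H) (inverse (real (Suc n))))
      + measure lebesgue (parallel_set (K + V) (inverse (real (Suc n)))) + 1)
    \<longlonglongrightarrow> measure lebesgue (K + H) + measure lebesgue (K + V) + 1"
    by (intro tendsto_intros measure_parallel_set_tendsto cH cV)
  moreover have "measure lebesgue (K + H + V) + measure lebesgue K
     \<le> measure lebesgue (parallel_set (K + H) (inverse (real (Suc n))))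
      + measure lebesgue (parallel_set (K + V) (inverse (real (Suc n)))) + 1" for n
  proof -
    have "2 / real (2 * Suc n) = inverse (real (Suc n))" by (simp add: field_simps)
    then show ?thesis using step[of "2 * Suc n"] by (simp del: of_nat_Suc of_nat_mult)
  qed
  ultimately show ?thesis using LIMSEQ_le_const by blast
qed

section \<open>Sums with arbitrary segments and with zonotopes\<close>

lemma set_plus_linear_image:
  assumes "linear f" shows "f ` (A + B) = f ` A + f ` B"
proof
  show "f ` (A + B) \<subseteq> f ` A + f ` B"
    using linear_add[OF assms] by (force simp: set_plus_def)
  show "f ` A + f ` B \<subseteq> f ` (A + B)"
  proof
    fix z assume "z \<in> f ` A + f ` B"
    then obtain x y where "x \<in> A" "y \<in> B" "z = f (x + y)"
      using linear_add[OF assms] by (auto simp: set_plus_def)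
    then show "z \<in> f ` (A + B)" by auto
  qed
qed

abbreviation seg :: "real^2 \<Rightarrow> (real^2) set" where "seg p \<equiv> closed_segment 0 p"

definition cross2 :: "real^2 \<Rightarrow> real^2 \<Rightarrow> real" where
  "cross2 p q = p$1 * q$2 - p$2 * q$1"

lemma plus_singleton: "{v} + A = (+) v ` A"
  by (auto simp: set_plus_def)

lemma seg_minus: "seg (- p) = {- p} + seg p"
proof -
  have "seg (- p) = (+) (- p) ` closed_segment p 0" 
    using closed_segment_translation[of "- p" p 0] by (simp add: closed_segment_commute)
  then show ?thesis by (simp add: plus_singleton closed_segment_commute)
qed

text \<open>The sum with both segments is covered by \<open>K + seg p\<close> and the translate by
  \<open>p\<close> of \<open>K + seg (c *\<^sub>R p)\<close>, and these two overlap at least in the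
  translate of \<open>K\<close> by \<open>p\<close>.\<close>

lemma mixed_difference_parallel:
  fixes K :: "(real^2) set"
  assumes "continuum K" "0 \<le> c"
  shows "measure lebesgue (K + seg p + seg (c *\<^sub>R p)) + measure lebesgue K
    \<le> measure lebesgue (K + seg p) + measure lebesgue (K + seg (c *\<^sub>R p))"
proof -
  let ?A = "K + seg p" and ?B = "{p} + (K + seg (c *\<^sub>R p))"
  have lm: "K \<in> lmeasurable" "?A \<in> lmeasurable" "?B \<in> lmeasurable" "{p} + K \<in> lmeasurable"
    using assms(1) by (auto intro!: lmeasurable_compact compact_set_plus simp: continuum_def)
  have "K + seg p + seg (c *\<^sub>R p) \<subseteq> ?A \<union> ?B"
  proof
    fix x assume "x \<in> K + seg p + seg (c *\<^sub>R p)"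
    then obtain k u v where x: "x = k + u *\<^sub>R p + v *\<^sub>R c *\<^sub>R p" "k \<in> K" "0 \<le> u" "u \<le> 1" "0 \<le> v" "v \<le> 1"
      by (auto simp: set_plus_def in_segment)
    show "x \<in> ?A \<union> ?B"
    proof (cases "u + v * c \<le> 1")
      case True
      have "(u + v * c) *\<^sub>R p \<in> seg p"
        using True x assms(2) by (auto simp: in_segment intro!: exI[of _ "u + v * c"])
      then have "k + (u + v * c) *\<^sub>R p \<in> ?A" using x by auto
      then show ?thesis using x by (simp add: algebra_simps)
    next
      case False
      then have "c > 0" using x assms(2) by (cases "c = 0") auto
      have "v * c \<le> c" using x(6) \<open>c > 0\<close> by simp
      then have "u + v * c - 1 \<le> c" using x(4) by linarith
      then have "((u + v * c - 1) / c) *\<^sub>R c *\<^sub>R p \<in> seg (c *\<^sub>R p)"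
        using False \<open>c > 0\<close> by (auto simp: in_segment field_simps intro!: exI[of _ "(u + v * c - 1) / c"])
      then have "p + (k + ((u + v * c - 1) / c) *\<^sub>R c *\<^sub>R p) \<in> ?B"
        using x(2) by (intro set_plus_intro) auto
      moreover have "p + (k + ((u + v * c - 1) / c) *\<^sub>R c *\<^sub>R p) = x"
      proof -
        have "((u + v * c - 1) / c) *\<^sub>R c *\<^sub>R p = (u + v * c - 1) *\<^sub>R p" using \<open>c > 0\<close> by simp
        then show ?thesis using x(1) by (simp add: algebra_simps)
      qed
      ultimately show ?thesis by simp
    qed
  qed
  then have "measure lebesgue (K + seg p + seg (c *\<^sub>R p)) \<le> measure lebesgue (?A \<union> ?B)"
    using lm assms(1)
    by (intro measure_mono_fmeasurable)
       (auto intro!: fmeasurableD lmeasurable_compact compact_set_plus simp: continuum_def)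
  moreover have "measure lebesgue (?A \<union> ?B) = measure lebesgue ?A + measure lebesgue ?B - measure lebesgue (?A \<inter> ?B)"
    using lm by (intro measure_Un3) auto
  moreover have "measure lebesgue ({p} + K) \<le> measure lebesgue (?A \<inter> ?B)"
  proof (intro measure_mono_fmeasurable)
    have "x + 0 \<in> K + seg (c *\<^sub>R p)" "p + x \<in> K + seg p" if "x \<in> K" for x
      using that unfolding add.commute[of p] by (auto intro!: set_plus_intro simp del: add_0_right)
    then show "{p} + K \<subseteq> ?A \<inter> ?B" by (auto simp: plus_singleton)
  qed (use lm in auto)
  ultimately show ?thesis by (simp add: plus_singleton measure_translation)
qed

text \<open>The linear map that sends the unit vectors to \<open>p\<close> and \<open>q\<close>
  multiplies all four areas by \<open>\<bar>cross2 p q\<bar>\<close>, so the unit square case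
  applies. For dependent vectors, a segment of opposite direction is a translate of one of equal
  direction.\<close>

lemma mixed_difference_segments:
  fixes K :: "(real^2) set"
  assumes K: "continuum K"
  shows "measure lebesgue (K + seg p + seg q) + measure lebesgue K
    \<le> measure lebesgue (K + seg p) + measure lebesgue (K + seg q) + \<bar>cross2 p q\<bar>"
proof (cases "cross2 p q = 0")
  case False
  define T :: "real^2 \<Rightarrow> real^2" where "T x = x$1 *\<^sub>R p + x$2 *\<^sub>R q" for x
  \<comment> \<open>The inverse of \<open>T\<close> by Cramer's rule.\<close>
  define S :: "real^2 \<Rightarrow> real^2" where
    "S y = vector [cross2 y q / cross2 p q, cross2 p y / cross2 p q]" for y
  have lin: "linear T" by (intro linearI) (simp_all add: T_def algebra_simps)
  have linS: "linear S"
    by (intro linearI) (simp_all add: S_def cross2_def vec_eq_iff forall_2 algebra_simps add_divide_distrib diff_divide_distrib)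
  have TS: "T (S y) = y" for y
  proof -
    have "cross2 y q * p$i + cross2 p y * q$i = cross2 p q * y$i" for i
    proof (cases "i = 1")
      case False
      then have "i = 2" using exhaust_2[of i] by auto
      then show ?thesis by (simp add: cross2_def algebra_simps)
    qed (simp add: cross2_def algebra_simps)
    then have "cross2 p q * (T (S y))$i = cross2 p q * y$i" for i
      using False by (simp add: T_def S_def field_simps)
    then show ?thesis using False by (simp add: vec_eq_iff)
  qed
  have det: "\<bar>det (matrix T)\<bar> = \<bar>cross2 p q\<bar>"
    by (simp add: det_2 matrix_def T_def axis_def cross2_def mult.commute)
  have m: "measure lebesgue (T ` A) = \<bar>cross2 p q\<bar> * measure lebesgue A" if "compact A" for A
    using measure_linear_image[OF lin lmeasurable_compact[OF that]] det by simp
  have K': "continuum (S ` K)"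
    using K linear_continuous_on[of S K] linS
    by (auto simp: continuum_def linear_conv_bounded_linear intro!: compact_continuous_image connected_continuous_image)
  let ?H = "closed_segment 0 (axis 1 1) :: (real^2) set" and ?V = "closed_segment 0 (axis 2 1) :: (real^2) set"
  have T: "T ` S ` K = K" using TS by (force simp: image_iff)
  have TH: "T ` ?H = seg p" "T ` ?V = seg q"
  proof -
    have "T 0 = 0" "T (axis 1 1) = p" "T (axis 2 1) = q" by (simp_all add: T_def axis_def)
    then show "T ` ?H = seg p" "T ` ?V = seg q"
      by (simp_all flip: closed_segment_linear_image[OF lin])
  qed
  have *: "K = T ` (S ` K)" "K + seg p = T ` (S ` K + ?H)" "K + seg q = T ` (S ` K + ?V)"
    "K + seg p + seg q = T ` (S ` K + ?H + ?V)"
    by (simp_all add: set_plus_linear_image[OF lin] TH T)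
  have c: "compact (S ` K)" "compact (S ` K + ?H)" "compact (S ` K + ?V)" "compact (S ` K + ?H + ?V)"
    using K' by (auto intro!: compact_set_plus simp: continuum_def)
  have "measure lebesgue (S ` K + ?H + ?V) + measure lebesgue (S ` K)
    \<le> measure lebesgue (S ` K + ?H) + measure lebesgue (S ` K + ?V) + 1"
    by (rule mixed_difference_unit_square[OF K'])
  from mult_left_mono[OF this, of "\<bar>cross2 p q\<bar>"]
  show ?thesis
    using m[OF c(1), folded *(1)] m[OF c(2), folded *(2)] m[OF c(3), folded *(3)] m[OF c(4), folded *(4)]
    by (simp only: distrib_left mult_1_right abs_ge_zero)
next
  case True
  show ?thesis
  proof (cases "p = 0")
    case False
    have "\<exists>c. q = c *\<^sub>R p"
    proof (cases "p$1 = 0")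
      case True
      then have "p$2 \<noteq> 0" using False by (auto simp: vec_eq_iff forall_2)
      then show ?thesis using \<open>cross2 p q = 0\<close> True
        by (intro exI[of _ "q$2 / p$2"]) (auto simp: cross2_def vec_eq_iff forall_2)
    next
      case False
      then show ?thesis using \<open>cross2 p q = 0\<close>
        by (intro exI[of _ "q$1 / p$1"]) (auto simp: cross2_def vec_eq_iff forall_2 field_simps)
    qed
    then obtain c where c: "q = c *\<^sub>R p" by auto
    show ?thesis
    proof (cases "c \<ge> 0")
      case True
      then show ?thesis using mixed_difference_parallel[OF K True, of p] c \<open>cross2 p q = 0\<close> by simp
    next
      case False
      have s: "seg q = {q} + seg ((- c) *\<^sub>R p)" using seg_minus[of "- q"] c by simp
      have "K + seg p + seg q = (+) q ` (K + seg p + seg ((- c) *\<^sub>R p))"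
        "K + seg q = (+) q ` (K + seg ((- c) *\<^sub>R p))"
        unfolding s plus_singleton[symmetric] by (simp_all add: ac_simps)
      then show ?thesis using mixed_difference_parallel[OF K, of "- c" p] False \<open>cross2 p q = 0\<close>
        by (simp add: measure_translation)
    qed
  qed (simp add: cross2_def closed_segment_idem)
qed

text \<open>A zonotope. Its segments start at the origin, so its centre of symmetry is not 0 in
  general but \<open>zono_centre\<close> below.\<close>

primrec zono :: "(real^2) list \<Rightarrow> (real^2) set" where
  "zono [] = {0}"
| "zono (p # ps) = seg p + zono ps"

lemma continuum_zono: "continuum (zono ps)"
  by (induction ps) (auto simp: continuum_set_plus continuum_closed_segment, simp add: continuum_def)

lemma plus_zero_set: "A + {0} = (A :: 'a::monoid_add set)"
  by (auto simp: set_plus_def)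

text \<open>For the zonotopes \<open>Z\<close> and \<open>Z'\<close> of the two lists this is the
  area of \<open>Z + Z'\<close> minus the areas of \<open>Z\<close> and \<open>Z'\<close>, twice the
  classical mixed area. For \<open>ps = qs\<close> it is twice the area of the zonotope.\<close>

definition mixed_area :: "(real^2) list \<Rightarrow> (real^2) list \<Rightarrow> real" where
  "mixed_area ps qs = (\<Sum>p\<leftarrow>ps. \<Sum>q\<leftarrow>qs. \<bar>cross2 p q\<bar>)"

text \<open>Segments are added one at a time in both lists. Each intermediate sum is again a
  continuum, so the inequality for two segments applies at every stage and the differences
  telescope.\<close>

lemma mixed_difference_zono:
  assumes "continuum K"
  shows "measure lebesgue (K + zono ps + zono qs) + measure lebesgue K
    \<le> measure lebesgue (K + zono ps) + measure lebesgue (K + zono qs) + mixed_area ps qs"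
  using assms
proof (induction ps arbitrary: K)
  case Nil
  then show ?case by (simp add: plus_zero_set mixed_area_def)
next
  case (Cons p ps)
  have 1: "measure lebesgue (K + seg p + zono qs) + measure lebesgue K
    \<le> measure lebesgue (K + seg p) + measure lebesgue (K + zono qs) + (\<Sum>q\<leftarrow>qs. \<bar>cross2 p q\<bar>)"
    if "continuum K" for K
    using that
  proof (induction qs arbitrary: K)
    case Nil
    then show ?case by (simp add: plus_zero_set)
  next
    case (Cons q qs)
    have "measure lebesgue (K + seg q + seg p + zono qs) + measure lebesgue (K + seg q)
      \<le> measure lebesgue (K + seg q + seg p) + measure lebesgue (K + seg q + zono qs) + (\<Sum>q\<leftarrow>qs. \<bar>cross2 p q\<bar>)"
      by (intro Cons.IH continuum_set_plus Cons.prems continuum_closed_segment)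
    then show ?case using mixed_difference_segments[OF Cons.prems, of p q]
      by (simp add: ac_simps)
  qed
  have "measure lebesgue (K + seg p + zono ps + zono qs) + measure lebesgue (K + seg p)
    \<le> measure lebesgue (K + seg p + zono ps) + measure lebesgue (K + seg p + zono qs) + mixed_area ps qs"
    by (intro Cons.IH continuum_set_plus Cons.prems continuum_closed_segment)
  then show ?case using 1[OF Cons.prems] by (simp add: mixed_area_def ac_simps)
qed

lemma seg_scaleR_plus:
  assumes "0 \<le> a" "0 \<le> b" shows "seg (a *\<^sub>R p) + seg (b *\<^sub>R p) = seg ((a + b) *\<^sub>R p)"
proof (intro equalityI subsetI)
  fix x assume "x \<in> seg (a *\<^sub>R p) + seg (b *\<^sub>R p)"
  then obtain u v where x: "x = (u * a + v * b) *\<^sub>R p" "0 \<le> u" "u \<le> 1" "0 \<le> v" "v \<le> 1"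
    by (auto simp: set_plus_def in_segment scaleR_add_left)
  show "x \<in> seg ((a + b) *\<^sub>R p)"
  proof (cases "a + b = 0")
    case True
    then have "a = 0" "b = 0" using assms by auto
    then show ?thesis using x by simp
  next
    case False
    have "u * a + v * b \<le> a + b"
      using x assms mult_right_mono[of u 1 a] mult_right_mono[of v 1 b] by auto
    then show ?thesis using False x assms
      by (auto simp: in_segment intro!: exI[of _ "(u * a + v * b) / (a + b)"])
  qed
next
  fix x assume "x \<in> seg ((a + b) *\<^sub>R p)"
  then obtain u where u: "x = u *\<^sub>R a *\<^sub>R p + u *\<^sub>R b *\<^sub>R p" "0 \<le> u" "u \<le> 1"
    by (auto simp: in_segment algebra_simps)
  then show "x \<in> seg (a *\<^sub>R p) + seg (b *\<^sub>R p)"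
    by (auto simp: in_segment intro!: set_plus_intro)
qed

lemma zono_scaleR_plus:
  assumes "0 \<le> a" "0 \<le> b"
  shows "zono (map ((*\<^sub>R) a) ps) + zono (map ((*\<^sub>R) b) ps) = zono (map ((*\<^sub>R) (a + b)) ps)"
proof (induction ps)
  case (Cons p ps)
  then show ?case
    by (simp add: seg_scaleR_plus[OF assms, symmetric] add.assoc add.left_commute[of "zono _" "seg _"])
qed (simp add: plus_zero_set)

lemma mixed_area_scaleR:
  assumes "0 \<le> a"
  shows "mixed_area (map ((*\<^sub>R) a) ps) (map ((*\<^sub>R) a) qs) = a\<^sup>2 * mixed_area ps qs"
proof -
  have "\<bar>cross2 (a *\<^sub>R p) (a *\<^sub>R q)\<bar> = a\<^sup>2 * \<bar>cross2 p q\<bar>" for p q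
  proof -
    have "cross2 (a *\<^sub>R p) (a *\<^sub>R q) = a\<^sup>2 * cross2 p q"
      by (simp add: cross2_def power2_eq_square algebra_simps)
    then show ?thesis by (simp add: abs_mult)
  qed
  then show ?thesis by (simp add: mixed_area_def comp_def sum_list_const_mult)
qed

text \<open>With \<open>h = t / N\<close>, the areas at the times \<open>n * h\<close> have second
  differences of at most \<open>h\<^sup>2 * mixed_area ps ps\<close>, since the intermediate sums
  are continua. Summing twice bounds the total growth by \<open>N\<close> times the first increment
  plus \<open>N * (N - 1) / 2\<close> such terms.\<close>

lemma zono_growth:
  fixes N :: nat
  assumes K: "continuum K" and t: "0 \<le> t" and N: "N > 0"
  shows "measure lebesgue (K + zono (map ((*\<^sub>R) t) ps)) - measure lebesgue K
    \<le> N * (measure lebesgue (K + zono (map ((*\<^sub>R) (t / real N)) ps)) - measure lebesgue K)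
      + t\<^sup>2 * mixed_area ps ps / 2"
proof -
  define h where "h = t / N"
  define W where "W n = measure lebesgue (K + zono (map ((*\<^sub>R) (real n * h)) ps))" for n :: nat
  have h: "0 \<le> h" using t N by (simp add: h_def)
  let ?M = "mixed_area ps ps"
  have z: "zono (map ((*\<^sub>R) (real n * h)) ps) + zono (map ((*\<^sub>R) h) ps) = zono (map ((*\<^sub>R) (real (Suc n) * h)) ps)" for n
    using zono_scaleR_plus[of "real n * h" h ps] h by (simp add: algebra_simps)
  have W0: "W 0 = measure lebesgue K"
  proof -
    have "zono (map ((*\<^sub>R) 0) ps) = {0}" by (induction ps) (auto simp: plus_zero_set)
    then show ?thesis by (simp add: W_def plus_zero_set)
  qed
  have D: "W (Suc (Suc n)) - W (Suc n) \<le> W (Suc n) - W n + h\<^sup>2 * ?M" for n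
  proof -
    let ?K = "K + zono (map ((*\<^sub>R) (real n * h)) ps)" and ?Z = "zono (map ((*\<^sub>R) h) ps)"
    have "measure lebesgue (?K + ?Z + ?Z) + measure lebesgue ?K
       \<le> measure lebesgue (?K + ?Z) + measure lebesgue (?K + ?Z) + h\<^sup>2 * ?M"
      using mixed_difference_zono[OF continuum_set_plus[OF K continuum_zono], of _ "map ((*\<^sub>R) h) ps" "map ((*\<^sub>R) h) ps"]
      by (simp add: mixed_area_scaleR h)
    moreover have "?K + ?Z = K + zono (map ((*\<^sub>R) (real (Suc n) * h)) ps)"
      "?K + ?Z + ?Z = K + zono (map ((*\<^sub>R) (real (Suc (Suc n)) * h)) ps)"
      by (simp_all only: add.assoc[of K] z)
    ultimately show ?thesis by (simp add: W_def del: of_nat_Suc)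
  qed
  have D1: "W (Suc n) - W n \<le> W 1 - W 0 + n * (h\<^sup>2 * ?M)" for n
  proof (induction n)
    case (Suc n)
    then show ?case using D[of n] by (simp add: algebra_simps)
  qed simp
  have "W n - W 0 \<le> n * (W 1 - W 0) + real n * (real n - 1) / 2 * (h\<^sup>2 * ?M)" for n
  proof (induction n)
    case (Suc n)
    then have "W (Suc n) - W 0 \<le> n * (W 1 - W 0) + real n * (real n - 1) / 2 * (h\<^sup>2 * ?M) + (W 1 - W 0 + n * (h\<^sup>2 * ?M))"
      using D1[of n] by linarith
    also have "\<dots> = real (Suc n) * (W 1 - W 0) + real (Suc n) * (real (Suc n) - 1) / 2 * (h\<^sup>2 * ?M)"
      by (simp add: field_simps)
    finally show ?case .
  qed simp
  from this[of N] have "W N - W 0 \<le> N * (W 1 - W 0) + real N * (real N - 1) / 2 * (h\<^sup>2 * ?M)" .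
  also have "\<dots> \<le> N * (W 1 - W 0) + (real N)\<^sup>2 / 2 * (h\<^sup>2 * ?M)"
  proof -
    have "0 \<le> ?M" unfolding mixed_area_def by (auto intro!: sum_list_nonneg)
    then show ?thesis
      by (intro add_left_mono mult_right_mono) (auto simp: power2_eq_square algebra_simps h)
  qed
  also have "(real N)\<^sup>2 / 2 * (h\<^sup>2 * ?M) = t\<^sup>2 * ?M / 2"
    using N by (simp add: h_def power_divide)
  finally show ?thesis using N unfolding W0 by (simp add: W_def h_def)
qed

section \<open>Approximation of the disk by zonotopes\<close>

lemma abs_cos_lipschitz: "\<bar>\<bar>cos x\<bar> - \<bar>cos y\<bar>\<bar> \<le> \<bar>x - y\<bar>" for x y :: real
proof -
  have "\<bar>cos x - cos y\<bar> = 2 * (\<bar>sin ((x + y) / 2)\<bar> * \<bar>sin ((y - x) / 2)\<bar>)"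
    by (simp add: cos_diff_cos abs_mult)
  also have "\<dots> \<le> 2 * (1 * \<bar>(y - x) / 2\<bar>)"
    by (intro mult_left_mono mult_mono abs_sin_x_le_abs_x abs_sin_le_one) auto
  finally have "\<bar>cos x - cos y\<bar> \<le> \<bar>x - y\<bar>" by (simp add: abs_minus_commute)
  then show ?thesis by linarith
qed

text \<open>Half of this integral is the half width, in direction \<open>\<theta>\<close>, of the
  sum of infinitesimal segments in all directions of a half circle. It is 1 in every direction, so
  the limit body is the unit disk.\<close>

lemma integral_abs_cos:
  assumes "0 \<le> \<theta>" "\<theta> \<le> pi"
  shows "((\<lambda>s. \<bar>cos (\<theta> - s)\<bar>) has_integral 2) {0..pi}"
proof -
  have I: "((\<lambda>s. \<bar>cos (\<theta> - s)\<bar>) has_integral (- sin (\<theta> - b)) - (- sin (\<theta> - a))) {a..b}"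
    if "a \<le> b" "\<And>s. s \<in> {a..b} \<Longrightarrow> 0 \<le> cos (\<theta> - s)" for a b
  proof (rule has_integral_eq)
    show "((\<lambda>s. cos (\<theta> - s)) has_integral (- sin (\<theta> - b)) - (- sin (\<theta> - a))) {a..b}"
      by (rule fundamental_theorem_of_calculus[OF that(1)])
         (auto intro!: derivative_eq_intros simp flip: has_real_derivative_iff_has_vector_derivative)
  qed (use that in auto)
  have J: "((\<lambda>s. \<bar>cos (\<theta> - s)\<bar>) has_integral sin (\<theta> - b) - sin (\<theta> - a)) {a..b}"
    if "a \<le> b" "\<And>s. s \<in> {a..b} \<Longrightarrow> cos (\<theta> - s) \<le> 0" for a b
  proof (rule has_integral_eq)
    show "((\<lambda>s. - cos (\<theta> - s)) has_integral sin (\<theta> - b) - sin (\<theta> - a)) {a..b}"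
      by (rule fundamental_theorem_of_calculus[OF that(1)])
         (auto intro!: derivative_eq_intros simp flip: has_real_derivative_iff_has_vector_derivative)
  qed (use that in auto)
  show ?thesis
  proof (cases "\<theta> \<le> pi / 2")
    case True
    have "((\<lambda>s. \<bar>cos (\<theta> - s)\<bar>) has_integral (- sin (\<theta> - (\<theta> + pi / 2))) - (- sin (\<theta> - 0))) {0..\<theta> + pi / 2}"
      by (rule I) (use assms True in \<open>auto intro!: cos_ge_zero\<close>)
    moreover have "((\<lambda>s. \<bar>cos (\<theta> - s)\<bar>) has_integral sin (\<theta> - pi) - sin (\<theta> - (\<theta> + pi / 2))) {\<theta> + pi / 2..pi}"
    proof (rule J)
      fix s assume "s \<in> {\<theta> + pi / 2..pi}"
      then have "0 \<le> cos (s - \<theta> - pi)" using assms True by (intro cos_ge_zero) auto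
      then show "cos (\<theta> - s) \<le> 0" using cos_minus[of "s - \<theta>"] by simp
    qed (use True in auto)
    ultimately have "((\<lambda>s. \<bar>cos (\<theta> - s)\<bar>) has_integral
      ((- sin (\<theta> - (\<theta> + pi / 2))) - (- sin (\<theta> - 0))) + (sin (\<theta> - pi) - sin (\<theta> - (\<theta> + pi / 2)))) {0..pi}"
      using assms True by (intro has_integral_combine[of 0 "\<theta> + pi / 2"]) auto
    then show ?thesis by simp
  next
    case False
    have "((\<lambda>s. \<bar>cos (\<theta> - s)\<bar>) has_integral sin (\<theta> - (\<theta> - pi / 2)) - sin (\<theta> - 0)) {0..\<theta> - pi / 2}"
    proof (rule J)
      fix s assume "s \<in> {0..\<theta> - pi / 2}"
      then have "0 \<le> cos (\<theta> - s - pi)" using assms False by (intro cos_ge_zero) auto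
      then show "cos (\<theta> - s) \<le> 0" by simp
    qed (use False in auto)
    moreover have "((\<lambda>s. \<bar>cos (\<theta> - s)\<bar>) has_integral (- sin (\<theta> - pi)) - (- sin (\<theta> - (\<theta> - pi / 2)))) {\<theta> - pi / 2..pi}"
      by (rule I) (use assms False in \<open>auto intro!: cos_ge_zero\<close>)
    ultimately have "((\<lambda>s. \<bar>cos (\<theta> - s)\<bar>) has_integral
      (sin (\<theta> - (\<theta> - pi / 2)) - sin (\<theta> - 0)) + ((- sin (\<theta> - pi)) - (- sin (\<theta> - (\<theta> - pi / 2))))) {0..pi}"
      using assms False by (intro has_integral_combine[of 0 "\<theta> - pi / 2"]) auto
    then show ?thesis by simp
  qed
qed

text \<open>The integrand is 1-Lipschitz, so each of the \<open>m\<close> cells of length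
  \<open>pi / m\<close> contributes an error of at most \<open>(pi / m)\<^sup>2\<close>.\<close>

lemma riemann_sum_abs_cos:
  fixes m :: nat
  assumes "0 \<le> \<theta>" "\<theta> \<le> pi" "m > 0"
  shows "\<bar>(\<Sum>k<m. pi / m * \<bar>cos (\<theta> - k * pi / m)\<bar>) - 2\<bar> \<le> pi\<^sup>2 / m"
proof -
  define f where "f s = \<bar>cos (\<theta> - s)\<bar>" for s
  define \<Phi> where "\<Phi> s = integral {0..s} f" for s
  define x where "x k = k * pi / m" for k :: nat
  have cont: "continuous_on S f" for S unfolding f_def by (intro continuous_intros)
  have xs: "x k \<le> x (Suc k)" "x (Suc k) - x k = pi / m" "0 \<le> x k" for k
    using assms(3) by (auto simp: x_def field_simps)
  have step: "\<bar>\<Phi> (x (Suc k)) - \<Phi> (x k) - pi / m * f (x k)\<bar> \<le> (pi / m)\<^sup>2" for k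
  proof -
    let ?I = "{x k..x (Suc k)}"
    have "\<Phi> (x (Suc k)) - \<Phi> (x k) = integral ?I f"
      using Henstock_Kurzweil_Integration.integral_combine[where a = 0 and c = "x k" and b = "x (Suc k)" and f = f] xs integrable_continuous_real[OF cont]
      by (simp add: \<Phi>_def)
    moreover have HI: "((\<lambda>s. f s - f (x k)) has_integral integral ?I f - pi / m * f (x k)) ?I"
    proof (intro has_integral_diff)
      show "(f has_integral integral ?I f) ?I"
        by (intro integrable_integral integrable_continuous_real cont)
      show "((\<lambda>s. f (x k)) has_integral pi / m * f (x k)) ?I"
        using has_integral_const_real[of "f (x k)" "x k" "x (Suc k)"] xs by simp
    qed
    have "norm (integral ?I f - pi / m * f (x k)) \<le> (pi / m) * measure lborel ?I"
    proof (rule has_integral_bound_real[OF _ finite.emptyI HI])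
      show "norm (f s - f (x k)) \<le> pi / m" if s: "s \<in> ?I - {}" for s
      proof -
        have "\<bar>f s - f (x k)\<bar> \<le> \<bar>s - x k\<bar>"
          using abs_cos_lipschitz[of "\<theta> - s" "\<theta> - x k"] by (simp add: f_def)
        also have "\<dots> \<le> pi / m" using s xs(2)[of k] by auto
        finally show ?thesis by simp
      qed
    qed (use assms(3) in simp)
    ultimately show ?thesis using xs[of k] by (simp add: power2_eq_square)
  qed
  have "\<Phi> (x m) - \<Phi> (x 0) = (\<Sum>k<m. \<Phi> (x (Suc k)) - \<Phi> (x k))"
    by (rule sum_lessThan_telescope[of "\<lambda>k. \<Phi> (x k)" m, symmetric])
  moreover have "\<Phi> (x m) = 2" "\<Phi> (x 0) = 0"
    using integral_unique[OF integral_abs_cos[OF assms(1,2)]] assms(3) by (simp_all add: \<Phi>_def x_def f_def[abs_def])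
  ultimately have "\<bar>(\<Sum>k<m. pi / m * f (x k)) - 2\<bar> = \<bar>\<Sum>k<m. \<Phi> (x (Suc k)) - \<Phi> (x k) - pi / m * f (x k)\<bar>"
    by (simp add: sum_subtractf)
  also have "\<dots> \<le> (\<Sum>k<m. (pi / m)\<^sup>2)"
    by (rule order_trans[OF sum_abs sum_mono[OF step]])
  also have "\<dots> = pi\<^sup>2 / m" using assms(3) by (simp add: power2_eq_square)
  finally show ?thesis by (simp add: f_def x_def)
qed

text \<open>The support function of \<open>zono ps\<close> after moving its centre to the
  origin.\<close>

definition half_width :: "(real^2) list \<Rightarrow> real^2 \<Rightarrow> real" where
  "half_width ps x = (\<Sum>p\<leftarrow>ps. \<bar>x \<bullet> p\<bar> / 2)"

definition zono_centre :: "(real^2) list \<Rightarrow> real^2" where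
  "zono_centre ps = sum_list ps /\<^sub>R 2"

lemma zono_width_le:
  "z \<in> zono ps \<Longrightarrow> x \<bullet> (z - zono_centre ps) \<le> half_width ps x"
proof (induction ps arbitrary: z)
  case (Cons p ps)
  then obtain u w where z: "z = u *\<^sub>R p + w" "0 \<le> u" "u \<le> 1" "w \<in> zono ps"
    by (auto simp: set_plus_def in_segment)
  have "(u - 1/2) * (x \<bullet> p) \<le> \<bar>u - 1/2\<bar> * \<bar>x \<bullet> p\<bar>" by (metis abs_ge_self abs_mult)
  also have "\<dots> \<le> 1/2 * \<bar>x \<bullet> p\<bar>" using z by (intro mult_right_mono) (auto simp: abs_le_iff field_simps)
  finally show ?case using Cons.IH[OF z(4)] z(1)
    by (simp add: half_width_def zono_centre_def algebra_simps)
qed (simp add: half_width_def zono_centre_def)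

lemma zono_width_attained:
  "\<exists>z\<in>zono ps. x \<bullet> (z - zono_centre ps) = half_width ps x"
proof (induction ps)
  case (Cons p ps)
  then obtain w where w: "w \<in> zono ps" "x \<bullet> (w - zono_centre ps) = half_width ps x" by auto
  let ?q = "if x \<bullet> p \<ge> 0 then p else 0"
  have "?q \<in> seg p" by auto
  then have "?q + w \<in> zono (p # ps)" using w(1) by (auto intro!: set_plus_intro simp del: add_0_left)
  moreover have "x \<bullet> (?q + w - zono_centre (p # ps)) = half_width (p # ps) x"
    using w(2) by (auto simp: half_width_def zono_centre_def algebra_simps)
  ultimately show ?case by blast
qed (simp add: half_width_def zono_centre_def)

lemma convex_zono: "convex (zono ps)"
proof (induction ps)
  case (Cons p ps)
  then show ?case using convex_set_plus[of "seg p" "zono ps"] by simp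
qed simp

text \<open>A closed convex set contains every point that obeys all its support inequalities. The
  separating functional \<open>a\<close> is smaller at the excluded point, so the violated
  inequality is the one for \<open>- a\<close>.\<close>

lemma mem_zonoI:
  assumes "\<And>x. x \<bullet> y \<le> half_width ps x"
  shows "zono_centre ps + y \<in> zono ps"
proof (rule ccontr)
  assume "zono_centre ps + y \<notin> zono ps"
  moreover have "closed (zono ps)"
    using continuum_zono by (auto simp: continuum_def compact_imp_closed)
  ultimately obtain a b where ab: "a \<bullet> (zono_centre ps + y) < b" "\<forall>x\<in>zono ps. b < a \<bullet> x"
    using separating_hyperplane_closed_point[OF convex_zono] by blast
  obtain z where z: "z \<in> zono ps" "(- a) \<bullet> (z - zono_centre ps) = half_width ps (- a)"
    using zono_width_attained by blast
  show False using ab z assms[of "- a"] by (auto simp: algebra_simps)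
qed

lemma zono_subset_cball:
  assumes "\<And>x. half_width ps x \<le> R * norm x"
  shows "zono ps \<subseteq> {zono_centre ps} + cball 0 R"
proof
  fix z assume z: "z \<in> zono ps"
  let ?x = "z - zono_centre ps"
  have "norm ?x * norm ?x \<le> R * norm ?x"
    using zono_width_le[OF z, of ?x] assms[of ?x]
    by (simp add: dot_square_norm power2_eq_square)
  moreover
  have "0 \<le> half_width ps (axis 1 1)"
    unfolding half_width_def by (rule sum_list_nonneg) auto
  then have "0 \<le> R" using assms[of "axis 1 1"] by simp
  ultimately have "norm ?x \<le> R" by (cases "?x = 0") auto
  then show "z \<in> {zono_centre ps} + cball 0 R" by (simp add: plus_singleton dist_norm norm_minus_commute)
qed

lemma cball_subset_zono:
  assumes "\<And>x. R * norm x \<le> half_width ps x"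
  shows "{zono_centre ps} + cball 0 R \<subseteq> zono ps"
proof
  fix z assume "z \<in> {zono_centre ps} + cball 0 R"
  then obtain y where y: "z = zono_centre ps + y" "norm y \<le> R" by (auto simp: set_plus_def)
  have "x \<bullet> y \<le> half_width ps x" for x
  proof -
    have "x \<bullet> y \<le> norm x * norm y" by (rule norm_cauchy_schwarz)
    also have "\<dots> \<le> R * norm x" using mult_right_mono[OF y(2), of "norm x"] by (simp add: mult.commute)
    finally show ?thesis using assms[of x] by linarith
  qed
  then show "z \<in> zono ps" using mem_zonoI y by blast
qed

text \<open>Half a circle of directions is enough, because opposite segments give translates of each
  other. The length \<open>pi / m\<close> normalises the half width to that of the unit disk in the
  limit.\<close>

definition fan :: "nat \<Rightarrow> (real^2) list" where
  "fan m = map (\<lambda>k. (pi / m) *\<^sub>R vector [cos (k * pi / m), sin (k * pi / m)]) [0..<m]"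

text \<open>In polar coordinates the half width is \<open>norm x / 2\<close> times the Riemann sum
  of \<open>riemann_sum_abs_cos\<close>. As \<open>half_width\<close> is even, only the upper half
  plane, with angles between 0 and \<open>pi\<close>, has to be treated.\<close>

lemma half_width_fan:
  assumes "m > 0"
  shows "\<bar>half_width (fan m) x - norm x\<bar> \<le> pi\<^sup>2 / (2 * m) * norm x"
proof -
  have polar: "\<exists>\<theta>. 0 \<le> \<theta> \<and> \<theta> \<le> pi \<and> (x = norm x *\<^sub>R vector [cos \<theta>, sin \<theta>])" if "0 \<le> x$2" for x :: "real^2"
  proof (cases "x = 0")
    case False
    have "(norm x)\<^sup>2 = (x$1)\<^sup>2 + (x$2)\<^sup>2"
      by (simp add: norm_vec_def L2_set_def sum_2)
    moreover have "(norm x)\<^sup>2 \<noteq> 0" using False by simp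
    ultimately have "(x$1 / norm x)\<^sup>2 + (x$2 / norm x)\<^sup>2 = 1"
      by (simp only: power_divide add_divide_distrib[symmetric] divide_self not_False_eq_True)
    moreover have "0 \<le> x$2 / norm x" using that by simp
    ultimately obtain t where "0 \<le> t" "t \<le> pi" "x$1 / norm x = cos t" "x$2 / norm x = sin t"
      using sincos_total_pi[of "x$2 / norm x" "x$1 / norm x"] by auto
    then show ?thesis using False by (intro exI[of _ t]) (simp add: vec_eq_iff forall_2 flip: \<open>x$1 / norm x = cos t\<close> \<open>x$2 / norm x = sin t\<close>)
  qed (auto intro: exI[of _ 0])
  have main: "\<bar>half_width (fan m) x - norm x\<bar> \<le> pi\<^sup>2 / (2 * m) * norm x"
    if "x = norm x *\<^sub>R vector [cos \<theta>, sin \<theta>]" "0 \<le> \<theta>" "\<theta> \<le> pi" for x :: "real^2" and \<theta>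
  proof -
    have "half_width (fan m) x = (\<Sum>k<m. \<bar>x \<bullet> ((pi / m) *\<^sub>R vector [cos (k * pi / m), sin (k * pi / m)])\<bar> / 2)"
      by (simp add: half_width_def fan_def comp_def interv_sum_list_conv_sum_set_nat atLeast0LessThan)
    also have "\<dots> = (\<Sum>k<m. norm x / 2 * (pi / m * \<bar>cos (\<theta> - k * pi / m)\<bar>))"
    proof (intro sum.cong refl)
      fix k
      have "x \<bullet> ((pi / m) *\<^sub>R vector [cos (k * pi / m), sin (k * pi / m)])
        = norm x * (pi / m * cos (\<theta> - k * pi / m))"
        by (subst that(1)) (simp add: inner_vec_def sum_2 cos_diff algebra_simps)
      then show "\<bar>x \<bullet> ((pi / m) *\<^sub>R vector [cos (k * pi / m), sin (k * pi / m)])\<bar> / 2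
        = norm x / 2 * (pi / m * \<bar>cos (\<theta> - k * pi / m)\<bar>)"
        by (simp only: abs_mult abs_norm_cancel) simp
    qed
    also have "\<dots> = norm x / 2 * (\<Sum>k<m. pi / m * \<bar>cos (\<theta> - k * pi / m)\<bar>)"
      by (simp add: sum_distrib_left)
    finally have "half_width (fan m) x - norm x = norm x / 2 * ((\<Sum>k<m. pi / m * \<bar>cos (\<theta> - k * pi / m)\<bar>) - 2)"
      by (simp add: algebra_simps)
    then have "\<bar>half_width (fan m) x - norm x\<bar> = norm x / 2 * \<bar>(\<Sum>k<m. pi / m * \<bar>cos (\<theta> - k * pi / m)\<bar>) - 2\<bar>"
      by (simp only: abs_mult) simp
    also have "\<dots> \<le> norm x / 2 * (pi\<^sup>2 / m)"
      by (intro mult_left_mono riemann_sum_abs_cos that assms) auto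
    finally show ?thesis by (simp add: field_simps)
  qed
  show ?thesis
  proof (cases "0 \<le> x$2")
    case True
    then show ?thesis using polar main by blast
  next
    case False
    then obtain \<theta> where "0 \<le> \<theta>" "\<theta> \<le> pi" "- x = norm (- x) *\<^sub>R vector [cos \<theta>, sin \<theta>]"
      using polar[of "- x"] by auto
    then have "\<bar>half_width (fan m) (- x) - norm (- x)\<bar> \<le> pi\<^sup>2 / (2 * m) * norm (- x)"
      using main by blast
    then show ?thesis by (simp add: half_width_def)
  qed
qed

lemma half_width_scaleR: "0 \<le> t \<Longrightarrow> half_width (map ((*\<^sub>R) t) ps) x = t * half_width ps x"
  by (induction ps) (simp_all add: half_width_def abs_mult algebra_simps)

text \<open>\<open>cross2 p q\<close> is the inner product of \<open>q\<close> with the rotated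
  vector \<open>J p\<close>, so the inner sum is twice a half width. The limit \<open>2 * pi\<close>
  is twice the area of the unit disk.\<close>

lemma mixed_area_fan:
  assumes "m > 0"
  shows "mixed_area (fan m) (fan m) \<le> 2 * pi * (1 + pi\<^sup>2 / (2 * m))"
proof -
  define J where "J p = (vector [- p$2, p$1] :: real^2)" for p :: "real^2"
  have J: "cross2 p q = J p \<bullet> q" for p q by (simp add: J_def cross2_def inner_vec_def sum_2)
  have nJ: "norm (J p) = pi / m" if p: "p \<in> set (fan m)" for p
  proof -
    obtain k :: nat where "p = (pi / m) *\<^sub>R vector [cos (k * pi / m), sin (k * pi / m)]"
      using p by (auto simp: fan_def)
    then have "(norm (J p))\<^sup>2 = (pi / m * sin (k * pi / m))\<^sup>2 + (pi / m * cos (k * pi / m))\<^sup>2"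
      by (simp add: J_def norm_vec_def L2_set_def sum_2)
    also have "\<dots> = (pi / m)\<^sup>2 * ((sin (k * pi / m))\<^sup>2 + (cos (k * pi / m))\<^sup>2)"
      by (simp only: power_mult_distrib distrib_left)
    finally have "(norm (J p))\<^sup>2 = (pi / m)\<^sup>2" by simp
    then show ?thesis by (simp add: power2_eq_iff_nonneg)
  qed
  have "mixed_area (fan m) (fan m) = (\<Sum>p\<leftarrow>fan m. 2 * half_width (fan m) (J p))"
    by (simp add: mixed_area_def half_width_def J sum_list_const_mult[symmetric])
  also have "\<dots> \<le> (\<Sum>p\<leftarrow>fan m. 2 * ((1 + pi\<^sup>2 / (2 * m)) * (pi / m)))"
  proof (rule sum_list_mono)
    fix p assume p: "p \<in> set (fan m)"
    show "2 * half_width (fan m) (J p) \<le> 2 * ((1 + pi\<^sup>2 / (2 * m)) * (pi / m))"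
    proof -
      have "half_width (fan m) (J p) - norm (J p) \<le> pi\<^sup>2 / (2 * m) * norm (J p)"
        using half_width_fan[OF assms, of "J p"] by (rule abs_le_D1)
      then have "half_width (fan m) (J p) \<le> (1 + pi\<^sup>2 / (2 * m)) * norm (J p)"
        by (simp add: distrib_right)
      then show ?thesis unfolding nJ[OF p] by simp
    qed
  qed
  also have "\<dots> = 2 * pi * (1 + pi\<^sup>2 / (2 * m))"
    using assms by (simp add: fan_def sum_list_triv)
  finally show ?thesis .
qed

text \<open>In the limit of fine fans, which approximate the disk, \<open>zono_growth\<close> says that
  \<open>measure (parallel_set K t) - \<pi> t\<^sup>2\<close> lies below its tangent at \<open>t = 0\<close>.\<close>

lemma parallel_set_area_le:
  fixes K :: "(real^2) set"
  assumes K: "continuum K" and c: "has_outer_minkowski_content K c" "c \<le> ennreal L"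
    and L: "0 \<le> L" and t: "0 < t"
  shows "measure lebesgue (parallel_set K t) - measure lebesgue K \<le> L * t + pi * t\<^sup>2"
proof -
  have K': "compact K" "K \<noteq> {}" using K by (auto simp: continuum_def)
  define A where "A t = measure lebesgue (parallel_set K t) - measure lebesgue K" for t
  have lm: "K \<in> lmeasurable" "parallel_set K t \<in> lmeasurable" for t
    using compact_parallel_set[OF K'] K'(1) by (auto intro: lmeasurable_compact)
  \<comment> \<open>The content enters here, as a bound on the slope at 0. The loss \<open>s\<close>
    is removed before the fans are refined.\<close>
  have A_small: "\<exists>d>0. \<forall>e. 0 < e \<and> e < d \<longrightarrow> A e \<le> (L + s) * e" if s: "s > 0" for s
  proof -
    have "c < ennreal (L + s)"
      using c(2) s L by (meson ennreal_lessI le_less_trans less_add_same_cancel1 add_nonneg_pos)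
    then have "\<forall>\<^sub>F e in at_right 0. emeasure lebesgue (parallel_set K e - K) / ennreal e < ennreal (L + s)"
      using c(1) order_tendstoD(2) unfolding has_outer_minkowski_content_def by blast
    then obtain d where d: "d > 0" "\<And>e. 0 < e \<Longrightarrow> e < d \<Longrightarrow>
        emeasure lebesgue (parallel_set K e - K) / ennreal e < ennreal (L + s)"
      unfolding eventually_at_right_field by auto
    have "A e \<le> (L + s) * e" if e: "0 < e" "e < d" for e
    proof -
      have "emeasure lebesgue (parallel_set K e - K) = ennreal (A e)"
        using lm measurable_measure_Diff[of "parallel_set K e" lebesgue K] e subset_parallel_set[of e K]
        by (subst emeasure_eq_measure2) (auto simp: A_def fmeasurableD simp del: emeasure_completion measure_completion)
      then have "ennreal (A e) / ennreal e < ennreal (L + s)" using d(2)[OF e] by simp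
      moreover have "0 \<le> A e"
        using measure_mono_fmeasurable[OF subset_parallel_set[of e K], of lebesgue] lm e
        by (simp add: A_def fmeasurableD)
      ultimately have "ennreal (A e / e) < ennreal (L + s)" using e by (simp add: divide_ennreal)
      then have "A e / e < L + s" using L s by (subst (asm) ennreal_less_iff) (auto simp: \<open>0 \<le> A e\<close> e less_imp_le)
      then show ?thesis using e by (simp add: field_simps)
    qed
    then show ?thesis using d(1) by blast
  qed
  \<comment> \<open>Around its centre, \<open>Z t\<close> contains the disk of radius
    \<open>(1 - \<eta>) * t\<close> and lies in that of radius \<open>(1 + \<eta>) * t\<close>. The
    translations by the centre do not change areas.\<close>
  have fan: "A ((1 - \<eta>) * t) \<le> (1 + \<eta>) * (L * t + pi * t\<^sup>2)"
    if m: "m > 0" and eta: "\<eta> = pi\<^sup>2 / (2 * real m)" and t: "t > 0" for m :: nat and \<eta> t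
  proof -
    define Z where "Z t = zono (map ((*\<^sub>R) t) (fan m))" for t
    define v where "v t = zono_centre (map ((*\<^sub>R) t) (fan m))" for t
    have eta0: "0 < \<eta>" using m eta by simp
    have hw: "half_width (map ((*\<^sub>R) t) (fan m)) x \<le> ((1 + \<eta>) * t) * norm x"
      "((1 - \<eta>) * t) * norm x \<le> half_width (map ((*\<^sub>R) t) (fan m)) x" if "0 \<le> t" for t x
    proof -
      have "\<bar>half_width (fan m) x - norm x\<bar> \<le> \<eta> * norm x"
        using half_width_fan[OF m] eta by simp
      then have "half_width (fan m) x \<le> (1 + \<eta>) * norm x" "(1 - \<eta>) * norm x \<le> half_width (fan m) x"
        by (auto simp: algebra_simps abs_le_iff)
      from mult_left_mono[OF this(1) that] mult_left_mono[OF this(2) that]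
      show "half_width (map ((*\<^sub>R) t) (fan m)) x \<le> ((1 + \<eta>) * t) * norm x"
        "((1 - \<eta>) * t) * norm x \<le> half_width (map ((*\<^sub>R) t) (fan m)) x"
        by (simp_all add: half_width_scaleR that mult_ac)
    qed
    have lmZ: "K + Z t \<in> lmeasurable" for t
      using continuum_set_plus[OF K continuum_zono] by (auto simp: Z_def continuum_def intro: lmeasurable_compact)
    have shift: "K + ({v} + cball 0 R) = (+) v ` parallel_set K R" for v R
      by (simp add: parallel_set_eq_plus[OF K'] plus_singleton[symmetric] add.left_commute)
    have up: "measure lebesgue (K + Z t) \<le> measure lebesgue (parallel_set K ((1 + \<eta>) * t))" if "0 \<le> t" for t
    proof -
      have "K + Z t \<subseteq> (+) (v t) ` parallel_set K ((1 + \<eta>) * t)"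
        unfolding shift[symmetric] Z_def v_def using zono_subset_cball[OF hw(1)[OF that]]
        by (intro set_plus_mono2) auto
      then have "measure lebesgue (K + Z t) \<le> measure lebesgue ((+) (v t) ` parallel_set K ((1 + \<eta>) * t))"
        using lm lmZ by (intro measure_mono_fmeasurable) (auto intro: fmeasurableD measurable_translation)
      then show ?thesis by (simp add: measure_translation)
    qed
    have lo: "measure lebesgue (parallel_set K ((1 - \<eta>) * t)) \<le> measure lebesgue (K + Z t)"
    proof -
      have "(+) (v t) ` parallel_set K ((1 - \<eta>) * t) \<subseteq> K + Z t"
        unfolding shift[symmetric] Z_def v_def using cball_subset_zono[OF hw(2)[OF less_imp_le[OF t]]]
        by (intro set_plus_mono2) auto
      then have "measure lebesgue ((+) (v t) ` parallel_set K ((1 - \<eta>) * t)) \<le> measure lebesgue (K + Z t)"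
        using lm lmZ by (intro measure_mono_fmeasurable) (auto intro!: fmeasurableD[OF measurable_translation])
      then show ?thesis by (simp add: measure_translation)
    qed
    have "measure lebesgue (K + Z t) - measure lebesgue K \<le> (L + s) * ((1 + \<eta>) * t) + t\<^sup>2 * (pi * (1 + \<eta>))"
      if s: "s > 0" for s
    proof -
      obtain d where d: "d > 0" "\<And>e. 0 < e \<Longrightarrow> e < d \<Longrightarrow> A e \<le> (L + s) * e" using A_small[OF s] by auto
      \<comment> \<open>So many steps bring the first increment of \<open>zono_growth\<close> into
        the range where the content controls it.\<close>
      obtain N :: nat where N: "(1 + \<eta>) * t / d < N" using reals_Archimedean2 by blast
      have "0 < (1 + \<eta>) * t / d" using eta0 t d by simp
      then have N0: "N > 0" using N by (cases N) auto
      have e: "(1 + \<eta>) * (t / N) < d" using N N0 d(1) by (simp add: field_simps)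
      have "measure lebesgue (K + Z t) - measure lebesgue K
        \<le> N * (measure lebesgue (K + Z (t / N)) - measure lebesgue K) + t\<^sup>2 * mixed_area (fan m) (fan m) / 2"
        using zono_growth[OF K _ N0, of t "fan m"] t by (simp add: Z_def)
      also have "\<dots> \<le> N * A ((1 + \<eta>) * (t / N)) + t\<^sup>2 * (pi * (1 + \<eta>))"
      proof (intro add_mono mult_left_mono)
        show "measure lebesgue (K + Z (t / N)) - measure lebesgue K \<le> A ((1 + \<eta>) * (t / N))"
          using up[of "t / N"] t by (simp add: A_def)
        have "t\<^sup>2 * mixed_area (fan m) (fan m) \<le> t\<^sup>2 * (2 * pi * (1 + \<eta>))"
          using mixed_area_fan[OF m] eta by (intro mult_left_mono) auto
        then show "t\<^sup>2 * mixed_area (fan m) (fan m) / 2 \<le> t\<^sup>2 * (pi * (1 + \<eta>))"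
          by simp
      qed auto
      also have "N * A ((1 + \<eta>) * (t / N)) \<le> N * ((L + s) * ((1 + \<eta>) * (t / N)))"
        using d(2)[OF _ e] eta0 t N0 by (intro mult_left_mono) auto
      also have "N * ((L + s) * ((1 + \<eta>) * (t / N))) = (L + s) * ((1 + \<eta>) * t)"
        using N0 by simp
      finally show ?thesis by simp
    qed
    moreover have "(L + s) * ((1 + \<eta>) * t) + t\<^sup>2 * (pi * (1 + \<eta>))
        = s * ((1 + \<eta>) * t) + (1 + \<eta>) * (L * t + pi * t\<^sup>2)" for s
      by (simp add: algebra_simps)
    ultimately have *: "measure lebesgue (K + Z t) - measure lebesgue K - ((1 + \<eta>) * (L * t + pi * t\<^sup>2))
        \<le> s * ((1 + \<eta>) * t)" if "s > 0" for s
      using that by (metis diff_le_eq)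
    have "measure lebesgue (K + Z t) - measure lebesgue K \<le> (1 + \<eta>) * (L * t + pi * t\<^sup>2)"
    proof (rule ccontr)
      let ?x = "measure lebesgue (K + Z t) - measure lebesgue K - ((1 + \<eta>) * (L * t + pi * t\<^sup>2))"
      assume "\<not> ?thesis"
      then have x: "?x > 0" by simp
      have p: "(1 + \<eta>) * t > 0" using eta0 t by simp
      have "?x \<le> (?x / (2 * ((1 + \<eta>) * t))) * ((1 + \<eta>) * t)" using x p by (intro *) simp
      also have "\<dots> = ?x / 2"
      proof -
        have "y / (2 * z) * z = y / 2" if "z > 0" for y z :: real using that by simp
        then show ?thesis using p by blast
      qed
      finally show False using x by simp
    qed
    then show ?thesis using lo by (simp add: A_def)
  qed
  define \<eta> where "\<eta> n = pi\<^sup>2 / (2 * real (Suc n))" for n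
  have lim: "\<eta> \<longlonglongrightarrow> 0"
  proof -
    have "(\<lambda>n. pi\<^sup>2 / 2 * inverse (real (Suc n))) \<longlonglongrightarrow> pi\<^sup>2 / 2 * 0"
      by (intro tendsto_mult tendsto_const LIMSEQ_inverse_real_of_nat)
    moreover have "\<eta> n = pi\<^sup>2 / 2 * inverse (real (Suc n))" for n
      unfolding \<eta>_def by (simp only: divide_inverse inverse_mult_distrib mult.assoc)
    then have "\<eta> = (\<lambda>n. pi\<^sup>2 / 2 * inverse (real (Suc n)))" by (rule ext)
    ultimately show ?thesis by (simp only: mult_zero_right)
  qed
  have inv: "(\<lambda>n. t / (1 - \<eta> n)) \<longlonglongrightarrow> t / (1 - 0)"
    by (intro tendsto_divide tendsto_diff tendsto_const lim) simp
  have "(\<lambda>n. (1 + \<eta> n) * (L * (t / (1 - \<eta> n)) + pi * (t / (1 - \<eta> n))\<^sup>2))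
    \<longlonglongrightarrow> (1 + 0) * (L * (t / (1 - 0)) + pi * (t / (1 - 0))\<^sup>2)"
    by (intro tendsto_mult tendsto_add tendsto_power tendsto_const lim inv)
  then have "(\<lambda>n. (1 + \<eta> n) * (L * (t / (1 - \<eta> n)) + pi * (t / (1 - \<eta> n))\<^sup>2))
    \<longlonglongrightarrow> L * t + pi * t\<^sup>2" by simp
  moreover have "\<forall>\<^sub>F n in sequentially. A t \<le> (1 + \<eta> n) * (L * (t / (1 - \<eta> n)) + pi * (t / (1 - \<eta> n))\<^sup>2)"
    using order_tendstoD(2)[OF lim zero_less_one]
  proof eventually_elim
    case (elim n)
    \<comment> \<open>The radius is enlarged beforehand to make up for the factor lost with the
      inner disk.\<close>
    have "A ((1 - \<eta> n) * (t / (1 - \<eta> n))) \<le> (1 + \<eta> n) * (L * (t / (1 - \<eta> n)) + pi * (t / (1 - \<eta> n))\<^sup>2)"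
    proof (rule fan[of "Suc n"])
      show "\<eta> n = pi\<^sup>2 / (2 * real (Suc n))" by (rule \<eta>_def)
      show "t / (1 - \<eta> n) > 0" using elim t by simp
    qed simp
    then show ?case using elim by simp
  qed
  ultimately have "A t \<le> L * t + pi * t\<^sup>2"
    by (rule tendsto_lowerbound) simp
  then show ?thesis by (simp add: A_def)
qed

section \<open>The Brunn-Minkowski inequality in the plane\<close>

text \<open>Fubini for the region under the graph. Only heights \<open>t > 0\<close> count on the
  right, which agrees with \<open>ennreal\<close> sending negative values to 0 on the left.\<close>

lemma nn_integral_layer_cake:
  fixes f :: "'a \<Rightarrow> real"
  assumes "sigma_finite_measure M" and [measurable]: "f \<in> borel_measurable M"
  shows "(\<integral>\<^sup>+x. ennreal (f x) \<partial>M) = (\<integral>\<^sup>+t. indicator {0<..} t * emeasure M {x\<in>space M. t \<le> f x} \<partial>lborel)"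
proof -
  interpret sigma_finite_measure M by fact
  interpret pair_sigma_finite M lborel ..
  let ?g = "\<lambda>x t. indicator {0<..} t * indicator {t. t \<le> f x} t :: ennreal"
  have "(\<integral>\<^sup>+x. ennreal (f x) \<partial>M) = (\<integral>\<^sup>+x. (\<integral>\<^sup>+t. ?g x t \<partial>lborel) \<partial>M)"
  proof (intro nn_integral_cong)
    fix x
    have "?g x t = indicator {0<..f x} t" for t by (auto split: split_indicator)
    then have "(\<integral>\<^sup>+t. ?g x t \<partial>lborel) = emeasure lborel {0<..f x}" by simp
    also have "\<dots> = ennreal (f x)" by (cases "0 \<le> f x") (auto simp: ennreal_neg)
    finally show "ennreal (f x) = (\<integral>\<^sup>+t. ?g x t \<partial>lborel)" by simp
  qed
  also have "\<dots> = (\<integral>\<^sup>+t. (\<integral>\<^sup>+x. ?g x t \<partial>M) \<partial>lborel)"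
    by (rule Fubini'[symmetric]) measurable
  also have "\<dots> = (\<integral>\<^sup>+t. indicator {0<..} t * emeasure M {x\<in>space M. t \<le> f x} \<partial>lborel)"
  proof (intro nn_integral_cong)
    fix t
    have "(\<integral>\<^sup>+x. ?g x t \<partial>M) = (\<integral>\<^sup>+x. indicator {0<..} t * indicator {x\<in>space M. t \<le> f x} x \<partial>M)"
      by (intro nn_integral_cong) (auto split: split_indicator)
    also have "\<dots> = indicator {0<..} t * emeasure M {x\<in>space M. t \<le> f x}"
      by (rule nn_integral_cmult_indicator) measurable
    finally show "(\<integral>\<^sup>+x. ?g x t \<partial>M) = indicator {0<..} t * emeasure M {x\<in>space M. t \<le> f x}" .
  qed
  finally show ?thesis .
qed

text \<open>Heights are measured relative to \<open>m\<close>, which makes superlevel sets of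
  functions with different suprema comparable.\<close>

lemma nn_integral_layer_cake_scaled:
  fixes f :: "'a \<Rightarrow> real"
  assumes "sigma_finite_measure M" and f [measurable]: "f \<in> borel_measurable M" and m: "0 < m"
    and le: "\<And>x. x \<in> space M \<Longrightarrow> f x \<le> m"
  shows "(\<integral>\<^sup>+x. ennreal (f x) \<partial>M)
    = ennreal m * (\<integral>\<^sup>+s. indicator {0<..<1} s * emeasure M {x\<in>space M. s * m \<le> f x} \<partial>lborel)"
proof -
  interpret sigma_finite_measure M by fact
  interpret pair_sigma_finite M lborel ..
  let ?F = "\<lambda>x. indicator {0<..} x * emeasure M {y\<in>space M. x \<le> f y} :: ennreal"
  have [measurable]: "(\<lambda>t. emeasure M {x\<in>space M. t \<le> f x}) \<in> borel_measurable lborel"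
  proof -
    have "(\<lambda>t. \<integral>\<^sup>+x. indicator {t. t \<le> f x} t \<partial>M) \<in> borel_measurable lborel" by measurable
    also have "(\<lambda>t. \<integral>\<^sup>+x. indicator {t. t \<le> f x} t \<partial>M) = (\<lambda>t. emeasure M {x\<in>space M. t \<le> f x})"
    proof
      fix t
      have "(\<integral>\<^sup>+x. indicator {t. t \<le> f x} t \<partial>M) = (\<integral>\<^sup>+x. indicator {x\<in>space M. t \<le> f x} x \<partial>M)"
        by (intro nn_integral_cong) (auto split: split_indicator)
      then show "(\<integral>\<^sup>+x. indicator {t. t \<le> f x} t \<partial>M) = emeasure M {x\<in>space M. t \<le> f x}" by simp
    qed
    finally show ?thesis .
  qed
  have "(\<integral>\<^sup>+x. ennreal (f x) \<partial>M) = (\<integral>\<^sup>+t. ?F t \<partial>lborel)"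
    by (rule nn_integral_layer_cake[OF assms(1) f])
  also have "\<dots> = ennreal \<bar>m\<bar> * (\<integral>\<^sup>+t. ?F (0 + m * t) \<partial>lborel)"
    by (rule nn_integral_real_affine) (use m in auto)
  also have "(\<integral>\<^sup>+t. ?F (0 + m * t) \<partial>lborel) = (\<integral>\<^sup>+s. indicator {0<..<1} s * emeasure M {x\<in>space M. s * m \<le> f x} \<partial>lborel)"
  proof (rule nn_integral_cong_AE)
    \<comment> \<open>Relative height 1 is discarded as a null set: a supremum need not be attained,
      and the superlevel set there could be empty.\<close>
    have "AE s in lborel. s \<noteq> (1::real)" by (rule AE_lborel_singleton)
    then show "AE s in lborel. ?F (0 + m * s) = indicator {0<..<1} s * emeasure M {x\<in>space M. s * m \<le> f x}"
    proof eventually_elim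
      case (elim s)
      show ?case
      proof (cases "s < 1")
        case True
        then show ?thesis using m by (auto simp: zero_less_mult_iff mult.commute split: split_indicator)
      next
        case False
        then have "m < s * m" using elim m by simp
        then have "{x\<in>space M. s * m \<le> f x} = {}" using le by fastforce
        then show ?thesis using False by (simp only: mult.commute[of m] add_0_left emeasure_empty mult_zero_right)
      qed
    qed
  qed
  finally show ?thesis using m by simp
qed

text \<open>With \<open>a\<close> the largest point of \<open>X\<close> and \<open>b\<close> the
  smallest of \<open>Y\<close>, the translates \<open>b + X\<close> and \<open>a + Y\<close> both
  lie in \<open>X + Y\<close> and meet only in \<open>a + b\<close>.\<close>

lemma brunn_minkowski_1_compact:
  fixes X Y :: "real set"
  assumes "compact X" "compact Y" "X \<noteq> {}" "Y \<noteq> {}"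
  shows "emeasure lborel X + emeasure lborel Y \<le> emeasure lborel (X + Y)"
proof -
  obtain a where a: "a \<in> X" "\<And>x. x \<in> X \<Longrightarrow> x \<le> a" using compact_attains_sup[OF assms(1,3)] by auto
  obtain b where b: "b \<in> Y" "\<And>y. y \<in> Y \<Longrightarrow> b \<le> y" using compact_attains_inf[OF assms(2,4)] by auto
  let ?X = "(+) b ` X" and ?Y = "(+) a ` Y"
  have cX: "compact ?X" "compact ?Y" using assms by (auto intro: compact_translation)
  have "?X \<inter> ?Y \<subseteq> {a + b}" using a b by fastforce
  then have nl: "emeasure lborel (?X \<inter> ?Y) = 0"
    using emeasure_mono[of "?X \<inter> ?Y" "{a + b}" lborel] by simp
  have tr: "emeasure lborel ((+) v ` A) = emeasure lborel A" if "compact A" for v :: real and A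
  proof -
    have "emeasure lborel ((+) v ` A) = emeasure lborel ((+) (- v) -` A)"
      by (intro arg_cong2[where f = emeasure]) (force simp: image_iff)+
    also have "\<dots> = emeasure (distr lborel borel ((+) (- v))) A"
      using that by (subst emeasure_distr) (auto simp: borel_compact)
    finally show ?thesis unfolding lborel_distr_plus .
  qed
  have "emeasure lborel X + emeasure lborel Y = emeasure lborel ?X + emeasure lborel ?Y"
    using assms by (simp add: tr)
  also have "\<dots> = emeasure lborel (?X \<union> ?Y) + emeasure lborel (?X \<inter> ?Y)"
    using cX by (intro emeasure_Un_Int) (auto simp: borel_compact)
  also have "\<dots> \<le> emeasure lborel (X + Y)"
    unfolding nl
  proof (simp, rule emeasure_mono)
    show "?X \<union> ?Y \<subseteq> X + Y" using a b by (auto simp: add.commute[of b] intro: set_plus_intro)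
    show "X + Y \<in> sets lborel"
      using compact_sums[OF assms(1,2)] by (auto simp: borel_compact set_plus_def Collect_ex_eq[symmetric] intro!: borel_compact elim!: back_subst[of compact])
  qed
  finally show ?thesis .
qed

lemma inner_compact:
  fixes X :: "real set"
  assumes "X \<in> sets borel" "bounded X" "e > 0"
  obtains C where "compact C" "C \<subseteq> X" "emeasure lborel X \<le> emeasure lborel C + ennreal e"
proof -
  obtain C where C: "closed C" "C \<subseteq> X" "X - C \<in> lmeasurable" "emeasure lebesgue (X - C) < ennreal e"
    using sets_lebesgue_inner_closed[of X e] assms by auto
  have bor: "C \<in> sets borel" using C(1) by auto
  have "emeasure lborel X = emeasure lborel (C \<union> (X - C))" using C(2) by (simp add: Un_absorb1)
  also have "\<dots> \<le> emeasure lborel C + emeasure lborel (X - C)"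
    using assms(1) bor by (intro emeasure_subadditive) auto
  also have "emeasure lborel (X - C) \<le> ennreal e" using C(4) assms(1) bor by simp
  finally have "emeasure lborel X \<le> emeasure lborel C + ennreal e" by (simp add: add_left_mono)
  moreover have "compact C" using C assms(2) bounded_subset compact_eq_bounded_closed by blast
  ultimately show ?thesis using that C(2) by blast
qed

text \<open>The sum of two Borel sets need not be Borel, whence the superset \<open>Z\<close>.
  Compact inner approximations reduce to the previous case; adding one point to each keeps them
  nonempty at no cost.\<close>

lemma brunn_minkowski_1:
  fixes X Y Z :: "real set"
  assumes "X \<in> sets borel" "Y \<in> sets borel" "Z \<in> sets borel" "bounded X" "bounded Y"
    "X \<noteq> {}" "Y \<noteq> {}" and sub: "X + Y \<subseteq> Z"
  shows "emeasure lborel X + emeasure lborel Y \<le> emeasure lborel Z"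
proof (rule ennreal_le_epsilon)
  fix e :: real assume e: "0 < e"
  obtain C where C: "compact C" "C \<subseteq> X" "emeasure lborel X \<le> emeasure lborel C + ennreal (e / 2)"
    using inner_compact[OF assms(1,4), of "e / 2"] e by auto
  obtain D where D: "compact D" "D \<subseteq> Y" "emeasure lborel Y \<le> emeasure lborel D + ennreal (e / 2)"
    using inner_compact[OF assms(2,5), of "e / 2"] e by auto
  obtain x y where xy: "x \<in> X" "y \<in> Y" using assms by auto
  let ?C = "insert x C" and ?D = "insert y D"
  have "emeasure lborel X + emeasure lborel Y
    \<le> (emeasure lborel C + ennreal (e / 2)) + (emeasure lborel D + ennreal (e / 2))"
    by (intro add_mono C D)
  also have "\<dots> = emeasure lborel C + emeasure lborel D + ennreal e"
    using e by (simp add: add.assoc add.left_commute ennreal_plus[symmetric] del: ennreal_plus)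
  also have "\<dots> \<le> emeasure lborel ?C + emeasure lborel ?D + ennreal e"
    using C(1) D(1) by (intro add_mono order_refl emeasure_mono) (auto simp: borel_compact)
  also have "\<dots> \<le> emeasure lborel (?C + ?D) + ennreal e"
    using C(1) D(1) by (intro add_right_mono brunn_minkowski_1_compact) auto
  also have "emeasure lborel (?C + ?D) \<le> emeasure lborel Z"
  proof (rule emeasure_mono)
    have "?C + ?D \<subseteq> X + Y" using C(2) D(2) xy by (intro set_plus_mono2) auto
    then show "?C + ?D \<subseteq> Z" using sub by auto
  qed (use assms in auto)
  finally show "emeasure lborel X + emeasure lborel Y \<le> emeasure lborel Z + ennreal e" by simp
qed

text \<open>Normalise the functions that map \<open>x\<close> to the length of the slice over \<open>x\<close> by their suprema \<open>M\<close> and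
  \<open>N\<close>. The superlevel sets of \<open>A\<close> and \<open>B\<close> at the same relative height \<open>s\<close> add up to points where the
  slice of \<open>A + B\<close> has length at least \<open>s (M + N)\<close>, and the one-dimensional inequality applies both to
  the slices and to the superlevel sets.\<close>

lemma brunn_minkowski_2_prod:
  fixes A B :: "(real \<times> real) set"
  assumes cA: "compact A" and cB: "compact B" and pA: "0 < measure lborel A" and pB: "0 < measure lborel B"
  shows "(sqrt (measure lborel A) + sqrt (measure lborel B))\<^sup>2 \<le> measure lborel (A + B)"
proof -
  define sl :: "(real \<times> real) set \<Rightarrow> real \<Rightarrow> real" where "sl C x = measure lborel (Pair x -` C)" for C x
  have csl: "compact (Pair x -` C)" if "compact C" for C :: "(real \<times> real) set" and x
  proof -
    have "Pair x -` C = snd ` (C \<inter> ({x} \<times> UNIV))" by force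
    moreover have "compact (C \<inter> ({x} \<times> UNIV))"
      using that by (intro compact_Int_closed closed_Times) auto
    ultimately show ?thesis by (simp add: compact_continuous_image continuous_on_snd)
  qed
  have esl: "emeasure lborel (Pair x -` C) = ennreal (sl C x)" if "compact C" for C x
    unfolding sl_def using emeasure_compact_finite[OF csl[OF that]]
    by (intro emeasure_eq_ennreal_measure) (simp add: less_top)
  have [measurable]: "sl C \<in> borel_measurable borel" if "compact C" for C
  proof -
    have "C \<in> sets (lborel \<Otimes>\<^sub>M lborel)"
      using borel_compact[OF that] by (metis lborel_prod sets_lborel)
    then have "(\<lambda>x. emeasure lborel (Pair x -` C)) \<in> borel_measurable lborel"
      by (rule lborel.measurable_emeasure_Pair)
    then show ?thesis by (simp add: sl_def[abs_def] measure_def)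
  qed
  have vol: "emeasure lborel C = (\<integral>\<^sup>+x. ennreal (sl C x) \<partial>lborel)" if "compact C" for C
  proof -
    have "emeasure (lborel \<Otimes>\<^sub>M lborel) C = (\<integral>\<^sup>+x. emeasure lborel (Pair x -` C) \<partial>lborel)"
      by (rule lborel.emeasure_pair_measure_alt) (use borel_compact[OF that] in \<open>metis lborel_prod sets_lborel\<close>)
    then show ?thesis by (simp add: lborel_prod esl[OF that])
  qed
  have mea: "emeasure lborel C = ennreal (measure lborel C)" if "compact C" for C :: "(real \<times> real) set"
    using emeasure_compact_finite[OF that] by (intro emeasure_eq_ennreal_measure) (simp add: less_top)
  have bdd: "\<exists>b. \<forall>x. sl C x \<le> b \<and> (sl C x \<noteq> 0 \<longrightarrow> \<bar>x\<bar> \<le> b)" if C: "compact C" for C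
  proof -
    obtain b where b: "\<And>z. z \<in> C \<Longrightarrow> norm z \<le> b" using compact_imp_bounded[OF C] by (auto simp: bounded_iff)
    have sub: "Pair x -` C \<subseteq> {- \<bar>b\<bar>..\<bar>b\<bar>}" for x
    proof
      fix y assume "y \<in> Pair x -` C"
      then have "norm (x, y) \<le> b" using b by simp
      then show "y \<in> {- \<bar>b\<bar>..\<bar>b\<bar>}" using norm_snd_le[of y x] by auto
    qed
    have "sl C x \<le> 2 * \<bar>b\<bar>" for x
      using measure_mono_fmeasurable[OF sub[of x], of lborel] csl[OF C, of x] fmeasurable_cbox[of "- \<bar>b\<bar>" "\<bar>b\<bar>"]
      by (simp add: sl_def borel_compact)
    moreover have "\<bar>x\<bar> \<le> 2 * \<bar>b\<bar>" if "sl C x \<noteq> 0" for x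
    proof -
      have "Pair x -` C \<noteq> {}" using that by (auto simp: sl_def)
      then obtain y where "(x, y) \<in> C" by auto
      then have "\<bar>x\<bar> \<le> b" using b[of "(x, y)"] norm_fst_le[of x y] by simp
      then show ?thesis by linarith
    qed
    ultimately show ?thesis by blast
  qed
  have top: "\<exists>m>0. (\<forall>x. sl C x \<le> m) \<and> (\<forall>s\<in>{0<..<1}. \<exists>x. s * m \<le> sl C x)"
    if C: "compact C" "0 < measure lborel C" for C
  proof -
    obtain b where b: "\<And>x. sl C x \<le> b" using bdd[OF C(1)] by auto
    then have bd: "bdd_above (range (sl C))" by (intro bdd_aboveI2)
    define m where "m = (SUP x. sl C x)"
    have le: "sl C x \<le> m" for x unfolding m_def by (rule cSUP_upper[OF UNIV_I bd])
    have "m > 0"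
    proof (rule ccontr)
      assume "\<not> m > 0"
      then have "sl C x = 0" for x 
        using le[of x] measure_nonneg[of lborel "Pair x -` C"] unfolding sl_def by linarith
      then show False using vol[OF C(1)] mea[OF C(1)] C(2) by simp
    qed
    moreover have "\<exists>x. s * m \<le> sl C x" if "s \<in> {0<..<1}" for s
    proof -
      have "s * m < m" using that \<open>m > 0\<close> by simp
      moreover have "m \<le> s * m" if "\<And>x. sl C x \<le> s * m"
        using cSUP_least[of UNIV "sl C" "s * m"] that by (simp add: m_def)
      ultimately show ?thesis by (meson less_imp_le not_le)
    qed
    ultimately show ?thesis using le by blast
  qed
  obtain M where M: "M > 0" "\<And>x. sl A x \<le> M" "\<And>s. s \<in> {0<..<1} \<Longrightarrow> \<exists>x. s * M \<le> sl A x"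
    using top[OF cA pA] by blast
  obtain N where N: "N > 0" "\<And>x. sl B x \<le> N" "\<And>s. s \<in> {0<..<1} \<Longrightarrow> \<exists>x. s * N \<le> sl B x"
    using top[OF cB pB] by blast
  have cAB: "compact (A + B)" using compact_sums'[OF cA cB] by (simp add: set_plus_def UNION_eq)
  \<comment> \<open>The cut-off at \<open>M + N\<close> provides the upper bound that the scaled
    layer cake formula asks for.\<close>
  define h where "h x = min (sl (A + B) x) (M + N)" for x
  have [measurable]: "h \<in> borel_measurable borel" "sl A \<in> borel_measurable borel" "sl B \<in> borel_measurable borel"
    using cAB cA cB by (auto simp: h_def[abs_def])
  define I where "I f m = (\<integral>\<^sup>+s. indicator {0<..<1} s * emeasure lborel {x. s * m \<le> f x} \<partial>lborel)" for f :: "real \<Rightarrow> real" and m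
  have lay: "(\<integral>\<^sup>+x. ennreal (f x) \<partial>lborel) = ennreal m * I f m"
    if "f \<in> borel_measurable borel" "0 < m" "\<And>x. f x \<le> m" for f m
    using nn_integral_layer_cake_scaled[OF lborel.sigma_finite_measure_axioms, of f m] that by (simp add: I_def)
  have vA: "ennreal (measure lborel A) = ennreal M * I (sl A) M"
    using lay[of "sl A" M] M vol[OF cA] mea[OF cA] by simp
  have vB: "ennreal (measure lborel B) = ennreal N * I (sl B) N"
    using lay[of "sl B" N] N vol[OF cB] mea[OF cB] by simp
  have "I (sl A) M + I (sl B) N \<le> I h (M + N)"
  proof -
    have mI: "(\<lambda>s. emeasure lborel {x. s * m \<le> f x}) \<in> borel_measurable lborel"
      if "f \<in> borel_measurable borel" for f :: "real \<Rightarrow> real" and m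
    proof -
      have [measurable]: "f \<in> borel_measurable borel" by fact
      have "(\<lambda>s. \<integral>\<^sup>+x. indicator {s. s * m \<le> f x} s \<partial>lborel) \<in> borel_measurable lborel" by measurable
      also have "(\<lambda>s. \<integral>\<^sup>+x. indicator {s. s * m \<le> f x} s \<partial>lborel) = (\<lambda>s. emeasure lborel {x. s * m \<le> f x})"
      proof
        fix s
        have "(\<integral>\<^sup>+x. indicator {s. s * m \<le> f x} s \<partial>lborel) = (\<integral>\<^sup>+x. indicator {x. s * m \<le> f x} x \<partial>lborel)"
          by (intro nn_integral_cong) (auto split: split_indicator)
        then show "(\<integral>\<^sup>+x. indicator {s. s * m \<le> f x} s \<partial>lborel) = emeasure lborel {x. s * m \<le> f x}" by simp
      qed
      finally show ?thesis .
    qed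
    have "I (sl A) M + I (sl B) N = (\<integral>\<^sup>+s. indicator {0<..<1} s * emeasure lborel {x. s * M \<le> sl A x}
       + indicator {0<..<1} s * emeasure lborel {x. s * N \<le> sl B x} \<partial>lborel)"
      unfolding I_def using mI[of "sl A" M] mI[of "sl B" N] by (intro nn_integral_add[symmetric]) auto
    also have "\<dots> \<le> I h (M + N)"
      unfolding I_def
    proof (intro nn_integral_mono)
      fix s :: real
      show "indicator {0<..<1} s * emeasure lborel {x. s * M \<le> sl A x}
       + indicator {0<..<1} s * emeasure lborel {x. s * N \<le> sl B x}
       \<le> indicator {0<..<1} s * emeasure lborel {x. s * (M + N) \<le> h x}"
      proof (cases "s \<in> {0<..<1}")
        case s: True
        have bnd: "bounded {x. s * m \<le> sl C x}" if C: "compact C" and m: "m > 0" for C m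
        proof -
          obtain b where b: "\<And>x. sl C x \<noteq> 0 \<Longrightarrow> \<bar>x\<bar> \<le> b" using bdd[OF C] by auto
          have "\<bar>x\<bar> \<le> b" if "s * m \<le> sl C x" for x
          proof -
            have "s * m > 0" using s m by simp
            then show ?thesis using b[of x] that by force
          qed
          then show ?thesis unfolding bounded_iff by auto
        qed
        have "emeasure lborel {x. s * M \<le> sl A x} + emeasure lborel {x. s * N \<le> sl B x}
          \<le> emeasure lborel {x. s * (M + N) \<le> h x}"
        proof (rule brunn_minkowski_1)
          show "bounded {x. s * M \<le> sl A x}" "bounded {x. s * N \<le> sl B x}"
            using bnd cA cB M N by auto
          show "{x. s * M \<le> sl A x} \<noteq> {}" "{x. s * N \<le> sl B x} \<noteq> {}"
            using M(3)[OF s] N(3)[OF s] by auto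
          show "{x. s * M \<le> sl A x} + {x. s * N \<le> sl B x} \<subseteq> {x. s * (M + N) \<le> h x}"
          proof
            fix z assume "z \<in> {x. s * M \<le> sl A x} + {x. s * N \<le> sl B x}"
            then obtain x y where xy: "z = x + y" "s * M \<le> sl A x" "s * N \<le> sl B y" by (auto simp: set_plus_def)
            have "0 < s * M" "0 < s * N" using s M N by auto
            then have ne: "Pair x -` A \<noteq> {}" "Pair y -` B \<noteq> {}" using xy by (auto simp: sl_def)
            have "emeasure lborel (Pair x -` A) + emeasure lborel (Pair y -` B)
              \<le> emeasure lborel (Pair x -` A + Pair y -` B)"
              by (intro brunn_minkowski_1_compact csl cA cB ne)
            also have "\<dots> \<le> emeasure lborel (Pair z -` (A + B))"
            proof (rule emeasure_mono)
              show "Pair x -` A + Pair y -` B \<subseteq> Pair z -` (A + B)"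
              proof
                fix w assume "w \<in> Pair x -` A + Pair y -` B"
                then obtain u v where "w = u + v" "(x, u) \<in> A" "(y, v) \<in> B" by (auto simp: set_plus_def)
                then show "w \<in> Pair z -` (A + B)"
                  using set_plus_intro[of "(x, u)" A "(y, v)" B] xy by simp
              qed
            qed (use csl[OF cAB] in \<open>simp add: borel_compact\<close>)
            finally have "ennreal (sl A x + sl B y) \<le> ennreal (sl (A + B) z)"
              using cA cB cAB by (simp add: esl sl_def ennreal_plus)
            then have "sl A x + sl B y \<le> sl (A + B) z"
              by (subst (asm) ennreal_le_iff) (simp_all add: sl_def)
            moreover have "s * (M + N) \<le> 1 * (M + N)" using s M N by (intro mult_right_mono) auto
            ultimately show "z \<in> {x. s * (M + N) \<le> h x}"
              using xy by (simp add: h_def distrib_left)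
          qed
        qed measurable
        then show ?thesis using s by simp
      qed simp
    qed
    finally show ?thesis .
  qed
  then have "ennreal (M + N) * (I (sl A) M + I (sl B) N) \<le> ennreal (M + N) * I h (M + N)"
    by (rule mult_left_mono) simp
  also have "\<dots> = (\<integral>\<^sup>+x. ennreal (h x) \<partial>lborel)"
    using M N by (intro lay[symmetric]) (auto simp: h_def)
  also have "\<dots> \<le> (\<integral>\<^sup>+x. ennreal (sl (A + B) x) \<partial>lborel)"
    by (intro nn_integral_mono ennreal_leI) (simp add: h_def)
  also have "\<dots> = ennreal (measure lborel (A + B))"
    using vol[OF cAB] mea[OF cAB] by simp
  finally have 1: "ennreal (M + N) * (I (sl A) M + I (sl B) N) \<le> ennreal (measure lborel (A + B))" .
  have IA: "I (sl A) M = ennreal (measure lborel A / M)"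
    and IB: "I (sl B) N = ennreal (measure lborel B / N)"
  proof -
    have *: "x = ennreal (v / m)" if "ennreal v = ennreal m * x" "m > 0" "0 \<le> v" for v m :: real and x
    proof (cases x)
      case (real y)
      then have "v = m * y" using that by (simp flip: ennreal_mult)
      then show ?thesis using real that by simp
    next
      case top
      then show ?thesis using that by (simp add: ennreal_mult_top)
    qed
    show "I (sl A) M = ennreal (measure lborel A / M)" "I (sl B) N = ennreal (measure lborel B / N)"
      using *[OF vA M(1)] *[OF vB N(1)] by auto
  qed
  let ?a = "measure lborel A" and ?b = "measure lborel B"
  have "ennreal ((M + N) * (?a / M + ?b / N)) \<le> ennreal (measure lborel (A + B))"
    using 1 M N unfolding IA IB by (simp flip: ennreal_plus ennreal_mult)
  then have 2: "(M + N) * (?a / M + ?b / N) \<le> measure lborel (A + B)" by simp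
  have "(M + N) * (?a / M + ?b / N) = ?a + ?b + (N / M * ?a + M / N * ?b)"
    using M N by (simp add: field_simps)
  \<comment> \<open>The arithmetic-geometric mean inequality: the two weights \<open>N / M\<close>
    and \<open>M / N\<close> are reciprocal, so they cancel in the product.\<close>
  moreover have "2 * (sqrt ?a * sqrt ?b) \<le> N / M * ?a + M / N * ?b"
  proof -
    define q where "q = sqrt (N / M)"
    have q: "q > 0" "q\<^sup>2 = N / M" using M N by (auto simp: q_def)
    have "0 \<le> (q * sqrt ?a - sqrt ?b / q)\<^sup>2" by simp
    also have "\<dots> = q\<^sup>2 * (sqrt ?a)\<^sup>2 + (sqrt ?b)\<^sup>2 / q\<^sup>2 - 2 * (sqrt ?a * sqrt ?b)"
      using q(1) by (simp add: power2_diff power_mult_distrib power_divide)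
    finally show ?thesis unfolding q(2) by (simp add: field_simps)
  qed
  ultimately show ?thesis using 2 by (simp add: power2_sum)
qed

lemma lborel_real2: "lborel = distr lborel borel (\<lambda>(x, y). vector [x, y] :: real^2)"
proof (rule lborel_eqI)
  have T [measurable]: "(\<lambda>(x, y). vector [x, y] :: real^2) \<in> borel_measurable borel"
  proof (rule borel_measurable_continuous_onI)
    have "(\<lambda>(x, y). vector [x, y] :: real^2) = (\<lambda>p. fst p *\<^sub>R axis 1 1 + snd p *\<^sub>R axis 2 1)"
      by (auto simp: fun_eq_iff vec_eq_iff forall_2 axis_def)
    then show "continuous_on UNIV (\<lambda>(x, y). vector [x, y] :: real^2)" by (simp add: continuous_intros)
  qed
  fix l u :: "real^2" assume le: "\<And>b. b \<in> Basis \<Longrightarrow> l \<bullet> b \<le> u \<bullet> b"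
  have le': "l$i \<le> u$i" for i using le[of "axis i 1"] by (simp add: inner_axis)
  have "(\<lambda>(x, y). vector [x, y]) -` box l u = box (l$1) (u$1) \<times> box (l$2) (u$2)"
    by (auto simp: mem_box_cart forall_2)
  moreover have "emeasure lborel (box (l$1) (u$1) \<times> box (l$2) (u$2)) = ennreal ((u$1 - l$1) * (u$2 - l$2))"
    using le'[of 1] le'[of 2]
    by (simp add: lborel_prod[symmetric] lborel.emeasure_pair_measure_Times ennreal_mult)
  moreover have "(\<Prod>b\<in>Basis. (u - l) \<bullet> b) = (u$1 - l$1) * (u$2 - l$2)"
    by (simp add: Basis_vec_def UNIV_2 axis_eq_axis inner_axis)
  ultimately show "emeasure (distr lborel borel (\<lambda>(x, y). vector [x, y])) (box l u) = (\<Prod>b\<in>Basis. (u - l) \<bullet> b)"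
    by (simp add: emeasure_distr)
qed simp

lemma brunn_minkowski_2:
  fixes A B :: "(real^2) set"
  assumes cA: "compact A" and cB: "compact B" and "0 < measure lebesgue A" "0 < measure lebesgue B"
  shows "(sqrt (measure lebesgue A) + sqrt (measure lebesgue B))\<^sup>2 \<le> measure lebesgue (A + B)"
proof -
  define T where "T = (\<lambda>(x, y). vector [x, y] :: real^2)"
  define S where "S v = (v$1, v$2)" for v :: "real^2"
  have TS: "T (S v) = v" and ST: "S (T p) = p" for v p
    by (auto simp: T_def S_def vec_eq_iff forall_2 case_prod_unfold)
  have S_add: "S (u + v) = S u + S v" for u v by (simp add: S_def)
  have cS: "compact (S ` C)" if "compact C" for C
    unfolding S_def by (intro compact_continuous_image that continuous_intros)
  have cT: "continuous_on UNIV T"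
  proof -
    have "T = (\<lambda>p. fst p *\<^sub>R axis 1 1 + snd p *\<^sub>R axis 2 1)"
      by (auto simp: T_def fun_eq_iff vec_eq_iff forall_2 axis_def)
    then show ?thesis by (simp add: continuous_intros)
  qed
  have m: "measure lebesgue C = measure lborel (S ` C)" if "compact C" for C
  proof -
    have C: "C \<in> sets borel" using that by (rule borel_compact)
    have "measure lebesgue C = measure (distr lborel borel T) C"
      using C lborel_real2 by (simp add: T_def)
    also have "\<dots> = measure lborel (T -` C)"
      using C cT by (subst measure_distr) (auto intro: borel_measurable_continuous_onI)
    also have "T -` C = S ` C" using TS ST by (metis (no_types, opaque_lifting) bij_def bij_vimage_eq_inv_image inj_def inj_imp_inv_eq surj_def)
    finally show ?thesis .
  qed
  have cAB: "compact (A + B)" using compact_sums'[OF cA cB] by (simp add: set_plus_def UNION_eq)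
  have "S ` (A + B) = S ` A + S ` B"
    by (force simp: set_plus_def S_add)
  then show ?thesis
    using brunn_minkowski_2_prod[OF cS[OF cA] cS[OF cB]] assms by (simp add: m cAB)
qed

section \<open>Mollification\<close>

text \<open>The powers of \<open>inverse s\<close> make the family closed under differentiation up
  to linear combinations, so that smoothness at 0 follows from one limit for all
  \<open>n\<close>.\<close>

definition flat_exp :: "nat \<Rightarrow> real \<Rightarrow> real" where
  "flat_exp n s = (if s \<le> 0 then 0 else exp (- inverse s) * inverse s ^ n)"

lemma flat_exp_tendsto: "(flat_exp n \<longlongrightarrow> 0) (at 0)"
proof (rule filterlim_split_at)
  show "(flat_exp n \<longlongrightarrow> 0) (at_left 0)"
    by (rule tendsto_eventually) (auto simp: flat_exp_def eventually_at_filter)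
  have "((\<lambda>x. x ^ n / exp x) \<longlongrightarrow> (0 :: real)) at_top" by (rule tendsto_power_div_exp_0)
  then have "((\<lambda>s. inverse s ^ n / exp (inverse s)) \<longlongrightarrow> (0 :: real)) (at_right 0)"
    by (rule filterlim_compose) (rule filterlim_inverse_at_top_right)
  moreover have "\<forall>\<^sub>F s in at_right 0. inverse s ^ n / exp (inverse s) = flat_exp n s"
    by (auto simp: flat_exp_def eventually_at_filter exp_minus divide_inverse)
  ultimately show "(flat_exp n \<longlongrightarrow> 0) (at_right 0)" by (rule Lim_transform_eventually)
qed

lemma flat_exp_deriv:
  "(flat_exp n has_real_derivative flat_exp (n + 2) s - n * flat_exp (n + 1) s) (at s)"
proof -
  consider "s < 0" | "s = 0" | "s > 0" by linarith
  then show ?thesis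
  proof cases
    case 1
    have "\<forall>\<^sub>F x in nhds s. flat_exp n x = 0"
      by (rule eventually_mono[OF eventually_nhds_in_open[of "{..<0}" s]]) (use 1 in \<open>auto simp: flat_exp_def\<close>)
    then show ?thesis using 1 by (subst DERIV_cong_ev[OF refl _ refl]) (auto simp: flat_exp_def)
  next
    case 2
    \<comment> \<open>At 0 the difference quotient of one member is the next member of the
      family.\<close>
    have "\<forall>\<^sub>F x in at 0. flat_exp (n + 1) x = (flat_exp n x - flat_exp n 0) / (x - 0)"
      by (auto simp: flat_exp_def eventually_at_filter divide_inverse)
    with flat_exp_tendsto have "((\<lambda>x. (flat_exp n x - flat_exp n 0) / (x - 0)) \<longlongrightarrow> 0) (at 0)"
      by (rule Lim_transform_eventually)
    then show ?thesis using 2 by (simp add: has_field_derivative_iff flat_exp_def)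
  next
    case 3
    have "\<forall>\<^sub>F x in nhds s. flat_exp n x = exp (- inverse x) * inverse x ^ n"
      by (rule eventually_mono[OF eventually_nhds_in_open[of "{0<..}" s]]) (use 3 in \<open>auto simp: flat_exp_def\<close>)
    moreover have "((\<lambda>x. exp (- inverse x) * inverse x ^ n) has_real_derivative
      flat_exp (n + 2) s - n * flat_exp (n + 1) s) (at s)"
    proof -
      define u where "u = inverse s"
      have "(inverse has_real_derivative - (u\<^sup>2)) (at s)"
        using DERIV_inverse[of s UNIV] 3 by (simp add: u_def power2_eq_square)
      then have "((\<lambda>x. exp (- inverse x) * inverse x ^ n) has_real_derivative
        exp (- u) * u\<^sup>2 * u ^ n + real n * u ^ (n - 1) * - (u\<^sup>2) * exp (- u)) (at s)"
        using 3 by (auto intro!: derivative_eq_intros simp: u_def power2_eq_square)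
      also have "exp (- u) * u\<^sup>2 * u ^ n + real n * u ^ (n - 1) * - (u\<^sup>2) * exp (- u)
        = flat_exp (n + 2) s - n * flat_exp (n + 1) s"
        using 3 by (cases n) (simp_all add: flat_exp_def u_def[symmetric] power2_eq_square algebra_simps)
      finally show ?thesis .
    qed
    ultimately show ?thesis by (subst DERIV_cong_ev[OF refl _ refl])
  qed
qed

text \<open>A class of functions that contains a bump supported in the ball of radius \<open>\<kappa>\<close> and is closed under
  partial derivatives, which makes its members smooth.\<close>

inductive bump_poly :: "real \<Rightarrow> ('a::euclidean_space \<Rightarrow> real) \<Rightarrow> bool" for \<kappa> where
  "bump_poly \<kappa> (\<lambda>x. c)"
| "bump_poly \<kappa> (\<lambda>x. x \<bullet> b)"
| "bump_poly \<kappa> (\<lambda>x. flat_exp n (\<kappa>\<^sup>2 - x \<bullet> x))"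
| "bump_poly \<kappa> f \<Longrightarrow> bump_poly \<kappa> g \<Longrightarrow> bump_poly \<kappa> (\<lambda>x. f x + g x)"
| "bump_poly \<kappa> f \<Longrightarrow> bump_poly \<kappa> g \<Longrightarrow> bump_poly \<kappa> (\<lambda>x. f x * g x)"

lemma bump_poly_deriv:
  assumes "bump_poly \<kappa> f"
  shows "\<exists>f'. (\<forall>x. (f has_derivative f' x) (at x)) \<and> (\<forall>b. bump_poly \<kappa> (\<lambda>x. f' x b))"
  using assms
proof induction
  case (1 c)
  then show ?case by (intro exI[of _ "\<lambda>x h. 0"]) (auto intro: bump_poly.intros)
next
  case (2 b)
  have "((\<lambda>x. x \<bullet> b) has_derivative (\<lambda>h. h \<bullet> b)) (at x)" for x
    by (auto intro!: derivative_eq_intros)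
  then show ?case by (intro exI[of _ "\<lambda>x h. h \<bullet> b"]) (auto intro: bump_poly.intros)
next
  case (3 n)
  let ?D = "\<lambda>x h. (flat_exp (n + 2) (\<kappa>\<^sup>2 - x \<bullet> x) + (- real n) * flat_exp (n + 1) (\<kappa>\<^sup>2 - x \<bullet> x)) * ((- 2) * (x \<bullet> h))"
  have "((\<lambda>x. flat_exp n (\<kappa>\<^sup>2 - x \<bullet> x)) has_derivative ?D x) (at x)" for x
  proof -
    have "((\<lambda>x. \<kappa>\<^sup>2 - x \<bullet> x) has_derivative (\<lambda>h. - 2 * (x \<bullet> h))) (at x)"
      by (auto intro!: derivative_eq_intros simp: inner_commute)
    from has_derivative_compose[OF this flat_exp_deriv[unfolded has_field_derivative_def]]
    show ?thesis by (simp add: mult_ac)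
  qed
  moreover have "bump_poly \<kappa> (\<lambda>x. ?D x b)" for b
    by (rule bump_poly.intros)+
  ultimately show ?case by (intro exI[of _ ?D]) auto
next
  case (4 f g)
  then obtain f' g' where *: "\<And>x. (f has_derivative f' x) (at x)" "\<And>b. bump_poly \<kappa> (\<lambda>x. f' x b)"
    "\<And>x. (g has_derivative g' x) (at x)" "\<And>b. bump_poly \<kappa> (\<lambda>x. g' x b)" by auto
  then show ?case
    by (intro exI[of _ "\<lambda>x h. f' x h + g' x h"]) (auto intro: bump_poly.intros has_derivative_add)
next
  case (5 f g)
  then obtain f' g' where *: "\<And>x. (f has_derivative f' x) (at x)" "\<And>b. bump_poly \<kappa> (\<lambda>x. f' x b)"
    "\<And>x. (g has_derivative g' x) (at x)" "\<And>b. bump_poly \<kappa> (\<lambda>x. g' x b)" by auto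
  have "bump_poly \<kappa> (\<lambda>x. f x * g' x b + f' x b * g x)" for b
    by (rule bump_poly.intros(4)[OF bump_poly.intros(5)[OF 5(1) *(4)] bump_poly.intros(5)[OF *(2) 5(2)]])
  then show ?case
    using * by (intro exI[of _ "\<lambda>x h. f x * g' x h + f' x h * g x"]) (auto intro: has_derivative_mult)
qed

lemma bump_poly_C_k: "bump_poly \<kappa> f \<Longrightarrow> C_k k f"
proof (induction k arbitrary: f)
  case 0
  then obtain f' where "\<And>x. (f has_derivative f' x) (at x)" using bump_poly_deriv by blast
  then show ?case
    by (auto intro!: continuous_at_imp_continuous_on has_derivative_continuous)
next
  case (Suc k)
  then obtain f' where f': "\<And>x. (f has_derivative f' x) (at x)" "\<And>b. bump_poly \<kappa> (\<lambda>x. f' x b)"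
    using bump_poly_deriv by blast
  then have "frechet_derivative f (at x) = f' x" for x using frechet_derivative_at by metis
  then show ?case using f' Suc.IH by (auto simp: differentiable_def)
qed

section \<open>Smooth functions and convolution\<close>

definition smooth :: "('a::euclidean_space \<Rightarrow> real) \<Rightarrow> bool" where
  "smooth f \<longleftrightarrow> (\<forall>k. C_k k f)"

lemma smooth_continuous: "smooth f \<Longrightarrow> continuous_on UNIV f"
  unfolding smooth_def by (metis C_k.simps(1))

lemma smooth_has_derivative: "smooth f \<Longrightarrow> (f has_derivative frechet_derivative f (at x)) (at x)"
  unfolding smooth_def by (metis C_k.simps(2) frechet_derivative_works)

lemma smooth_partial: "smooth f \<Longrightarrow> b \<in> Basis \<Longrightarrow> smooth (\<lambda>x. frechet_derivative f (at x) b)"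
  unfolding smooth_def by (metis C_k.simps(2))

lemma test_function_smooth: "test_function D f \<Longrightarrow> smooth f"
  by (simp add: test_function_def smooth_def)

lemma frechet_derivative_eq_gradient:
  assumes "smooth f" shows "frechet_derivative f (at x) h = gradient f x \<bullet> h"
proof -
  let ?F = "frechet_derivative f (at x)"
  have lin: "linear ?F" using smooth_has_derivative[OF assms] has_derivative_linear by blast
  have "?F h = ?F (\<Sum>b\<in>Basis. (h \<bullet> b) *\<^sub>R b)" by (simp add: euclidean_representation)
  also have "\<dots> = (\<Sum>b\<in>Basis. (h \<bullet> b) * ?F b)"
    by (simp add: linear_sum[OF lin] linear_scale[OF lin])
  also have "\<dots> = gradient f x \<bullet> h"
    by (simp add: gradient_def inner_sum_left inner_commute[of h] mult.commute)
  finally show ?thesis .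
qed

lemma smooth_gradient: "smooth f \<Longrightarrow> (f has_derivative (\<lambda>h. gradient f x \<bullet> h)) (at x)"
  using smooth_has_derivative[of f x] frechet_derivative_eq_gradient[of f x] by (metis (no_types, lifting) ext)

lemma smooth_continuous_gradient: "smooth f \<Longrightarrow> continuous_on UNIV (gradient f)"
  unfolding gradient_def
  by (intro continuous_intros) (auto intro!: smooth_continuous smooth_partial)

lemma gradient_inner_Basis: "b \<in> Basis \<Longrightarrow> gradient f x \<bullet> b = frechet_derivative f (at x) b"
  by (simp add: gradient_def inner_sum_left_Basis)

lemma bump_exists:
  fixes \<kappa> :: real assumes "\<kappa> > 0"
  obtains \<eta> :: "'a::euclidean_space \<Rightarrow> real" where
    "smooth \<eta>" "\<And>x. 0 \<le> \<eta> x" "\<And>x. \<eta> x \<noteq> 0 \<Longrightarrow> norm x < \<kappa>" "integrable lborel \<eta>" "(LINT x|lborel. \<eta> x) = 1"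
proof -
  define q :: "'a \<Rightarrow> real" where "q x = flat_exp 0 (\<kappa>\<^sup>2 - x \<bullet> x)" for x
  have bq: "bump_poly \<kappa> q" unfolding q_def[abs_def] by (rule bump_poly.intros)
  have supp: "q x \<noteq> 0 \<longleftrightarrow> norm x < \<kappa>" for x
  proof -
    have "norm x < \<kappa> \<longleftrightarrow> x \<bullet> x < \<kappa>\<^sup>2"
      using assms by (simp add: norm_eq_sqrt_inner real_sqrt_less_iff[symmetric, of "x \<bullet> x" "\<kappa>\<^sup>2"] del: real_sqrt_less_iff)
    then show ?thesis by (auto simp: q_def flat_exp_def)
  qed
  have nn: "0 \<le> q x" for x by (simp add: q_def flat_exp_def)
  have cq: "continuous_on UNIV q" using bump_poly_C_k[OF bq, of 0] by simp
  have "integrable lborel (\<lambda>x. indicator (cball 0 \<kappa>) x *\<^sub>R q x)"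
    using borel_integrable_compact[OF compact_cball continuous_on_subset[OF cq subset_UNIV]] by simp
  moreover have "(\<lambda>x. indicator (cball 0 \<kappa>) x *\<^sub>R q x) = q"
  proof
    fix x show "indicator (cball 0 \<kappa>) x *\<^sub>R q x = q x"
      using supp[of x] by (cases "q x = 0") auto
  qed
  ultimately have int: "integrable lborel q" by simp
  define I where "I = (LINT x|lborel. q x)"
  have "I \<noteq> 0"
  proof
    assume "I = 0"
    then have "AE x in lborel. q x = 0"
      using int nn by (simp add: I_def integral_nonneg_eq_0_iff_AE)
    moreover have "emeasure lborel (ball (0::'a) \<kappa>) \<noteq> 0"
      using content_ball_pos[OF assms, of "0::'a"] by (auto simp: measure_def)
    moreover have "{x\<in>space lborel. \<not> q x = 0} = ball 0 \<kappa>"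
      by (rule set_eqI) (simp only: mem_Collect_eq space_lborel space_borel UNIV_I simp_thms supp mem_ball_0)
    ultimately show False using AE_iff_measurable[of "ball 0 \<kappa>" lborel "\<lambda>x. q x = 0"] by simp
  qed
  moreover have "0 \<le> I" unfolding I_def using nn by simp
  ultimately have I: "I > 0" by simp
  show ?thesis
  proof (rule that[of "\<lambda>x. inverse I * q x"])
    have "bump_poly \<kappa> (\<lambda>x. inverse I * q x)" by (intro bump_poly.intros bq)
    then show "smooth (\<lambda>x. inverse I * q x)" using bump_poly_C_k by (auto simp: smooth_def)
    show "0 \<le> inverse I * q x" for x using I nn by simp
    show "norm x < \<kappa>" if "inverse I * q x \<noteq> 0" for x using that supp by auto
    show "integrable lborel (\<lambda>x. inverse I * q x)" using int by simp
    show "(LINT x|lborel. inverse I * q x) = 1" using I by (simp add: I_def)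
  qed
qed

text \<open>The derivative falls on the smooth kernel under an integral over a fixed box. The result
  is again such a convolution, with a partial derivative of \<open>\<eta>\<close> as kernel, which
  drives the induction in \<open>convolution_smooth\<close>.\<close>

lemma convolution_has_derivative:
  fixes v \<eta> :: "'a::euclidean_space \<Rightarrow> real"
  assumes v: "continuous_on UNIV v" and \<eta>: "smooth \<eta>"
  shows "((\<lambda>x. integral (cbox p q) (\<lambda>t. v t * \<eta> (x - t))) has_derivative
      (\<lambda>h. \<Sum>b\<in>Basis. (h \<bullet> b) * integral (cbox p q) (\<lambda>t. v t * frechet_derivative \<eta> (at (x - t)) b))) (at x)"
proof -
  define fx where "fx x t = v t *\<^sub>R blinfun_inner_right (gradient \<eta> (x - t))" for x t
  have cg: "continuous_on S (\<lambda>z. gradient \<eta> (h z))" if "continuous_on S h" for h and S :: "('b::topological_space) set"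
    using continuous_on_compose2[OF smooth_continuous_gradient[OF \<eta>] that] by simp
  have ce: "continuous_on S (\<lambda>z. \<eta> (h z))" if "continuous_on S h" for h and S :: "('b::topological_space) set"
    using continuous_on_compose2[OF smooth_continuous[OF \<eta>] that] by simp
  have cv: "continuous_on S (\<lambda>z. v (h z))" if "continuous_on S h" for h and S :: "('b::topological_space) set"
    using continuous_on_compose2[OF v that] by simp
  have cfx: "continuous_on S (\<lambda>z. fx (h z) (k z))" if "continuous_on S h" "continuous_on S k" for h k and S :: "('b::topological_space) set"
    unfolding fx_def
    by (intro continuous_intros bounded_linear.continuous_on[OF bounded_linear_blinfun_inner_right] cg cv that)
  have der: "((\<lambda>x. integral (cbox p q) (\<lambda>t. v t * \<eta> (x - t))) has_derivative blinfun_apply (integral (cbox p q) (fx x))) (at x within UNIV)"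
  proof (rule leibniz_rule)
    fix y t
    have "((\<lambda>x. \<eta> (x - t)) has_derivative (\<lambda>h. gradient \<eta> (y - t) \<bullet> h)) (at y)"
    proof (rule has_derivative_compose[of "\<lambda>x. x - t" "\<lambda>h. h" y UNIV \<eta>, OF _ smooth_gradient[OF \<eta>]])
      show "((\<lambda>x. x - t) has_derivative (\<lambda>h. h)) (at y)" by (auto intro!: derivative_eq_intros)
    qed
    then have "((\<lambda>x. v t * \<eta> (x - t)) has_derivative (\<lambda>h. v t * (gradient \<eta> (y - t) \<bullet> h))) (at y)"
      by (rule has_derivative_mult_right)
    then show "((\<lambda>x. v t * \<eta> (x - t)) has_derivative blinfun_apply (fx y t)) (at y within UNIV)"
      by (simp add: fx_def scaleR_blinfun.rep_eq)
    show "(\<lambda>t. v t * \<eta> (y - t)) integrable_on cbox p q"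
      by (intro integrable_continuous continuous_intros ce cv)
  next
    show "continuous_on (UNIV \<times> cbox p q) (\<lambda>(x, t). fx x t)"
      unfolding case_prod_unfold by (intro cfx continuous_intros)
  qed auto
  have int: "fx x integrable_on cbox p q"
    by (intro integrable_continuous cfx continuous_intros)
  have "blinfun_apply (integral (cbox p q) (fx x)) h
    = (\<Sum>b\<in>Basis. (h \<bullet> b) * integral (cbox p q) (\<lambda>t. v t * frechet_derivative \<eta> (at (x - t)) b))" for h
  proof -
    let ?B = "blinfun_apply (integral (cbox p q) (fx x))"
    have "?B h = ?B (\<Sum>b\<in>Basis. (h \<bullet> b) *\<^sub>R b)" by (simp add: euclidean_representation)
    also have "\<dots> = (\<Sum>b\<in>Basis. (h \<bullet> b) * ?B b)" by (simp add: blinfun.sum_right blinfun.scaleR_right)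
    also have "\<dots> = (\<Sum>b\<in>Basis. (h \<bullet> b) * integral (cbox p q) (\<lambda>t. v t * frechet_derivative \<eta> (at (x - t)) b))"
      using blinfun_apply_integral[OF int]
      by (intro sum.cong) (auto simp: fx_def scaleR_blinfun.rep_eq gradient_inner_Basis)
    finally show ?thesis .
  qed
  then show ?thesis using der by (metis (no_types, lifting) ext)
qed

lemma convolution_smooth:
  fixes v \<eta> :: "'a::euclidean_space \<Rightarrow> real"
  assumes v: "continuous_on UNIV v" and \<eta>: "smooth \<eta>"
  shows "smooth (\<lambda>x. integral (cbox p q) (\<lambda>t. v t * \<eta> (x - t)))"
proof -
  have "C_k k (\<lambda>x. integral (cbox p q) (\<lambda>t. v t * \<eta> (x - t)))" if "smooth \<eta>" for k \<eta>
    using that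
  proof (induction k arbitrary: \<eta>)
    case 0
    then show ?case
      using convolution_has_derivative[OF v 0]
      by (auto intro!: continuous_at_imp_continuous_on has_derivative_continuous)
  next
    case (Suc k)
    let ?\<phi> = "\<lambda>x. integral (cbox p q) (\<lambda>t. v t * \<eta> (x - t))"
    have "frechet_derivative ?\<phi> (at x) b = integral (cbox p q) (\<lambda>t. v t * frechet_derivative \<eta> (at (x - t)) b)"
      if "b \<in> Basis" for x b
      using that
      by (subst frechet_derivative_at[OF convolution_has_derivative[OF v Suc.prems], symmetric])
         (simp add: inner_Basis if_distrib[of "\<lambda>x. x * _"] cong: if_cong)
    then show ?case
      using convolution_has_derivative[OF v Suc.prems, of p q] Suc.IH[OF smooth_partial[OF Suc.prems]]
      unfolding C_k.simps differentiable_def by simp blast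
  qed
  then show ?thesis using \<eta> by (auto simp: smooth_def)
qed

lemma lborel_integral_reflect:
  fixes F :: "'a::euclidean_space \<Rightarrow> real"
  assumes [measurable]: "F \<in> borel_measurable borel"
  shows "(LINT y|lborel. F (x - y)) = (LINT y|lborel. F y)"
proof -
  have "lborel = distr lborel borel (\<lambda>y. x - y)"
    using lborel_affine[of "- 1" x] by (simp add: density_1)
  then have "(LINT y|lborel. F y) = (LINT y|distr lborel borel (\<lambda>y. x - y). F y)" by simp
  also have "\<dots> = (LINT y|lborel. F (x - y))" by (subst integral_distr) auto
  finally show ?thesis by simp
qed

text \<open>Along the direction of the gradient, the difference quotient tends to its squared norm,
  while the Lipschitz bound limits it by \<open>c\<close> times the norm.\<close>

lemma gradient_norm_le:
  fixes f :: "'a::euclidean_space \<Rightarrow> real"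
  assumes f: "smooth f" and d: "d > 0" and le: "\<And>y. norm (y - x) < d \<Longrightarrow> \<bar>f y - f x\<bar> \<le> c * norm (y - x)"
  shows "norm (gradient f x) \<le> c"
proof (cases "gradient f x = 0")
  case True
  obtain b :: 'a where b: "b \<in> Basis" using nonempty_Basis by blast
  have "0 \<le> c * norm ((x + (d / 2) *\<^sub>R b) - x)"
    using le[of "x + (d / 2) *\<^sub>R b"] d b by (intro order_trans[OF abs_ge_zero le]) auto
  then show ?thesis using True d b by (simp add: zero_le_mult_iff)
next
  case False
  define g where "g = gradient f x"
  have "((\<lambda>t. f (x + t *\<^sub>R g)) has_derivative (\<lambda>t. gradient f x \<bullet> (t *\<^sub>R g))) (at 0)"
  proof (rule has_derivative_compose[of "\<lambda>t. x + t *\<^sub>R g" "\<lambda>t. t *\<^sub>R g" 0 UNIV f])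
    show "((\<lambda>t. x + t *\<^sub>R g) has_derivative (\<lambda>t. t *\<^sub>R g)) (at 0)"
      by (auto intro!: derivative_eq_intros)
    show "(f has_derivative (\<lambda>h. gradient f x \<bullet> h)) (at (x + 0 *\<^sub>R g))"
      using smooth_gradient[OF f, of x] by simp
  qed
  then have "((\<lambda>t. f (x + t *\<^sub>R g)) has_real_derivative (norm g)\<^sup>2) (at 0)"
    by (simp add: has_field_derivative_def g_def[symmetric] dot_square_norm mult_commute_abs)
  then have lim: "((\<lambda>t. (f (x + t *\<^sub>R g) - f x) / t) \<longlongrightarrow> (norm g)\<^sup>2) (at 0)"
    by (simp add: has_field_derivative_iff)
  have "(norm g)\<^sup>2 \<le> c * norm g"
  proof (rule tendsto_upperbound[OF lim])
    have "\<forall>\<^sub>F t in at (0::real). \<bar>t\<bar> < d / norm g"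
      using d False by (auto simp: eventually_at g_def intro!: exI[of _ "d / norm g"])
    moreover have "\<forall>\<^sub>F t in at (0::real). t \<noteq> 0" by (simp add: eventually_at_filter)
    ultimately show "\<forall>\<^sub>F t in at 0. (f (x + t *\<^sub>R g) - f x) / t \<le> c * norm g"
    proof eventually_elim
      case (elim t)
      have "\<bar>f (x + t *\<^sub>R g) - f x\<bar> \<le> c * (\<bar>t\<bar> * norm g)"
        using le[of "x + t *\<^sub>R g"] elim False by (simp add: g_def field_simps)
      then have "\<bar>(f (x + t *\<^sub>R g) - f x) / t\<bar> \<le> c * norm g"
        using elim by (simp add: abs_divide field_simps)
      then show ?case by linarith
    qed
  qed simp
  then show ?thesis using False by (simp add: g_def power2_eq_square)
qed

text \<open>Averages over balls of radius \<open>\<kappa>\<close> inherit local Lipschitz constants: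
  increments of \<open>\<phi>\<close> near \<open>x\<close> average increments of \<open>v\<close>
  within distance \<open>2 * \<kappa>\<close> of \<open>x\<close>. The last property is what turns
  slope bounds for \<open>v\<close> into gradient bounds.\<close>

lemma mollification:
  fixes v :: "'a::euclidean_space \<Rightarrow> real"
  assumes bd: "bounded {x. v x \<noteq> 0}" and lip: "\<And>y z. \<bar>v y - v z\<bar> \<le> C * dist y z" and \<kappa>: "\<kappa> > 0"
  obtains \<phi> where "smooth \<phi>" "\<And>x. \<phi> x \<noteq> 0 \<Longrightarrow> \<exists>y. v y \<noteq> 0 \<and> dist x y < \<kappa>"
    "\<And>x. \<bar>\<phi> x - v x\<bar> \<le> C * \<kappa>"
    "\<And>x c. (\<And>y z. dist x y < 2 * \<kappa> \<Longrightarrow> dist x z < 2 * \<kappa> \<Longrightarrow> \<bar>v y - v z\<bar> \<le> c * dist y z) \<Longrightarrow> norm (gradient \<phi> x) \<le> c"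
proof -
  obtain \<eta> :: "'a \<Rightarrow> real" where \<eta>: "smooth \<eta>" "\<And>x. 0 \<le> \<eta> x" "\<And>x. \<eta> x \<noteq> 0 \<Longrightarrow> norm x < \<kappa>"
    "integrable lborel \<eta>" "(LINT x|lborel. \<eta> x) = 1"
    using bump_exists[OF \<kappa>] by metis
  have C: "0 \<le> C"
  proof -
    obtain b :: 'a where b: "b \<in> Basis" using nonempty_Basis by blast
    then show ?thesis using order_trans[OF abs_ge_zero lip[of b 0]] by simp
  qed
  have v: "continuous_on UNIV v"
  proof (rule lipschitz_on_continuous_on[of C])
    show "C-lipschitz_on UNIV v" using lip C by (auto simp: lipschitz_on_def dist_real_def)
  qed
  have \<eta>c: "continuous_on UNIV \<eta>" using smooth_continuous[OF \<eta>(1)] .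
  obtain r where r: "{x. v x \<noteq> 0} \<subseteq> cbox (- r) r"
    using bounded_subset_cbox_symmetric[OF bd] by auto
  define \<phi> where "\<phi> x = integral (cbox (- r) r) (\<lambda>t. v t * \<eta> (x - t))" for x
  have bor [measurable]: "v \<in> borel_measurable borel" "\<eta> \<in> borel_measurable borel"
    using v \<eta>c by (auto intro: borel_measurable_continuous_onI)
  have intp: "integrable lborel (\<lambda>y. v (x - y) * \<eta> y)" for x
  proof -
    have "compact (cball (0 :: 'a) \<kappa>)" by simp
    then have "integrable lborel (\<lambda>y. indicator (cball 0 \<kappa>) y *\<^sub>R (v (x - y) * \<eta> y))"
      by (rule borel_integrable_compact)
         (intro continuous_intros continuous_on_subset[OF \<eta>c] continuous_on_compose2[OF v]; simp)
    moreover have "(\<lambda>y. indicator (cball 0 \<kappa>) y *\<^sub>R (v (x - y) * \<eta> y)) = (\<lambda>y. v (x - y) * \<eta> y)"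
    proof
      fix y show "indicator (cball 0 \<kappa>) y *\<^sub>R (v (x - y) * \<eta> y) = v (x - y) * \<eta> y"
        using \<eta>(3)[of y] by (cases "\<eta> y = 0") (auto simp: indicator_def)
    qed
    ultimately show ?thesis by simp
  qed
  have \<phi>: "\<phi> x = (LINT y|lborel. v (x - y) * \<eta> y)" for x
  proof -
    have "continuous_on (cbox (- r) r) (\<lambda>t. v t * \<eta> (x - t))"
      by (intro continuous_intros continuous_on_subset[OF v] continuous_on_compose2[OF \<eta>c]) auto
    then have "set_integrable lborel (cbox (- r) r) (\<lambda>t. v t * \<eta> (x - t))"
      unfolding set_integrable_def by (rule borel_integrable_compact[OF compact_cbox])
    then have "\<phi> x = (LINT t|lborel. indicator (cbox (- r) r) t *\<^sub>R (v t * \<eta> (x - t)))"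
      unfolding \<phi>_def by (simp only: set_borel_integral_eq_integral(2)[symmetric] set_lebesgue_integral_def)
    also have "(\<lambda>t. indicator (cbox (- r) r) t *\<^sub>R (v t * \<eta> (x - t))) = (\<lambda>t. v t * \<eta> (x - t))"
    proof
      fix t show "indicator (cbox (- r) r) t *\<^sub>R (v t * \<eta> (x - t)) = v t * \<eta> (x - t)"
        using r by (cases "v t = 0") (auto simp: indicator_def)
    qed
    also have "(LINT t|lborel. v t * \<eta> (x - t)) = (LINT y|lborel. v (x - y) * \<eta> (x - (x - y)))"
      by (rule lborel_integral_reflect[symmetric]) measurable
    finally show ?thesis by simp
  qed
  have diff: "\<bar>(LINT y|lborel. (v (x + h - y) - v (x' - y)) * \<eta> y)\<bar> \<le> B"
    if "\<And>y. norm y < \<kappa> \<Longrightarrow> \<bar>v (x + h - y) - v (x' - y)\<bar> \<le> B" for x h x' B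
  proof -
    have B: "0 \<le> B" using that[of 0] \<kappa> by simp
    have "\<bar>(LINT y|lborel. (v (x + h - y) - v (x' - y)) * \<eta> y)\<bar> \<le> (LINT y|lborel. B * \<eta> y)"
    proof (rule integral_abs_bound_integral)
      show "integrable lborel (\<lambda>y. (v (x + h - y) - v (x' - y)) * \<eta> y)"
        using Bochner_Integration.integrable_diff[OF intp[of "x + h"] intp[of x']] by (simp add: left_diff_distrib)
      show "integrable lborel (\<lambda>y. B * \<eta> y)" using \<eta>(4) by simp
      show "\<bar>(v (x + h - y) - v (x' - y)) * \<eta> y\<bar> \<le> B * \<eta> y" for y
        using that[of y] \<eta>(2,3)[of y] by (cases "\<eta> y = 0") (auto simp: abs_mult intro!: mult_right_mono)
    qed
    then show ?thesis using \<eta>(5) by simp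
  qed
  have sm: "smooth \<phi>" unfolding \<phi>_def by (rule convolution_smooth[OF v \<eta>(1)])
  show ?thesis
  proof (rule that[OF sm])
    fix x
    show "\<exists>y. v y \<noteq> 0 \<and> dist x y < \<kappa>" if "\<phi> x \<noteq> 0"
    proof (rule ccontr)
      assume no: "\<not> ?thesis"
      have "v (x - y) * \<eta> y = 0" for y
        using no \<eta>(3)[of y] by (auto simp: dist_norm)
      then have "(LINT y|lborel. v (x - y) * \<eta> y) = (LINT y::'a|lborel. 0)"
        by (intro Bochner_Integration.integral_cong) auto
      then show False using that \<phi>[of x] by simp
    qed
    have "\<phi> x - v x = (LINT y|lborel. v (x - y) * \<eta> y) - (LINT y|lborel. v x * \<eta> y)"
      using \<eta>(5) by (simp add: \<phi>)
    also have "\<dots> = (LINT y|lborel. (v (x - y) - v x) * \<eta> y)"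
      using intp[of x] \<eta>(4) by (subst Bochner_Integration.integral_diff[symmetric]) (auto simp: left_diff_distrib)
    finally have e: "\<phi> x - v x = (LINT y|lborel. (v (x - y) - v x) * \<eta> y)" .
    show "\<bar>\<phi> x - v x\<bar> \<le> C * \<kappa>"
    proof -
      have "\<bar>(LINT y|lborel. (v (x - y) - v x) * \<eta> y)\<bar> \<le> (LINT y|lborel. (C * \<kappa>) * \<eta> y)"
      proof (rule integral_abs_bound_integral)
        show "integrable lborel (\<lambda>y. (v (x - y) - v x) * \<eta> y)"
          using intp[of x] \<eta>(4) by (simp add: left_diff_distrib)
        show "integrable lborel (\<lambda>y. (C * \<kappa>) * \<eta> y)" using \<eta>(4) by simp
        show "\<bar>(v (x - y) - v x) * \<eta> y\<bar> \<le> (C * \<kappa>) * \<eta> y" for y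
        proof (cases "\<eta> y = 0")
          case False
          then have "\<bar>v (x - y) - v x\<bar> \<le> C * norm y" "norm y < \<kappa>" using lip[of "x - y" x] \<eta>(3)[of y] by (auto simp: dist_norm)
          then have "\<bar>v (x - y) - v x\<bar> \<le> C * \<kappa>" using C by (meson less_imp_le mult_left_mono order_trans)
          then show ?thesis using \<eta>(2)[of y] by (simp add: abs_mult mult_right_mono)
        qed simp
      qed
      then show ?thesis using \<eta>(5) e by simp
    qed
    fix c assume c: "\<And>y z. dist x y < 2 * \<kappa> \<Longrightarrow> dist x z < 2 * \<kappa> \<Longrightarrow> \<bar>v y - v z\<bar> \<le> c * dist y z"
    show "norm (gradient \<phi> x) \<le> c"
    proof (rule gradient_norm_le[OF sm \<kappa>])
      fix y assume y: "norm (y - x) < \<kappa>"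
      have "\<phi> y - \<phi> x = (LINT u|lborel. (v (x + (y - x) - u) - v (x - u)) * \<eta> u)"
        using intp[of x] intp[of y] unfolding \<phi>
        by (subst Bochner_Integration.integral_diff[symmetric]) (auto simp: left_diff_distrib)
      also have "\<bar>\<dots>\<bar> \<le> c * norm (y - x)"
      proof (rule diff)
        fix u :: 'a assume u: "norm u < \<kappa>"
        have "norm (u - (y - x)) < 2 * \<kappa>" using norm_triangle_ineq4[of u "y - x"] u y by linarith
        then have "\<bar>v (y - u) - v (x - u)\<bar> \<le> c * dist (y - u) (x - u)"
          using u \<kappa> by (intro c) (auto simp: dist_norm algebra_simps)
        then show "\<bar>v (x + (y - x) - u) - v (x - u)\<bar> \<le> c * norm (y - x)" by (simp add: dist_norm)
      qed
      finally show "\<bar>\<phi> y - \<phi> x\<bar> \<le> c * norm (y - x)" .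
    qed
  qed
qed

section \<open>Rayleigh quotients of test functions\<close>

lemma integrable_continuous_bounded_support:
  fixes f :: "'a::euclidean_space \<Rightarrow> real"
  assumes "continuous_on UNIV f" "bounded {x. f x \<noteq> 0}"
  shows "integrable lborel f"
proof -
  obtain R where R: "\<And>x. f x \<noteq> 0 \<Longrightarrow> norm x \<le> R" using assms(2) by (auto simp: bounded_iff)
  have "integrable lborel (\<lambda>x. indicator (cball 0 R) x *\<^sub>R f x)"
    by (rule borel_integrable_compact) (auto intro: continuous_on_subset[OF assms(1)])
  moreover have "(\<lambda>x. indicator (cball 0 R) x *\<^sub>R f x) = f"
  proof
    fix x show "indicator (cball 0 R) x *\<^sub>R f x = f x" using R[of x] by (cases "f x = 0") auto
  qed
  ultimately show ?thesis by simp
qed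

text \<open>The integral of the difference quotient vanishes by translation invariance.\<close>

lemma integral_partial_derivative_zero:
  fixes f :: "'a::euclidean_space \<Rightarrow> real"
  assumes der: "\<And>x. (f has_derivative f' x) (at x)" and cont: "continuous_on UNIV (\<lambda>x. f' x b)"
    and bd: "bounded {x. f x \<noteq> 0}"
  shows "integrable lborel (\<lambda>x. f' x b)" "(LINT x|lborel. f' x b) = 0"
proof -
  obtain R where R: "\<And>x. f x \<noteq> 0 \<Longrightarrow> norm x \<le> R" using bd by (auto simp: bounded_iff)
  \<comment> \<open>The margin leaves room for the shifts by \<open>h n *\<^sub>R b\<close> with
    \<open>h n \<le> 1\<close>: outside \<open>C\<close> the difference quotients vanish, so a
    multiple of the indicator of \<open>C\<close> dominates them.\<close>
  define C where "C = cball (0::'a) (R + 1 + norm b)"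
  have cf: "continuous_on UNIV f"
    using der by (auto intro!: continuous_at_imp_continuous_on has_derivative_continuous)
  have fz: "f y = 0" if "R < norm y" for y using R[of y] that by fastforce
  have zero: "f' x b = 0" if "R < norm x" for x
  proof -
    have "((\<lambda>y. 0) has_derivative f' x) (at x)"
    proof (rule has_derivative_transform_within_open[OF der[of x], of "- cball 0 R"])
      show "f y = 0" if "y \<in> - cball 0 R" for y using that fz by (simp add: not_le)
    qed (use that in auto)
    then have "f' x = (\<lambda>h. 0)" using has_derivative_unique has_derivative_const by blast
    then show ?thesis by simp
  qed
  have "compact ((\<lambda>x. f' x b) ` C)"
    unfolding C_def by (intro compact_continuous_image continuous_on_subset[OF cont]) auto
  then obtain M where M: "\<And>x. x \<in> C \<Longrightarrow> \<bar>f' x b\<bar> \<le> M"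
    using compact_imp_bounded by (force simp: bounded_iff)
  have M': "\<bar>f' x b\<bar> \<le> \<bar>M\<bar>" for x
    using M[of x] zero[of x] norm_ge_zero[of b] by (cases "R < norm x") (auto simp: C_def)
  define h where "h n = inverse (real (Suc n))" for n
  have h: "0 < h n" "h n \<le> 1" for n by (auto simp: h_def inverse_le_1_iff)
  have hlim: "h \<longlonglongrightarrow> 0" unfolding h_def by (rule LIMSEQ_inverse_real_of_nat)
  define q where "q n x = (f (x + h n *\<^sub>R b) - f x) / h n" for n x
  have bor [measurable]: "f \<in> borel_measurable borel" "(\<lambda>x. f' x b) \<in> borel_measurable borel"
    using cf cont by (auto intro: borel_measurable_continuous_onI)
  have line: "((\<lambda>t. f (x + t *\<^sub>R b)) has_real_derivative f' (x + t *\<^sub>R b) b) (at t)" for x t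
  proof -
    have "((\<lambda>t. f (x + t *\<^sub>R b)) has_derivative (\<lambda>u. f' (x + t *\<^sub>R b) (u *\<^sub>R b))) (at t)"
    proof (rule has_derivative_compose[of "\<lambda>t. x + t *\<^sub>R b" "\<lambda>t. t *\<^sub>R b" t UNIV f])
      show "((\<lambda>t. x + t *\<^sub>R b) has_derivative (\<lambda>t. t *\<^sub>R b)) (at t)"
        by (auto intro!: derivative_eq_intros)
    qed (rule der)
    moreover have "(\<lambda>u. f' (x + t *\<^sub>R b) (u *\<^sub>R b)) = (*) (f' (x + t *\<^sub>R b) b)"
      using linear_scale[OF has_derivative_linear[OF der[of "x + t *\<^sub>R b"]], of _ b]
      by (auto simp: fun_eq_iff mult.commute)
    ultimately show ?thesis by (simp add: has_field_derivative_def)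
  qed
  have lim: "(\<lambda>n. q n x) \<longlonglongrightarrow> f' x b" for x
  proof -
    have "((\<lambda>t. (f (x + t *\<^sub>R b) - f x) / t) \<longlongrightarrow> f' x b) (at 0)"
      using line[of x 0] by (simp add: has_field_derivative_iff)
    moreover have "filterlim h (at 0) sequentially"
      using hlim h by (auto simp: filterlim_at intro!: always_eventually) (metis less_irrefl)
    ultimately show ?thesis unfolding q_def by (rule filterlim_compose)
  qed
  have bound: "\<bar>q n x\<bar> \<le> \<bar>M\<bar> * indicator C x" for n x
  proof (cases "x \<in> C")
    case True
    obtain t where "f (x + h n *\<^sub>R b) - f (x + 0 *\<^sub>R b) = (h n - 0) * f' (x + t *\<^sub>R b) b"
      using MVT2[OF h(1)[of n], of "\<lambda>t. f (x + t *\<^sub>R b)" "\<lambda>t. f' (x + t *\<^sub>R b) b"] line by blast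
    then have "q n x = f' (x + t *\<^sub>R b) b" using h(1)[of n] by (simp add: q_def)
    then show ?thesis using True M' by simp
  next
    case False
    have "norm (h n *\<^sub>R b) \<le> norm b" using h[of n] by (simp add: mult_left_le_one_le)
    then have "norm (x + h n *\<^sub>R b) \<ge> norm x - norm b"
      using norm_triangle_ineq4[of "x + h n *\<^sub>R b" "h n *\<^sub>R b"] by simp
    moreover have "R + 1 + norm b < norm x" using False by (simp add: C_def)
    ultimately have "R < norm (x + h n *\<^sub>R b)" "R < norm x" using norm_ge_zero[of b] by linarith+
    then have "f (x + h n *\<^sub>R b) = 0" "f x = 0" by (auto intro: fz)
    then show ?thesis using False by (simp add: q_def)
  qed
  have intC: "integrable lborel (\<lambda>x. \<bar>M\<bar> * indicator C x)"
    using emeasure_compact_finite[of C] by (auto simp: C_def less_top)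
  have intf: "integrable lborel f" by (rule integrable_continuous_bounded_support[OF cf bd])
  have tr: "integrable lborel (\<lambda>x. f (x + c))" "(LINT x|lborel. f (x + c)) = (LINT x|lborel. f x)" for c
  proof -
    have d: "distr lborel borel (\<lambda>x. x + c) = lborel"
      unfolding add.commute[of _ c] by (rule lborel_distr_plus)
    have "integrable (distr lborel borel (\<lambda>x. x + c)) f" unfolding d by (rule intf)
    then show "integrable lborel (\<lambda>x. f (x + c))" by (subst (asm) integrable_distr_eq) auto
    have "(LINT x|lborel. f x) = (LINT x|distr lborel borel (\<lambda>x. x + c). f x)" unfolding d ..
    then show "(LINT x|lborel. f (x + c)) = (LINT x|lborel. f x)" by (subst (asm) integral_distr) auto
  qed
  have q0: "(LINT x|lborel. q n x) = 0" for n
    using tr[of "h n *\<^sub>R b"] intf by (simp add: q_def diff_divide_distrib)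
  have qm: "q n \<in> borel_measurable lborel" for n unfolding q_def by measurable
  have fm: "(\<lambda>x. f' x b) \<in> borel_measurable lborel" by simp
  have L: "AE x in lborel. (\<lambda>n. q n x) \<longlonglongrightarrow> f' x b" and Bd: "AE x in lborel. norm (q n x) \<le> \<bar>M\<bar> * indicator C x" for n
    using lim bound by auto
  show "integrable lborel (\<lambda>x. f' x b)"
    by (rule integrable_dominated_convergence[OF fm qm intC L Bd])
  have "(\<lambda>n. LINT x|lborel. q n x) \<longlonglongrightarrow> (LINT x|lborel. f' x b)"
    by (rule integral_dominated_convergence[OF fm qm intC L Bd])
  then show "(LINT x|lborel. f' x b) = 0" by (simp add: q0 LIMSEQ_const_iff)
qed

lemma lebesgue_on_eq_lborel:
  fixes f :: "'a::euclidean_space \<Rightarrow> real"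
  assumes D: "open D" and f: "f \<in> borel_measurable borel" and z: "\<And>x. x \<notin> D \<Longrightarrow> f x = 0"
  shows "(LINT x|lebesgue_on D. f x) = (LINT x|lborel. f x)"
    "integrable (lebesgue_on D) f \<longleftrightarrow> integrable lborel f"
proof -
  have i: "(\<lambda>x. indicator D x * f x) = f" using z by (auto simp: fun_eq_iff indicator_def)
  have Ds: "D \<in> sets lebesgue" using D by auto
  have "(LINT x|lebesgue_on D. f x) = (LINT x|lebesgue. f x)"
    using Ds by (subst integral_restrict_space) (simp_all add: i)
  then show "(LINT x|lebesgue_on D. f x) = (LINT x|lborel. f x)"
    using f by (simp add: integral_completion)
  have "integrable (lebesgue_on D) f \<longleftrightarrow> integrable lebesgue f"
    using Ds by (subst integrable_restrict_space) (simp_all add: i)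
  then show "integrable (lebesgue_on D) f \<longleftrightarrow> integrable lborel f"
    using f by (simp add: integrable_completion)
qed

lemma test_functionD:
  assumes "test_function D \<phi>"
  shows "smooth \<phi>" "bounded {x. \<phi> x \<noteq> 0}" "\<And>x. x \<notin> D \<Longrightarrow> \<phi> x = 0" "\<And>x. x \<notin> closure {x. \<phi> x \<noteq> 0} \<Longrightarrow> gradient \<phi> x = 0"
    "\<And>x. x \<notin> D \<Longrightarrow> gradient \<phi> x = 0" "bounded {x. gradient \<phi> x \<noteq> 0}"
proof -
  let ?S = "closure {x. \<phi> x \<noteq> 0}"
  show sm: "smooth \<phi>" using assms by (rule test_function_smooth)
  have S: "compact ?S" "?S \<subseteq> D" using assms by (auto simp: test_function_def)
  show "bounded {x. \<phi> x \<noteq> 0}" using S(1) compact_imp_bounded bounded_subset closure_subset by metis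
  have sup: "x \<in> ?S" if "\<phi> x \<noteq> 0" for x using closure_subset[of "{x. \<phi> x \<noteq> 0}"] that by blast
  show "\<phi> x = 0" if "x \<notin> D" for x using that S(2) sup by blast
  show g: "gradient \<phi> x = 0" if "x \<notin> ?S" for x
  proof -
    have z: "\<phi> y = 0" if "y \<in> - ?S" for y using that sup by blast
    have "((\<lambda>y. 0) has_derivative (\<lambda>h. gradient \<phi> x \<bullet> h)) (at x)"
    proof (rule has_derivative_transform_within_open[OF smooth_gradient[OF sm]])
      show "open (- ?S)" by (rule open_Compl[OF closed_closure])
      show "x \<in> - ?S" using that by blast
    qed (rule z)
    then have "(\<lambda>h. gradient \<phi> x \<bullet> h) = (\<lambda>h. 0)" using has_derivative_unique has_derivative_const by blast
    then have "gradient \<phi> x \<bullet> gradient \<phi> x = 0" by metis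
    then show ?thesis by simp
  qed
  show "gradient \<phi> x = 0" if "x \<notin> D" for x using that S(2) g by blast
  have "{x. gradient \<phi> x \<noteq> 0} \<subseteq> ?S" using g by blast
  then show "bounded {x. gradient \<phi> x \<noteq> 0}" using S(1) compact_imp_bounded bounded_subset by blast
qed

text \<open>Allows a partial derivative of a test function to be inserted as test function into
  \<open>weak_gradient\<close>.\<close>

lemma test_function_partial:
  assumes "test_function D \<phi>" "b \<in> Basis"
  shows "test_function D (\<lambda>x. gradient \<phi> x \<bullet> b)"
proof -
  have "(\<lambda>x. gradient \<phi> x \<bullet> b) = (\<lambda>x. frechet_derivative \<phi> (at x) b)"
    using assms(2) by (simp add: gradient_inner_Basis)
  then have "smooth (\<lambda>x. gradient \<phi> x \<bullet> b)"
    using smooth_partial[OF test_functionD(1)[OF assms(1)] assms(2)] by simp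
  moreover have sub: "closure {x. gradient \<phi> x \<bullet> b \<noteq> 0} \<subseteq> closure {x. \<phi> x \<noteq> 0}"
    using test_functionD(4)[OF assms(1)] by (intro closure_minimal) (force, simp)
  moreover have "compact (closure {x. gradient \<phi> x \<bullet> b \<noteq> 0})"
    using compact_Int_closed[of "closure {x. \<phi> x \<noteq> 0}" "closure {x. gradient \<phi> x \<bullet> b \<noteq> 0}"] sub assms(1)
    by (simp add: test_function_def Int_absorb1)
  ultimately show ?thesis using assms(1) by (auto simp: test_function_def smooth_def)
qed

lemma integration_by_parts:
  fixes f g :: "'a::euclidean_space \<Rightarrow> real"
  assumes f: "smooth f" and g: "smooth g" and bd: "bounded {x. f x \<noteq> 0}"
  shows "(LINT x|lborel. f x * (gradient g x \<bullet> b)) = - (LINT x|lborel. (gradient f x \<bullet> b) * g x)"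
proof -
  have d: "((\<lambda>x. f x * g x) has_derivative (\<lambda>h. f x * (gradient g x \<bullet> h) + (gradient f x \<bullet> h) * g x)) (at x)" for x
    by (rule has_derivative_mult[OF smooth_gradient[OF f] smooth_gradient[OF g]])
  have c: "continuous_on UNIV f" "continuous_on UNIV g" "continuous_on UNIV (gradient f)" "continuous_on UNIV (gradient g)"
    using f g by (auto intro: smooth_continuous smooth_continuous_gradient)
  have c12: "continuous_on UNIV (\<lambda>x. f x * (gradient g x \<bullet> b))" "continuous_on UNIV (\<lambda>x. (gradient f x \<bullet> b) * g x)"
    by (intro continuous_intros c)+
  have z: "(LINT x|lborel. f x * (gradient g x \<bullet> b) + (gradient f x \<bullet> b) * g x) = 0"
    "integrable lborel (\<lambda>x. f x * (gradient g x \<bullet> b) + (gradient f x \<bullet> b) * g x)"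
    using integral_partial_derivative_zero[OF d, of b]
      continuous_on_add[OF c12] bounded_subset[OF bd, of "{x. f x * g x \<noteq> 0}"] by auto
  have i1: "integrable lborel (\<lambda>x. f x * (gradient g x \<bullet> b))"
    by (rule integrable_continuous_bounded_support[OF c12(1)]) (rule bounded_subset[OF bd], auto)
  have "integrable lborel (\<lambda>x. (gradient f x \<bullet> b) * g x)"
    using Bochner_Integration.integrable_diff[OF z(2) i1] by simp
  then show ?thesis using z(1) i1 by simp
qed

lemma test_function_measurable:
  assumes "test_function D \<phi>"
  shows "\<phi> \<in> borel_measurable borel" "gradient \<phi> \<in> borel_measurable borel"
  using test_functionD(1)[OF assms]
  by (auto intro!: borel_measurable_continuous_onI smooth_continuous smooth_continuous_gradient)

lemma test_function_integrable:
  assumes "test_function D \<phi>"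
  shows "integrable lborel (\<lambda>x. (\<phi> x)\<^sup>2)" "integrable lborel (\<lambda>x. (norm (gradient \<phi> x))\<^sup>2)"
  using test_functionD(2,6)[OF assms] test_functionD(1)[OF assms]
  by (intro integrable_continuous_bounded_support continuous_intros smooth_continuous smooth_continuous_gradient; simp)+

lemma test_function_H1_gradient:
  assumes D: "open D" and \<phi>: "test_function D \<phi>"
  shows "H1_gradient D \<phi> (gradient \<phi>)"
proof -
  note m [measurable] = test_function_measurable[OF \<phi>]
  have mD: "f \<in> borel_measurable borel \<Longrightarrow> f \<in> borel_measurable (lebesgue_on D)" for f :: "'a \<Rightarrow> 'b::euclidean_space"
    by (intro measurable_restrict_space1) (auto simp: measurable_completion)
  have "\<phi> \<in> L2_on D" "gradient \<phi> \<in> L2_on D"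
    unfolding L2_on_def
    using test_function_integrable[OF \<phi>] test_functionD(3,5)[OF \<phi>] m
    by (auto intro!: mD lebesgue_on_eq_lborel(2)[OF D, THEN iffD2])
  moreover have "weak_gradient D \<phi> (gradient \<phi>)"
    unfolding weak_gradient_def
  proof (intro allI impI ballI)
    fix \<psi> b assume \<psi>: "test_function D \<psi>" and "b \<in> (Basis :: 'a set)"
    note [measurable] = test_function_measurable[OF \<psi>]
    have "(LINT x|lebesgue_on D. \<phi> x * (gradient \<psi> x \<bullet> b)) = (LINT x|lborel. \<phi> x * (gradient \<psi> x \<bullet> b))"
      using test_functionD(3)[OF \<phi>] by (intro lebesgue_on_eq_lborel[OF D]) auto
    moreover have "(LINT x|lebesgue_on D. (gradient \<phi> x \<bullet> b) * \<psi> x) = (LINT x|lborel. (gradient \<phi> x \<bullet> b) * \<psi> x)"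
      using test_functionD(3)[OF \<psi>] by (intro lebesgue_on_eq_lborel[OF D]) auto
    ultimately show "(LINT x|lebesgue_on D. \<phi> x * (gradient \<psi> x \<bullet> b)) = - (LINT x|lebesgue_on D. (gradient \<phi> x \<bullet> b) * \<psi> x)"
      using integration_by_parts[OF test_functionD(1)[OF \<phi>] test_functionD(1)[OF \<psi>] test_functionD(2)[OF \<phi>]] by simp
  qed
  ultimately show ?thesis by (simp add: H1_gradient_def)
qed

lemma dirichlet_eigenvalue_1_le_rayleigh:
  assumes D: "open D" and \<phi>: "test_function D \<phi>" and pos: "0 < (LINT x|lborel. (\<phi> x)\<^sup>2)"
  shows "dirichlet_eigenvalue_1 D \<le> ennreal ((LINT x|lborel. (norm (gradient \<phi> x))\<^sup>2) / (LINT x|lborel. (\<phi> x)\<^sup>2))"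
proof -
  note [measurable] = test_function_measurable[OF \<phi>]
  have e: "(LINT x|lebesgue_on D. (\<phi> x)\<^sup>2) = (LINT x|lborel. (\<phi> x)\<^sup>2)"
    "(LINT x|lebesgue_on D. (norm (gradient \<phi> x))\<^sup>2) = (LINT x|lborel. (norm (gradient \<phi> x))\<^sup>2)"
    using test_functionD(3,5)[OF \<phi>] by (auto intro!: lebesgue_on_eq_lborel[OF D])
  have "\<phi> \<in> H1_0 D"
    unfolding H1_0_def using test_function_H1_gradient[OF D \<phi>] \<phi>
    by (intro CollectI exI[of _ "gradient \<phi>"] conjI exI[of _ "\<lambda>n. \<phi>"]) auto
  moreover have "\<not> (AE x in lebesgue_on D. \<phi> x = 0)"
  proof
    assume "AE x in lebesgue_on D. \<phi> x = 0"
    then have "(LINT x|lebesgue_on D. (\<phi> x)\<^sup>2) = 0" by (intro integral_eq_zero_AE) auto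
    then show False using e pos by simp
  qed
  ultimately show ?thesis
    unfolding dirichlet_eigenvalue_1_def e[symmetric] using test_function_H1_gradient[OF D \<phi>]
    by (intro Inf_lower) blast
qed

text \<open>The factor of the main term is close to 1 for small \<open>e\<close>, whereas the large
  factor goes to the error, which tends to 0 first.\<close>

lemma norm_sq_young:
  fixes a b :: "'a::real_normed_vector"
  assumes e: "0 < e"
  shows "(norm a)\<^sup>2 \<le> (1 + e) * (norm b)\<^sup>2 + (1 + 1 / e) * (norm (b - a))\<^sup>2"
proof -
  let ?x = "norm b" and ?y = "norm (b - a)"
  have "norm a \<le> ?x + ?y" using norm_triangle_ineq4[of b "b - a"] by simp
  then have "(norm a)\<^sup>2 \<le> (?x + ?y)\<^sup>2" by (intro power_mono) auto
  moreover have "0 \<le> (e * ?x - ?y)\<^sup>2 / e" using e by simp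
  then have "2 * ?x * ?y \<le> e * ?x\<^sup>2 + ?y\<^sup>2 / e"
    using e by (simp add: power2_eq_square field_simps)
  ultimately show ?thesis by (simp add: power2_sum algebra_simps)
qed

lemma square_integrable_combine:
  fixes f g :: "'b \<Rightarrow> 'a::euclidean_space"
  assumes [measurable]: "f \<in> borel_measurable M" "g \<in> borel_measurable M"
    and f: "integrable M (\<lambda>x. (norm (f x))\<^sup>2)" and g: "integrable M (\<lambda>x. (norm (g x))\<^sup>2)"
  shows "integrable M (\<lambda>x. f x \<bullet> g x)" "integrable M (\<lambda>x. (norm (f x - g x))\<^sup>2)"
    "(LINT x|M. (norm (f x - g x))\<^sup>2) = (LINT x|M. (norm (f x))\<^sup>2) - 2 * (LINT x|M. f x \<bullet> g x) + (LINT x|M. (norm (g x))\<^sup>2)"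
proof -
  show i: "integrable M (\<lambda>x. f x \<bullet> g x)"
  proof (rule Bochner_Integration.integrable_bound[OF Bochner_Integration.integrable_add[OF f g]])
    show "AE x in M. norm (f x \<bullet> g x) \<le> norm ((norm (f x))\<^sup>2 + (norm (g x))\<^sup>2)"
    proof (rule AE_I2)
      fix x
      have "\<bar>f x \<bullet> g x\<bar> \<le> norm (f x) * norm (g x)" by (rule Cauchy_Schwarz_ineq2)
      also have "\<dots> \<le> (norm (f x))\<^sup>2 + (norm (g x))\<^sup>2"
        using sum_squares_bound[of "norm (f x)" "norm (g x)"] mult_nonneg_nonneg[OF norm_ge_zero norm_ge_zero, of "f x" "g x"]
        by linarith
      finally show "norm (f x \<bullet> g x) \<le> norm ((norm (f x))\<^sup>2 + (norm (g x))\<^sup>2)" by simp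
    qed
  qed measurable
  have e: "(norm (f x - g x))\<^sup>2 = (norm (f x))\<^sup>2 - 2 * (f x \<bullet> g x) + (norm (g x))\<^sup>2" for x
    by (simp add: power2_norm_eq_inner inner_diff_left inner_diff_right inner_commute)
  show "integrable M (\<lambda>x. (norm (f x - g x))\<^sup>2)" unfolding e using i f g by simp
  show "(LINT x|M. (norm (f x - g x))\<^sup>2) = (LINT x|M. (norm (f x))\<^sup>2) - 2 * (LINT x|M. f x \<bullet> g x) + (LINT x|M. (norm (g x))\<^sup>2)"
    unfolding e using i f g by simp
qed

text \<open>The weak gradient \<open>G\<close> in the definition of the eigenvalue need not be the \<open>L\<^sup>2\<close>-limit \<open>G'\<close> of the
  gradients of the test functions. Uniqueness of weak gradients is not needed: \<open>G\<close> and \<open>G'\<close> have the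
  same inner products with gradients of test functions, whence \<open>\<parallel>G'\<parallel> \<le> \<parallel>G\<parallel>\<close>.\<close>

lemma dirichlet_eigenvalue_1_ge:
  fixes D :: "'a::euclidean_space set"
  assumes D: "open D" and lam: "0 \<le> lam"
    and poincare: "\<And>\<phi>. test_function D \<phi> \<Longrightarrow> lam * (LINT x|lborel. (\<phi> x)\<^sup>2) \<le> (LINT x|lborel. (norm (gradient \<phi> x))\<^sup>2)"
  shows "ennreal lam \<le> dirichlet_eigenvalue_1 D"
  unfolding dirichlet_eigenvalue_1_def
proof (rule Inf_greatest, clarify)
  fix u G assume u: "u \<in> H1_0 D" and G: "H1_gradient D u G" and nz: "\<not> (AE x in lebesgue_on D. u x = 0)"
  let ?M = "lebesgue_on D"
  obtain G' \<phi> where G': "H1_gradient D u G'" and \<phi>: "\<And>n. test_function D (\<phi> n)" and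
    lim: "(\<lambda>n. (LINT x|?M. (\<phi> n x - u x)\<^sup>2) + (LINT x|?M. (norm (gradient (\<phi> n) x - G' x))\<^sup>2)) \<longlonglongrightarrow> 0"
    using u unfolding H1_0_def by auto
  define A where "A n = (LINT x|?M. (norm (\<phi> n x - u x))\<^sup>2)" for n
  define B where "B n = (LINT x|?M. (norm (gradient (\<phi> n) x - G' x))\<^sup>2)" for n
  have AB0: "0 \<le> A n" "0 \<le> B n" for n by (simp_all add: A_def B_def)
  have limAB: "(\<lambda>n. A n + B n) \<longlonglongrightarrow> 0" using lim by (simp add: A_def B_def)
  have A: "A \<longlonglongrightarrow> 0" and B: "B \<longlonglongrightarrow> 0"
    using AB0 by (auto intro!: tendsto_sandwich[OF _ _ tendsto_const limAB] always_eventually)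
  have L2: "u \<in> borel_measurable ?M" "integrable ?M (\<lambda>x. (norm (u x))\<^sup>2)"
    "G \<in> borel_measurable ?M" "integrable ?M (\<lambda>x. (norm (G x))\<^sup>2)"
    "G' \<in> borel_measurable ?M" "integrable ?M (\<lambda>x. (norm (G' x))\<^sup>2)"
    using G G' by (auto simp: H1_gradient_def L2_on_def)
  have T: "\<phi> n \<in> borel_measurable ?M" "integrable ?M (\<lambda>x. (norm (\<phi> n x))\<^sup>2)"
    "gradient (\<phi> n) \<in> borel_measurable ?M" "integrable ?M (\<lambda>x. (norm (gradient (\<phi> n) x))\<^sup>2)" for n
    using test_function_H1_gradient[OF D \<phi>[of n]] by (auto simp: H1_gradient_def L2_on_def)
  have P: "lam * (LINT x|?M. (norm (\<phi> n x))\<^sup>2) \<le> (LINT x|?M. (norm (gradient (\<phi> n) x))\<^sup>2)" for n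
  proof -
    note [measurable] = test_function_measurable[OF \<phi>[of n]]
    have "(LINT x|?M. (norm (\<phi> n x))\<^sup>2) = (LINT x|lborel. (norm (\<phi> n x))\<^sup>2)"
      "(LINT x|?M. (norm (gradient (\<phi> n) x))\<^sup>2) = (LINT x|lborel. (norm (gradient (\<phi> n) x))\<^sup>2)"
      using test_functionD(3,5)[OF \<phi>[of n]] by (auto intro!: lebesgue_on_eq_lborel[OF D])
    then show ?thesis using poincare[OF \<phi>[of n]] by simp
  qed
  define IG where "IG = (LINT x|?M. (norm (G x))\<^sup>2)"
  define IG' where "IG' = (LINT x|?M. (norm (G' x))\<^sup>2)"
  define Iu where "Iu = (LINT x|?M. (norm (u x))\<^sup>2)"
  \<comment> \<open>Testing \<open>weak_gradient\<close> with the partial derivatives of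
    \<open>\<phi> n\<close> moves the derivative on \<open>u\<close> to the test function. The
    right-hand side contains \<open>u\<close> alone, so it is the same for \<open>G\<close> and
    \<open>G'\<close>.\<close>
  have weak: "(LINT x|?M. H x \<bullet> gradient (\<phi> n) x)
      = (\<Sum>b\<in>Basis. - (LINT x|?M. u x * (gradient (\<lambda>x. gradient (\<phi> n) x \<bullet> b) x \<bullet> b)))"
    if H: "H1_gradient D u H" for H n
  proof -
    have HM [measurable]: "H \<in> borel_measurable ?M" "integrable ?M (\<lambda>x. (norm (H x))\<^sup>2)"
      using H by (auto simp: H1_gradient_def L2_on_def)
    have int: "integrable ?M (\<lambda>x. (H x \<bullet> b) * (gradient (\<phi> n) x \<bullet> b))" if b: "b \<in> Basis" for b
    proof -
      have sq: "integrable ?M (\<lambda>x. (norm (F x \<bullet> b))\<^sup>2)" if [measurable]: "F \<in> borel_measurable ?M" and F: "integrable ?M (\<lambda>x. (norm (F x))\<^sup>2)" for F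
      proof (rule Bochner_Integration.integrable_bound[OF F])
        show "AE x in ?M. norm ((norm (F x \<bullet> b))\<^sup>2) \<le> norm ((norm (F x))\<^sup>2)"
          using b by (intro AE_I2) (auto intro!: power_mono Basis_le_norm simp: power2_eq_square[symmetric] abs_le_square_iff[symmetric])
      qed measurable
      note [measurable] = T(3)[of n]
      have "integrable ?M (\<lambda>x. (H x \<bullet> b) \<bullet> (gradient (\<phi> n) x \<bullet> b))"
        by (intro square_integrable_combine sq HM T) measurable
      then show ?thesis by simp
    qed
    have "(LINT x|?M. H x \<bullet> gradient (\<phi> n) x) = (LINT x|?M. (\<Sum>b\<in>Basis. (H x \<bullet> b) * (gradient (\<phi> n) x \<bullet> b)))"
      by (simp add: euclidean_inner[symmetric])
    also have "\<dots> = (\<Sum>b\<in>Basis. (LINT x|?M. (H x \<bullet> b) * (gradient (\<phi> n) x \<bullet> b)))"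
      by (rule Bochner_Integration.integral_sum[OF int])
    also have "\<dots> = (\<Sum>b\<in>Basis. - (LINT x|?M. u x * (gradient (\<lambda>x. gradient (\<phi> n) x \<bullet> b) x \<bullet> b)))"
    proof (rule sum.cong[OF refl])
      fix b :: 'a assume b: "b \<in> Basis"
      have "weak_gradient D u H" using H by (simp add: H1_gradient_def)
      then show "(LINT x|?M. (H x \<bullet> b) * (gradient (\<phi> n) x \<bullet> b)) = - (LINT x|?M. u x * (gradient (\<lambda>x. gradient (\<phi> n) x \<bullet> b) x \<bullet> b))"
        using test_function_partial[OF \<phi>[of n] b] b unfolding weak_gradient_def by simp
    qed
    finally show ?thesis .
  qed
  \<comment> \<open>The squared distances of \<open>G\<close> and \<open>G'\<close> to the gradient
    of \<open>\<phi> n\<close> have equal cross terms by \<open>weak\<close>. The first is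
    nonnegative and the second tends to 0.\<close>
  have GG': "IG' \<le> IG"
  proof -
    have "IG' - B n \<le> IG" for n
    proof -
      have "0 \<le> (LINT x|?M. (norm (G x - gradient (\<phi> n) x))\<^sup>2)" by simp
      then have "0 \<le> IG - 2 * (LINT x|?M. G x \<bullet> gradient (\<phi> n) x) + (LINT x|?M. (norm (gradient (\<phi> n) x))\<^sup>2)"
        unfolding IG_def by (subst (asm) square_integrable_combine(3)[OF L2(3) T(3) L2(4) T(4)])
      moreover have "B n = IG' - 2 * (LINT x|?M. G' x \<bullet> gradient (\<phi> n) x) + (LINT x|?M. (norm (gradient (\<phi> n) x))\<^sup>2)"
        unfolding B_def IG'_def by (simp only: norm_minus_commute[of "gradient (\<phi> n) _"] square_integrable_combine(3)[OF L2(5) T(3) L2(6) T(4)])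
      ultimately show ?thesis using weak[OF G, of n] weak[OF G', of n] by linarith
    qed
    moreover have "(\<lambda>n. IG' - B n) \<longlonglongrightarrow> IG' - 0" by (intro tendsto_diff tendsto_const B)
    ultimately show ?thesis using LIMSEQ_le_const2 by fastforce
  qed
  \<comment> \<open>Young's inequality is used twice, from \<open>u\<close> to
    \<open>\<phi> n\<close> and from the gradient of \<open>\<phi> n\<close> to \<open>G'\<close>.
    The limit in \<open>n\<close> precedes the one in \<open>e\<close>.\<close>
  have step: "lam * Iu \<le> (1 + e)\<^sup>2 * IG'" if e: "0 < e" for e
  proof -
    have n: "lam * Iu \<le> (1 + e)\<^sup>2 * IG' + ((1 + e) * (1 + 1 / e) * B n + lam * (1 + 1 / e) * A n)" for n
    proof -
      have "Iu \<le> (LINT x|?M. (1 + e) * (norm (\<phi> n x))\<^sup>2 + (1 + 1 / e) * (norm (\<phi> n x - u x))\<^sup>2)"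
        unfolding Iu_def
        using square_integrable_combine(2)[OF T(1) L2(1) T(2) L2(2)] T(2)
        by (intro integral_mono L2 norm_sq_young[OF e] Bochner_Integration.integrable_add integrable_mult_right)
      also have "\<dots> = (1 + e) * (LINT x|?M. (norm (\<phi> n x))\<^sup>2) + (1 + 1 / e) * A n"
        using square_integrable_combine(2)[OF T(1) L2(1) T(2) L2(2)] T(2) by (simp add: A_def)
      finally have "lam * Iu \<le> lam * ((1 + e) * (LINT x|?M. (norm (\<phi> n x))\<^sup>2) + (1 + 1 / e) * A n)"
        using lam by (rule mult_left_mono)
      also have "\<dots> = (1 + e) * (lam * (LINT x|?M. (norm (\<phi> n x))\<^sup>2)) + lam * (1 + 1 / e) * A n"
        by (simp add: algebra_simps)
      also have "\<dots> \<le> (1 + e) * (LINT x|?M. (norm (gradient (\<phi> n) x))\<^sup>2) + lam * (1 + 1 / e) * A n"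
        using e P[of n] by (intro add_right_mono mult_left_mono) auto
      finally have 1: "lam * Iu \<le> (1 + e) * (LINT x|?M. (norm (gradient (\<phi> n) x))\<^sup>2) + lam * (1 + 1 / e) * A n" .
      have "(LINT x|?M. (norm (gradient (\<phi> n) x))\<^sup>2)
        \<le> (LINT x|?M. (1 + e) * (norm (G' x))\<^sup>2 + (1 + 1 / e) * (norm (G' x - gradient (\<phi> n) x))\<^sup>2)"
        using square_integrable_combine(2)[OF L2(5) T(3) L2(6) T(4)]
        by (intro integral_mono T L2 norm_sq_young[OF e] Bochner_Integration.integrable_add integrable_mult_right)
      also have "\<dots> = (1 + e) * IG' + (1 + 1 / e) * B n"
        using square_integrable_combine(2)[OF L2(5) T(3) L2(6) T(4)] L2(6)
        by (simp add: IG'_def B_def norm_minus_commute)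
      finally have "(1 + e) * (LINT x|?M. (norm (gradient (\<phi> n) x))\<^sup>2) \<le> (1 + e) * ((1 + e) * IG' + (1 + 1 / e) * B n)"
        using e by (intro mult_left_mono) auto
      then show ?thesis using 1 by (simp add: power2_eq_square algebra_simps)
    qed
    have "(\<lambda>n. (1 + e)\<^sup>2 * IG' + ((1 + e) * (1 + 1 / e) * B n + lam * (1 + 1 / e) * A n)) \<longlonglongrightarrow>
       (1 + e)\<^sup>2 * IG' + ((1 + e) * (1 + 1 / e) * 0 + lam * (1 + 1 / e) * 0)"
      by (intro tendsto_add tendsto_mult tendsto_const A B)
    then have "lam * Iu \<le> (1 + e)\<^sup>2 * IG' + ((1 + e) * (1 + 1 / e) * 0 + lam * (1 + 1 / e) * 0)"
      using LIMSEQ_le_const n by blast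
    then show ?thesis by simp
  qed
  have "lam * Iu \<le> IG'"
  proof (rule LIMSEQ_le_const)
    have "(\<lambda>n. (1 + inverse (real (Suc n)))\<^sup>2 * IG') \<longlonglongrightarrow> (1 + 0)\<^sup>2 * IG'"
      by (intro tendsto_mult tendsto_power tendsto_add tendsto_const LIMSEQ_inverse_real_of_nat)
    then show "(\<lambda>n. (1 + inverse (real (Suc n)))\<^sup>2 * IG') \<longlonglongrightarrow> IG'" by simp
    show "\<exists>N. \<forall>n\<ge>N. lam * Iu \<le> (1 + inverse (real (Suc n)))\<^sup>2 * IG'"
      using step by (intro exI[of _ 0] allI impI step) simp
  qed
  then have le: "lam * Iu \<le> IG" using GG' by simp
  have "Iu \<noteq> 0"
  proof
    assume "Iu = 0"
    then have "AE x in ?M. (norm (u x))\<^sup>2 = 0"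
      using L2(2) by (simp add: Iu_def integral_nonneg_eq_0_iff_AE)
    then show False using nz by simp
  qed
  moreover have "0 \<le> Iu" by (simp add: Iu_def)
  ultimately have "lam \<le> IG / Iu" using le by (simp add: field_simps)
  then show "ennreal lam \<le> ennreal ((LINT x|?M. (norm (G x))\<^sup>2) / (LINT x|?M. (u x)\<^sup>2))"
    by (intro ennreal_leI) (simp add: IG_def Iu_def)
qed

section \<open>The radial eigenfunction of an annulus\<close>

text \<open>With \<open>z = \<lambda> s\<^sup>2 / 4\<close> and the power series \<open>J\<close>, \<open>K\<close> with coefficients \<open>bessel_coeff\<close>,
  \<open>bessel_coeff2\<close>, the functions \<open>J z\<close> (that is \<open>J\<^sub>0 (sqrt \<lambda> s)\<close>) and \<open>J z ln s + K z\<close> of \<open>s\<close> solve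
  \<open>(s f')' = - \<lambda> s f\<close>.\<close>

definition bessel_coeff :: "nat \<Rightarrow> real" where
  "bessel_coeff n = (- 1) ^ n / (fact n)\<^sup>2"

definition bessel_coeff2 :: "nat \<Rightarrow> real" where
  "bessel_coeff2 n = - harm n * bessel_coeff n"

lemma bessel_coeff_Suc: "(real n + 1)\<^sup>2 * bessel_coeff (Suc n) = - bessel_coeff n"
proof -
  have "(real n + 1)\<^sup>2 \<noteq> 0" by (simp add: add_nonneg_eq_0_iff)
  moreover have "(fact (Suc n) :: real)\<^sup>2 = (real n + 1)\<^sup>2 * (fact n)\<^sup>2"
    by (simp add: power_mult_distrib add.commute)
  ultimately show ?thesis by (simp add: bessel_coeff_def del: fact_Suc)
qed

lemma bessel_coeff2_Suc:
  "(real n + 1)\<^sup>2 * bessel_coeff2 (Suc n) = - bessel_coeff2 n - (real n + 1) * bessel_coeff (Suc n)"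
proof -
  have "(real n + 1)\<^sup>2 * bessel_coeff2 (Suc n) = - harm (Suc n) * ((real n + 1)\<^sup>2 * bessel_coeff (Suc n))"
    by (simp add: bessel_coeff2_def)
  also have "\<dots> = - bessel_coeff2 n + inverse (real n + 1) * bessel_coeff n"
    unfolding bessel_coeff_Suc by (simp add: bessel_coeff2_def harm_Suc algebra_simps)
  also have "inverse (real n + 1) * bessel_coeff n = - ((real n + 1) * bessel_coeff (Suc n))"
  proof -
    have "bessel_coeff n = - ((real n + 1)\<^sup>2 * bessel_coeff (Suc n))" by (simp add: bessel_coeff_Suc)
    then show ?thesis by (simp add: power2_eq_square field_simps)
  qed
  finally show ?thesis by simp
qed

lemma summable_of_le_fact:
  fixes c :: "nat \<Rightarrow> real"
  assumes "\<And>n. \<bar>c n\<bar> \<le> 1 / fact n"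
  shows "summable (\<lambda>n. c n * z ^ n)"
proof (rule summable_comparison_test')
  show "summable (\<lambda>n. inverse (fact n) * \<bar>z\<bar> ^ n)" by (rule summable_exp)
  show "norm (c n * z ^ n) \<le> inverse (fact n) * \<bar>z\<bar> ^ n" for n
    using mult_right_mono[OF assms[of n], of "\<bar>z\<bar> ^ n"] by (simp add: abs_mult power_abs divide_inverse)
qed

lemma summable_bessel: "summable (\<lambda>n. bessel_coeff n * z ^ n)"
proof (rule summable_of_le_fact)
  fix n
  have "(fact n :: real) \<le> (fact n)\<^sup>2" using fact_ge_1[where 'a = real, of n] by (simp add: power2_eq_square)
  then show "\<bar>bessel_coeff n\<bar> \<le> 1 / fact n"
    by (simp add: bessel_coeff_def abs_mult power_abs field_simps)
qed

lemma summable_bessel2: "summable (\<lambda>n. bessel_coeff2 n * z ^ n)"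
proof (rule summable_of_le_fact)
  fix n
  have "(harm n :: real) \<le> fact n"
  proof (induction n)
    case (Suc n)
    have "inverse (real (Suc n)) \<le> 1" by (rule inverse_le_1_iff[THEN iffD2]) simp
    moreover have "1 * 1 \<le> real n * fact n" if "n \<noteq> 0"
      using that by (intro mult_mono) (auto simp: fact_ge_1)
    moreover have "(harm (Suc n) :: real) = harm n + inverse (real (Suc n))" "(fact (Suc n) :: real) = fact n + real n * fact n"
      by (simp_all add: harm_Suc algebra_simps)
    ultimately show ?case using Suc by (cases "n = 0") (auto simp: harm_def simp del: of_nat_Suc fact_Suc)
  qed (simp add: harm_def)
  moreover have "0 \<le> (harm n :: real)" by (rule harm_nonneg)
  ultimately show "\<bar>bessel_coeff2 n\<bar> \<le> 1 / fact n"
    by (simp add: bessel_coeff2_def bessel_coeff_def abs_mult power_abs power2_eq_square field_simps)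
qed

text \<open>The operator sending \<open>F\<close> to \<open>z F'' + F'\<close> takes the coefficient
  \<open>c (Suc n)\<close> to \<open>(n + 1)\<^sup>2 * c (Suc n)\<close> at \<open>z ^ n\<close>, so
  the differential equations below become the recurrences of the coefficients.\<close>

lemma entire_ode:
  fixes c :: "nat \<Rightarrow> real"
  assumes sm: "\<And>z. summable (\<lambda>n. c n * z ^ n)"
  defines "F \<equiv> \<lambda>z. \<Sum>n. c n * z ^ n" and "F1 \<equiv> \<lambda>z. \<Sum>n. diffs c n * z ^ n"
    and "F2 \<equiv> \<lambda>z. \<Sum>n. diffs (diffs c) n * z ^ n"
  shows "(F has_real_derivative F1 z) (at z)" "(F1 has_real_derivative F2 z) (at z)"
    "(\<lambda>n. (real n + 1)\<^sup>2 * c (Suc n) * z ^ n) sums (z * F2 z + F1 z)"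
    "(\<lambda>n. (real n + 1) * c (Suc n) * z ^ n) sums F1 z" "(\<lambda>n. c n * z ^ n) sums F z"
proof -
  have sm1: "summable (\<lambda>n. diffs c n * z ^ n)" for z by (rule termdiff_converges_all[OF sm])
  have sm2: "summable (\<lambda>n. diffs (diffs c) n * z ^ n)" for z by (rule termdiff_converges_all[OF sm1])
  show "(F has_real_derivative F1 z) (at z)" "(F1 has_real_derivative F2 z) (at z)"
    unfolding F_def F1_def F2_def by (rule termdiffs_strong_converges_everywhere, fact sm sm1)+
  show F: "(\<lambda>n. c n * z ^ n) sums F z" using sm by (simp add: F_def summable_sums)
  show F1: "(\<lambda>n. (real n + 1) * c (Suc n) * z ^ n) sums F1 z"
    using sm1 by (simp add: F1_def summable_sums diffs_def add.commute[of _ 1] flip: of_nat_Suc)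
  have "(\<lambda>n. diffs (diffs c) n * z ^ n) sums F2 z" using sm2 by (simp add: F2_def summable_sums)
  then have "(\<lambda>n. z * (diffs (diffs c) n * z ^ n)) sums (z * F2 z)" by (rule sums_mult)
  then have "(\<lambda>n. real (Suc n) * diffs c (Suc n) * z ^ Suc n) sums (z * F2 z)"
    by (simp add: diffs_def mult_ac)
  then have "(\<lambda>n. real n * diffs c n * z ^ n) sums (z * F2 z)"
    using sums_Suc_iff[of "\<lambda>n. real n * diffs c n * z ^ n" "z * F2 z"] by simp
  from sums_add[OF this F1]
  show "(\<lambda>n. (real n + 1)\<^sup>2 * c (Suc n) * z ^ n) sums (z * F2 z + F1 z)"
    by (simp add: diffs_def power2_eq_square algebra_simps)
qed

text \<open>\<open>K\<close> is the power series part of the second solution, with the harmonic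
  numbers familiar from \<open>Y\<^sub>0\<close>. The inhomogeneity \<open>- J1\<close> compensates
  what the product of \<open>J\<close> and the logarithm leaves over in the radial equation.\<close>

lemma bessel_pair:
  obtains J J1 J2 K K1 K2 :: "real \<Rightarrow> real" where
    "\<And>z. (J has_real_derivative J1 z) (at z)" "\<And>z. (J1 has_real_derivative J2 z) (at z)"
    "\<And>z. z * J2 z + J1 z + J z = 0" "J 0 = 1"
    "\<And>z. (K has_real_derivative K1 z) (at z)" "\<And>z. (K1 has_real_derivative K2 z) (at z)"
    "\<And>z. z * K2 z + K1 z + K z = - J1 z" "K 0 = 0"
proof -
  note J = entire_ode[OF summable_bessel] and K = entire_ode[OF summable_bessel2]
  show ?thesis
  proof (rule that[OF J(1,2) _ _ K(1,2)], goal_cases)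
    case (1 z)
    have "(\<lambda>n. (real n + 1)\<^sup>2 * bessel_coeff (Suc n) * z ^ n + bessel_coeff n * z ^ n) sums
      (z * (\<Sum>n. diffs (diffs bessel_coeff) n * z ^ n) + (\<Sum>n. diffs bessel_coeff n * z ^ n) + (\<Sum>n. bessel_coeff n * z ^ n))"
      by (intro sums_add J)
    then show ?case unfolding bessel_coeff_Suc by (simp add: sums_iff)
  next
    case 2 show ?case by (simp only: powser_zero) (simp add: bessel_coeff_def)
  next
    case (3 z)
    have "(\<lambda>n. (real n + 1)\<^sup>2 * bessel_coeff2 (Suc n) * z ^ n + bessel_coeff2 n * z ^ n + (real n + 1) * bessel_coeff (Suc n) * z ^ n) sums
      (z * (\<Sum>n. diffs (diffs bessel_coeff2) n * z ^ n) + (\<Sum>n. diffs bessel_coeff2 n * z ^ n) + (\<Sum>n. bessel_coeff2 n * z ^ n)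
        + (\<Sum>n. diffs bessel_coeff n * z ^ n))"
      by (intro sums_add J K)
    then show ?case unfolding bessel_coeff2_Suc by (simp add: sums_iff algebra_simps)
  next
    case 4 show ?case by (simp only: powser_zero) (simp add: bessel_coeff2_def harm_def)
  qed
qed

text \<open>\<open>g\<close> stands for \<open>s f'\<close>.\<close>

lemma radial_solutions:
  fixes r :: real assumes r: "0 < r"
  obtains f g :: "real \<Rightarrow> real \<Rightarrow> real" where
    "\<And>lam s. 0 < s \<Longrightarrow> (f lam has_real_derivative g lam s / s) (at s)"
    "\<And>lam s. 0 < s \<Longrightarrow> (g lam has_real_derivative - lam * s * f lam s) (at s)"
    "\<And>lam. f lam r = 0" "\<And>lam. g lam r = 1" "\<And>s. 0 < s \<Longrightarrow> f 0 s = ln (s / r)"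
    "continuous_on (UNIV \<times> {0<..}) (\<lambda>(lam, s). f lam s)"
    "continuous_on (UNIV \<times> {0<..}) (\<lambda>(lam, s). g lam s)"
proof -
  obtain J J1 J2 K K1 K2 :: "real \<Rightarrow> real" where
    J: "\<And>z. (J has_real_derivative J1 z) (at z)" "\<And>z. (J1 has_real_derivative J2 z) (at z)"
    "\<And>z. z * J2 z + J1 z + J z = 0" "J 0 = 1" and
    K: "\<And>z. (K has_real_derivative K1 z) (at z)" "\<And>z. (K1 has_real_derivative K2 z) (at z)"
    "\<And>z. z * K2 z + K1 z + K z = - J1 z" "K 0 = 0"
    using bessel_pair by metis
  define Z where "Z lam s = lam * s\<^sup>2 / 4" for lam s :: real
  \<comment> \<open>The combination of both solutions that vanishes at \<open>r\<close>. Taking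
    \<open>ln (s / r)\<close> instead of \<open>ln s\<close> only adds a multiple of the first
    solution to the second.\<close>
  define f where "f lam s = J (Z lam r) * (J (Z lam s) * ln (s / r) + K (Z lam s)) - K (Z lam r) * J (Z lam s)" for lam s
  define g where "g lam s = J (Z lam r) * (2 * Z lam s * J1 (Z lam s) * ln (s / r) + J (Z lam s) + 2 * Z lam s * K1 (Z lam s))
     - K (Z lam r) * (2 * Z lam s * J1 (Z lam s))" for lam s
  have dZ: "((\<lambda>s. F (Z lam s)) has_real_derivative F' * (lam * s / 2)) (at s)"
    if "(F has_real_derivative F') (at (Z lam s))" for F F' lam s
    by (rule DERIV_chain2[where f = F and g = "Z lam", OF that]) (auto simp: Z_def[abs_def] intro!: derivative_eq_intros)
  have dL: "((\<lambda>s. ln (s / r)) has_real_derivative 1 / s) (at s)" if "s > 0" for s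
    using that r by (auto intro!: derivative_eq_intros)
  have d2: "((\<lambda>z. 2 * z * F1 z) has_real_derivative 2 * (F1 z + z * F2)) (at z)"
    if "(F1 has_real_derivative F2) (at z)" for F1 F2 z
    using that by (auto intro!: derivative_eq_intros)
  have df: "(f lam has_real_derivative g lam s / s) (at s)" if "s > 0" for lam s
  proof -
    have "(f lam has_real_derivative
       J (Z lam r) * ((J1 (Z lam s) * (lam * s / 2)) * ln (s / r) + 1 / s * J (Z lam s) + K1 (Z lam s) * (lam * s / 2))
       - K (Z lam r) * (J1 (Z lam s) * (lam * s / 2))) (at s)"
      unfolding f_def[abs_def]
      by (intro DERIV_diff DERIV_cmult DERIV_add DERIV_mult dZ dL J K that)
    moreover have e2: "2 * Z lam s = lam * s / 2 * s" by (simp add: Z_def power2_eq_square)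
    have "J (Z lam r) * ((J1 (Z lam s) * (lam * s / 2)) * ln (s / r) + 1 / s * J (Z lam s) + K1 (Z lam s) * (lam * s / 2))
       - K (Z lam r) * (J1 (Z lam s) * (lam * s / 2)) = g lam s / s"
      using that unfolding g_def e2 by (simp add: field_simps)
    ultimately show ?thesis by simp
  qed
  have dg: "(g lam has_real_derivative - lam * s * f lam s) (at s)" if "s > 0" for lam s
  proof -
    let ?z = "Z lam s"
    have JJ: "J1 ?z + ?z * J2 ?z = - J ?z" and KK: "K1 ?z + ?z * K2 ?z = - K ?z - J1 ?z"
      using J(3)[of ?z] K(3)[of ?z] by linarith+
    have "(g lam has_real_derivative
       J (Z lam r) * ((2 * (J1 ?z + ?z * J2 ?z) * (lam * s / 2)) * ln (s / r) + 1 / s * (2 * ?z * J1 ?z)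
          + J1 ?z * (lam * s / 2) + 2 * (K1 ?z + ?z * K2 ?z) * (lam * s / 2))
       - K (Z lam r) * (2 * (J1 ?z + ?z * J2 ?z) * (lam * s / 2))) (at s)"
      unfolding g_def[abs_def]
      by (intro DERIV_diff DERIV_cmult DERIV_add DERIV_mult dL dZ[OF d2] dZ[OF J(1)] J K that)
    moreover have e1: "1 / s * (2 * ?z * J1 ?z) = lam * s / 2 * J1 ?z"
      using that by (simp add: Z_def power2_eq_square)
    ultimately show ?thesis unfolding JJ KK e1 f_def by (simp add: algebra_simps)
  qed
  \<comment> \<open>Abel's identity: a form of the Wronskian of the two solutions is constant. At
    \<open>z = Z lam r\<close> it is the value of \<open>g lam r\<close>, which is therefore 1 for
    all \<open>lam\<close>.\<close>
  have W: "(J z)\<^sup>2 + 2 * z * (J z * K1 z - J1 z * K z) = 1" for z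
  proof -
    have "((\<lambda>z. (J z)\<^sup>2 + 2 * z * (J z * K1 z - J1 z * K z)) has_real_derivative 0) (at z)" for z
    proof -
      have "((\<lambda>z. (J z)\<^sup>2 + 2 * z * (J z * K1 z - J1 z * K z)) has_real_derivative
        2 * J z * J1 z + (2 * (J z * K1 z - J1 z * K z) + 2 * z * ((J1 z * K1 z + J z * K2 z) - (J2 z * K z + J1 z * K1 z)))) (at z)"
        using J(1,2)[of z] K(1,2)[of z] by (auto intro!: derivative_eq_intros)
      moreover have "2 * J z * J1 z + (2 * (J z * K1 z - J1 z * K z) + 2 * z * ((J1 z * K1 z + J z * K2 z) - (J2 z * K z + J1 z * K1 z)))
        = 2 * J z * (J1 z + (z * K2 z + K1 z)) - 2 * K z * (z * J2 z + J1 z)"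
        by (simp add: algebra_simps)
      moreover have "z * K2 z + K1 z = - J1 z - K z" "z * J2 z + J1 z = - J z"
        using J(3)[of z] K(3)[of z] by linarith+
      ultimately show ?thesis by simp
    qed
    then have "(J z)\<^sup>2 + 2 * z * (J z * K1 z - J1 z * K z) = (J 0)\<^sup>2 + 2 * 0 * (J 0 * K1 0 - J1 0 * K 0)"
      using DERIV_isconst_all by blast
    then show ?thesis using J(4) by simp
  qed
  have cont: "continuous_on S (\<lambda>x. F (h x))"
    if "\<And>z. (F has_real_derivative F' z) (at z)" "continuous_on S h" for F F' h and S :: "(real \<times> real) set"
    using continuous_on_compose2[OF _ that(2), of UNIV F] that(1) DERIV_isCont
    by (metis UNIV_I continuous_at_imp_continuous_on subsetI)
  have contJK: "continuous_on S (\<lambda>x. J (h x))" "continuous_on S (\<lambda>x. J1 (h x))"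
    "continuous_on S (\<lambda>x. K (h x))" "continuous_on S (\<lambda>x. K1 (h x))"
    if "continuous_on S h" for h and S :: "(real \<times> real) set"
    using cont[OF J(1) that] cont[OF J(2) that] cont[OF K(1) that] cont[OF K(2) that] by auto
  have cZ: "continuous_on S (\<lambda>x. Z (fst x) (snd x))" "continuous_on S (\<lambda>x. Z (fst x) r)" for S
    unfolding Z_def by (intro continuous_intros; simp)+
  have cL: "continuous_on (UNIV \<times> {0<..}) (\<lambda>x :: real \<times> real. ln (snd x / r))"
    using r by (intro continuous_intros) auto
  show ?thesis
  proof (rule that[of f g])
    show "f lam r = 0" for lam using r by (simp add: f_def)
    show "g lam r = 1" for lam using r W[of "Z lam r"] by (simp add: g_def power2_eq_square algebra_simps)
    show "f 0 s = ln (s / r)" for s using J(4) K(4) by (simp add: f_def Z_def)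
    show "continuous_on (UNIV \<times> {0<..}) (\<lambda>(lam, s). f lam s)"
      unfolding f_def case_prod_unfold by (intro continuous_intros contJK cZ cL)
    show "continuous_on (UNIV \<times> {0<..}) (\<lambda>(lam, s). g lam s)"
      unfolding g_def case_prod_unfold by (intro continuous_intros contJK cZ cL)
  qed (use df dg in auto)
qed

text \<open>The eigenvalue is the largest \<open>lam\<close> for which the solution starting from \<open>r\<close> is nonnegative on
  \<open>{r..R}\<close>. If it did not vanish at \<open>R\<close>, it would stay positive for slightly larger \<open>lam\<close>.\<close>

lemma annulus_eigenfunction:
  fixes r R :: real assumes r: "0 < r" "r < R"
  obtains lam \<rho> and f g :: "real \<Rightarrow> real" where
    "0 < lam" "r < \<rho>" "\<rho> < R"
    "\<And>s. 0 < s \<Longrightarrow> (f has_real_derivative g s / s) (at s)"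
    "\<And>s. 0 < s \<Longrightarrow> (g has_real_derivative - lam * s * f s) (at s)"
    "f r = 0" "f R = 0" "\<And>s. r < s \<Longrightarrow> s < R \<Longrightarrow> 0 < f s"
    "\<And>s. r \<le> s \<Longrightarrow> s < \<rho> \<Longrightarrow> 0 < g s" "g \<rho> = 0" "\<And>s. \<rho> < s \<Longrightarrow> s \<le> R \<Longrightarrow> g s < 0"
proof -
  obtain f g :: "real \<Rightarrow> real \<Rightarrow> real" where
    df: "\<And>lam s. 0 < s \<Longrightarrow> (f lam has_real_derivative g lam s / s) (at s)" and
    dg: "\<And>lam s. 0 < s \<Longrightarrow> (g lam has_real_derivative - lam * s * f lam s) (at s)" and
    fr: "\<And>lam. f lam r = 0" and gr: "\<And>lam. g lam r = 1" and f0: "\<And>s. 0 < s \<Longrightarrow> f 0 s = ln (s / r)" and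
    cf: "continuous_on (UNIV \<times> {0<..}) (\<lambda>(lam, s). f lam s)" and
    cg: "continuous_on (UNIV \<times> {0<..}) (\<lambda>(lam, s). g lam s)"
    using radial_solutions[OF r(1)] by metis
  define S where "S = {lam. 0 \<le> lam \<and> (\<forall>s\<in>{r..R}. 0 \<le> f lam s)}"
  have g_anti: "g lam t \<le> g lam s" if "lam \<in> S" "r \<le> s" "s \<le> t" "t \<le> R" for lam s t
  proof (rule DERIV_nonpos_imp_nonincreasing[OF that(3)])
    fix x assume "s \<le> x" "x \<le> t"
    then have "(g lam has_real_derivative - lam * x * f lam x) (at x)" "- lam * x * f lam x \<le> 0"
      using that r dg[of x lam] by (auto simp: S_def)
    then show "\<exists>y. (g lam has_real_derivative y) (at x) \<and> y \<le> 0" by blast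
  qed
  \<comment> \<open>At an interior zero, a minimum, \<open>g\<close> vanishes. As \<open>g\<close>
    decreases, \<open>f\<close> would increase up to that zero and be at most 0 before it, against
    the slope of \<open>f\<close> at \<open>r\<close>.\<close>
  have pos: "0 < f lam s" if lam: "lam \<in> S" and s: "r < s" "s < R" for lam s
  proof (rule ccontr)
    assume "\<not> 0 < f lam s"
    then have fs: "f lam s = 0" using lam s by (auto simp: S_def intro!: antisym)
    have "g lam s / s = 0"
    proof (rule DERIV_local_min[OF df, of s "min (s - r) (R - s)"])
      show "\<forall>y. \<bar>s - y\<bar> < min (s - r) (R - s) \<longrightarrow> f lam s \<le> f lam y"
        using lam fs by (auto simp: S_def abs_less_iff)
    qed (use s r in auto)
    then have "g lam s = 0" using s r by auto
    then have gn: "0 \<le> g lam t" if "r \<le> t" "t \<le> s" for t using g_anti[OF lam, of t s] that s by auto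
    have le0: "f lam t \<le> 0" if "r \<le> t" "t \<le> s" for t
    proof -
      have "f lam t \<le> f lam s"
      proof (rule DERIV_nonneg_imp_nondecreasing[OF that(2)])
        fix x assume "t \<le> x" "x \<le> s"
        then have "(f lam has_real_derivative g lam x / x) (at x)" "0 \<le> g lam x / x"
          using that r gn[of x] by (auto intro!: df)
        then show "\<exists>y. (f lam has_real_derivative y) (at x) \<and> 0 \<le> y" by blast
      qed
      then show ?thesis using fs by simp
    qed
    obtain d where "d > 0" "\<And>h. 0 < h \<Longrightarrow> h < d \<Longrightarrow> f lam r < f lam (r + h)"
      using DERIV_pos_inc_right[OF df, of r lam] r gr by auto
    moreover define h where "h = min (d / 2) (s - r)"
    ultimately have "0 < h" "h < d" "h \<le> s - r" "0 < f lam (r + h)" using s fr by (auto simp: min_def)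
    then show False using le0[of "r + h"] by simp
  qed
  \<comment> \<open>From this value on, the quadratic polynomial in \<open>w\<close> that appears in
    \<open>key\<close> has negative discriminant; the summand 1 makes this strict.\<close>
  define \<Lambda> where "\<Lambda> = (12 + 2 * (R - r) / r)\<^sup>2 / (8 * (R - r)\<^sup>2) + 1"
  have bound: "lam < \<Lambda>" if lam: "lam \<in> S" for lam
  proof (rule ccontr)
    assume "\<not> lam < \<Lambda>"
    then have big: "(12 + 2 * (R - r) / r)\<^sup>2 < 8 * (R - r)\<^sup>2 * lam"
    proof -
      have "(12 + 2 * (R - r) / r)\<^sup>2 / (8 * (R - r)\<^sup>2) < lam" using \<open>\<not> lam < \<Lambda>\<close> by (simp add: \<Lambda>_def)
      then show ?thesis using r by (simp add: pos_divide_less_eq mult.commute)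
    qed
    then have "lam > 0" using r by (smt (verit) mult_nonneg_nonpos zero_le_power2)
    \<comment> \<open>For large \<open>lam\<close>, \<open>\<phi>\<close> is a strict subsolution vanishing to second order at both ends.\<close>
    define \<phi> where "\<phi> s = (s - r)\<^sup>2 * (R - s)\<^sup>2" for s
    define \<phi>1 where "\<phi>1 s = 2 * ((s - r) * (R - s)) * (R + r - 2 * s)" for s
    define \<phi>2 where "\<phi>2 s = 2 * (R - r)\<^sup>2 - 12 * ((s - r) * (R - s))" for s
    have d\<phi>: "(\<phi> has_real_derivative \<phi>1 s) (at s)" "(\<phi>1 has_real_derivative \<phi>2 s) (at s)" for s
      unfolding \<phi>_def \<phi>1_def \<phi>2_def
      by (auto intro!: derivative_eq_intros simp: power2_eq_square algebra_simps)
    \<comment> \<open>The Lagrange bracket of \<open>f lam\<close> and \<open>\<phi>\<close>: it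
      vanishes at both ends together with \<open>\<phi>\<close> and \<open>\<phi>1\<close>, yet its
      derivative turns out to be positive in between.\<close>
    define Q where "Q s = s * f lam s * \<phi>1 s - g lam s * \<phi> s" for s
    have dQ: "(Q has_real_derivative f lam s * (lam * s * \<phi> s + \<phi>1 s + s * \<phi>2 s)) (at s)" if "s > 0" for s
      unfolding Q_def[abs_def] using df[OF that, of lam] dg[OF that, of lam] d\<phi>[of s] that
      by (auto intro!: derivative_eq_intros simp: field_simps)
    have key: "0 < lam * s * \<phi> s + \<phi>1 s + s * \<phi>2 s" if s: "r < s" "s < R" for s
    proof -
      define w where "w = (s - r) * (R - s)"
      have w: "w > 0" using s by (simp add: w_def)
      define b where "b = 12 + 2 * (R - r) / r"
      have "- ((R - r) * s / r) \<le> - (R - r)" using s r mult_left_mono[of 1 "s / r" "R - r"] by simp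
      also have "\<dots> \<le> R + r - 2 * s" using s by simp
      finally have "2 * w * (- ((R - r) * s / r)) \<le> \<phi>1 s"
        unfolding \<phi>1_def w_def[symmetric] using w by (intro mult_left_mono) auto
      moreover have "lam * s * \<phi> s + s * \<phi>2 s - 2 * w * ((R - r) * s / r) = s * (2 * (R - r)\<^sup>2 - b * w + lam * w\<^sup>2)"
      proof -
        have "\<phi> s = w\<^sup>2" "\<phi>2 s = 2 * (R - r)\<^sup>2 - 12 * w" "(R - r) * s / r = s * ((R - r) / r)" "b = 12 + 2 * ((R - r) / r)"
          by (simp_all add: \<phi>_def \<phi>2_def w_def b_def power_mult_distrib)
        moreover have "lam * s * w\<^sup>2 + s * (D - 12 * w) - 2 * w * (s * c) = s * (D - (12 + 2 * c) * w + lam * w\<^sup>2)" for c D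
          by (simp add: algebra_simps)
        ultimately show ?thesis by metis
      qed
      moreover have "0 < 2 * (R - r)\<^sup>2 - b * w + lam * w\<^sup>2"
      proof -
        have "4 * lam * (2 * (R - r)\<^sup>2 - b * w + lam * w\<^sup>2) = (2 * lam * w - b)\<^sup>2 + (8 * (R - r)\<^sup>2 * lam - b\<^sup>2)"
          by (simp add: power2_eq_square algebra_simps)
        also have "\<dots> > 0" using big by (simp add: b_def add_nonneg_pos)
        finally show ?thesis using \<open>lam > 0\<close> by (simp add: zero_less_mult_iff)
      qed
      then have "0 < s * (2 * (R - r)\<^sup>2 - b * w + lam * w\<^sup>2)" using s r by simp
      ultimately show ?thesis by linarith
    qed
    have "Q r < Q R"
    proof (rule DERIV_pos_imp_increasing_open[OF r(2)])
      fix x assume x: "r < x" "x < R"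
      show "\<exists>y. (Q has_real_derivative y) (at x) \<and> 0 < y"
        using dQ[of x] mult_pos_pos[OF pos[OF lam x] key[OF x]] r x by (meson less_trans)
    next
      show "continuous_on {r..R} Q"
        using r by (intro continuous_at_imp_continuous_on ballI DERIV_isCont[OF dQ]) auto
    qed
    moreover have "Q r = 0" "Q R = 0" by (simp_all add: Q_def \<phi>_def \<phi>1_def)
    ultimately show False by simp
  qed
  have cfl: "isCont (\<lambda>lam. f lam s) lam" if "s > 0" for s lam
  proof -
    have "continuous_on UNIV (\<lambda>lam. (\<lambda>(lam, s). f lam s) (lam, s))"
      using that by (intro continuous_on_compose2[OF cf] continuous_intros) auto
    then show ?thesis by (simp add: continuous_on_eq_continuous_at)
  qed
  have "S = {0..} \<inter> (\<Inter>s\<in>{r..R}. {lam. 0 \<le> f lam s})" by (auto simp: S_def)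
  moreover have "closed {lam. 0 \<le> f lam s}" if "s \<in> {r..R}" for s
    using that r cfl by (intro closed_Collect_le continuous_at_imp_continuous_on) auto
  ultimately have "closed S" by (metis (no_types, lifting) closed_INT closed_Int closed_atLeast)
  moreover have "bounded S"
  proof -
    have "S \<subseteq> {0..\<Lambda>}" using bound by (force simp: S_def)
    then show ?thesis using bounded_subset bounded_closed_interval by blast
  qed
  moreover have "0 \<in> S" using r f0 by (auto simp: S_def)
  ultimately obtain l where l: "l \<in> S" "\<And>lam. lam \<in> S \<Longrightarrow> lam \<le> l"
    using compact_attains_sup[of S] compact_eq_bounded_closed by blast
  have fR: "f l R = 0"
  proof (rule ccontr)
    assume "f l R \<noteq> 0"
    then have posR: "0 < f l s" if "r < s" "s \<le> R" for s
      using pos[OF l(1) that(1)] that l(1) r by (cases "s = R") (auto simp: S_def less_le)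
    \<comment> \<open>Slightly above \<open>l\<close> there are negative values at points
      \<open>s n\<close>, and these can accumulate only at \<open>r\<close>. Mean value points
      between \<open>r\<close> and \<open>s n\<close> where \<open>g\<close> is negative then
      converge to \<open>r\<close> as well, against \<open>g l r = 1\<close>.\<close>
    define \<mu> where "\<mu> n = l + inverse (real (Suc n))" for n
    have lim\<mu>: "\<mu> \<longlonglongrightarrow> l"
      using tendsto_add[OF tendsto_const[of l] LIMSEQ_inverse_real_of_nat] by (simp add: \<mu>_def[abs_def])
    have "\<exists>s\<in>{r..R}. f (\<mu> n) s < 0" for n
    proof -
      have "l < \<mu> n" by (simp add: \<mu>_def)
      then have "\<mu> n \<notin> S" using l(2) by force
      moreover have "0 \<le> \<mu> n" using \<open>l < \<mu> n\<close> l(1) by (simp add: S_def)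
      ultimately show ?thesis by (auto simp: S_def not_le)
    qed
    then obtain s where s: "\<And>n. s n \<in> {r..R}" "\<And>n. f (\<mu> n) (s n) < 0" by metis
    have "\<exists>\<xi>. r < \<xi> \<and> \<xi> < s n \<and> g (\<mu> n) \<xi> < 0" for n
    proof -
      have "s n \<noteq> r" using s(2)[of n] fr by auto
      then have "r < s n" using s(1)[of n] by simp
      then obtain \<xi> where x: "r < \<xi>" "\<xi> < s n" "f (\<mu> n) (s n) - f (\<mu> n) r = (s n - r) * (g (\<mu> n) \<xi> / \<xi>)"
        using MVT2[of r "s n" "f (\<mu> n)" "\<lambda>x. g (\<mu> n) x / x"] df r by force
      then have "(s n - r) * (g (\<mu> n) \<xi> / \<xi>) < 0" using s(2)[of n] fr by simp
      then show ?thesis using x r by (auto simp: mult_less_0_iff divide_less_0_iff)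
    qed
    then obtain \<xi> where \<xi>: "\<And>n. r < \<xi> n" "\<And>n. \<xi> n < s n" "\<And>n. g (\<mu> n) (\<xi> n) < 0" by metis
    obtain t \<sigma> where t: "t \<in> {r..R}" "strict_mono \<sigma>" "(s \<circ> \<sigma>) \<longlonglongrightarrow> t"
      using compact_imp_seq_compact[OF compact_Icc[of r R]] s(1) unfolding seq_compact_def by metis
    have lim\<mu>': "(\<lambda>n. \<mu> (\<sigma> n)) \<longlonglongrightarrow> l" using LIMSEQ_subseq_LIMSEQ[OF lim\<mu> t(2)] by (simp add: comp_def)
    have opn: "open (UNIV \<times> {0<..} :: (real \<times> real) set)" by (intro open_Times) auto
    have pair: "(\<lambda>n. F (\<mu> (\<sigma> n)) (u n)) \<longlonglongrightarrow> F l v"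
      if "continuous_on (UNIV \<times> {0<..}) (\<lambda>(lam, s). F lam s)" "u \<longlonglongrightarrow> v" "v > 0" for F :: "real \<Rightarrow> real \<Rightarrow> real" and u v
    proof -
      have "isCont (\<lambda>(lam, s). F lam s) (l, v)"
        using that(1,3) opn continuous_on_eq_continuous_at by blast
      then show ?thesis
        using isCont_tendsto_compose[of "(l, v)" "\<lambda>(lam, s). F lam s" "\<lambda>n. (\<mu> (\<sigma> n), u n)"]
          tendsto_Pair[OF lim\<mu>' that(2)] by simp
    qed
    have "(\<lambda>n. f (\<mu> (\<sigma> n)) (s (\<sigma> n))) \<longlonglongrightarrow> f l t"
      using t r by (intro pair[OF cf]) (auto simp: comp_def)
    then have "f l t \<le> 0"
      by (rule LIMSEQ_le_const2) (use s(2) in \<open>auto intro: less_imp_le\<close>)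
    then have "t = r" using posR[of t] t(1) by force
    have "(\<lambda>n. \<xi> (\<sigma> n)) \<longlonglongrightarrow> r"
    proof (rule tendsto_sandwich[of "\<lambda>_. r" _ _ "\<lambda>n. s (\<sigma> n)"])
      show "(\<lambda>n. s (\<sigma> n)) \<longlonglongrightarrow> r" using t(3) \<open>t = r\<close> by (simp add: comp_def)
    qed (use \<xi> in \<open>auto intro!: always_eventually simp: less_imp_le\<close>)
    then have "(\<lambda>n. g (\<mu> (\<sigma> n)) (\<xi> (\<sigma> n))) \<longlonglongrightarrow> g l r" by (rule pair[OF cg _ r(1)])
    then have "g l r \<le> 0"
      by (rule LIMSEQ_le_const2) (use \<xi>(3) in \<open>auto intro: less_imp_le\<close>)
    then show False using gr by simp
  qed
  have "l \<noteq> 0" using fR f0[of R] r by auto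
  then have lpos: "l > 0" using l(1) by (auto simp: S_def)
  obtain \<rho> where \<rho>: "r < \<rho>" "\<rho> < R" "g l \<rho> / \<rho> = 0"
  proof -
    have "continuous_on {r..R} (f l)"
      using r by (intro continuous_at_imp_continuous_on ballI DERIV_isCont[OF df]) auto
    moreover have "f l r = f l R" using fr fR by simp
    ultimately obtain z where z: "r < z" "z < R" "(f l has_real_derivative 0) (at z)"
      using Rolle[OF r(2)] df r by (metis less_trans real_differentiable_def)
    then show ?thesis using that[of z] DERIV_unique[OF df[of z l]] r by auto
  qed
  have g\<rho>: "g l \<rho> = 0" using \<rho> r by auto
  have gdec: "g l t < g l s" if "r \<le> s" "s < t" "t \<le> R" for s t
  proof (rule DERIV_neg_imp_decreasing_open[OF that(2)])
    fix x assume x: "s < x" "x < t"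
    then have "(g l has_real_derivative - l * x * f l x) (at x)" "- l * x * f l x < 0"
      using that r x pos[OF l(1), of x] lpos dg[of x l] by auto
    then show "\<exists>y. (g l has_real_derivative y) (at x) \<and> y < 0" by blast
  next
    show "continuous_on {s..t} (g l)"
      using r that by (intro continuous_at_imp_continuous_on ballI DERIV_isCont[OF dg]) auto
  qed
  show ?thesis
  proof (rule that[OF lpos \<rho>(1,2) df dg fr fR pos[OF l(1)] _ g\<rho>])
    show "0 < g l s" if "r \<le> s" "s < \<rho>" for s using gdec[of s \<rho>] that \<rho> g\<rho> by auto
    show "g l s < 0" if "\<rho> < s" "s \<le> R" for s using gdec[of \<rho> s] that \<rho> g\<rho> by auto
  qed
qed

text \<open>Barta's trick: with \<open>X = \<nabla>u / u\<close> for the positive radial solution \<open>u\<close> one has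
  \<open>\<bar>\<nabla>\<phi>\<bar>\<^sup>2 - lam \<phi>\<^sup>2 = \<bar>\<nabla>\<phi> - \<phi> X\<bar>\<^sup>2 + div (\<phi>\<^sup>2 X)\<close>. Below, \<open>X x = W \<bar>x - a\<bar> (x - a)\<close>.\<close>

lemma annulus_poincare:
  fixes a :: "real^2" and f g :: "real \<Rightarrow> real"
  assumes r: "0 < r"
    and df: "\<And>s. 0 < s \<Longrightarrow> (f has_real_derivative g s / s) (at s)"
    and dg: "\<And>s. 0 < s \<Longrightarrow> (g has_real_derivative - lam * s * f s) (at s)"
    and pos: "\<And>s. r < s \<Longrightarrow> s < R \<Longrightarrow> 0 < f s"
    and \<phi>: "test_function (ball a R - cball a r) \<phi>"
  shows "lam * (LINT x|lborel. (\<phi> x)\<^sup>2) \<le> (LINT x|lborel. (norm (gradient \<phi> x))\<^sup>2)"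
proof -
  define D where "D = ball a R - cball a r"
  define S where "S = closure {x. \<phi> x \<noteq> 0}"
  have D: "open D" unfolding D_def by (intro open_Diff) auto
  have S: "closed S" "S \<subseteq> D" using \<phi> by (auto simp: test_function_def S_def D_def)
  have zS: "\<phi> x = 0" if "x \<notin> S" for x
    using closure_subset[of "{x. \<phi> x \<noteq> 0}"] that unfolding S_def by blast
  have zG: "gradient \<phi> x = 0" if "x \<notin> S" for x
    using test_functionD(4)[OF \<phi>] that unfolding S_def by blast
  have sm: "smooth \<phi>" using test_functionD(1)[OF \<phi>] .
  have Dn: "r < norm (x - a)" "norm (x - a) < R" if "x \<in> D" for x
    using that by (auto simp: D_def dist_norm norm_minus_commute)
  \<comment> \<open>The gradient of \<open>ln f\<close> at distance \<open>s\<close> is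
    \<open>g s / (s * f s)\<close> in radial direction, which leaves this factor of
    \<open>x - a\<close>. \<open>W1\<close> is the right-hand side of the resulting Riccati
    equation.\<close>
  define W where "W s = g s / (s\<^sup>2 * f s)" for s
  define W1 where "W1 s = (- lam - 2 * W s - (W s)\<^sup>2 * s\<^sup>2) / s" for s
  have dW: "(W has_real_derivative W1 s) (at s)" if "r < s" "s < R" for s
  proof -
    have s: "s > 0" "f s > 0" using that r pos by auto
    have "(W has_real_derivative ((- lam * s * f s) * (s\<^sup>2 * f s) - g s * (2 * s * f s + s\<^sup>2 * (g s / s))) / ((s\<^sup>2 * f s) * (s\<^sup>2 * f s))) (at s)"
      unfolding W_def[abs_def]
      using s by (auto intro!: derivative_eq_intros df[OF s(1)] dg[OF s(1)] simp: power2_eq_square)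
    moreover have "((- lam * s * f s) * (s\<^sup>2 * f s) - g s * (2 * s * f s + s\<^sup>2 * (g s / s))) / ((s\<^sup>2 * f s) * (s\<^sup>2 * f s)) = W1 s"
      using s by (simp add: W1_def W_def power2_eq_square field_simps)
    ultimately show ?thesis by simp
  qed
  define q where "q b x = (\<phi> x)\<^sup>2 * (W (norm (x - a)) * ((x - a) \<bullet> b))" for b x
  \<comment> \<open>The field is differentiable in the annulus \<open>D\<close> and vanishes off the
    support \<open>S\<close>. The open sets \<open>D\<close> and \<open>- S\<close> cover the plane,
    so the pieces fit to a continuously differentiable field.\<close>
  define q' where "q' b x h = (if x \<in> S then 2 * \<phi> x * (gradient \<phi> x \<bullet> h) * (W (norm (x - a)) * ((x - a) \<bullet> b))
     + (\<phi> x)\<^sup>2 * (W1 (norm (x - a)) * (((x - a) \<bullet> h) / norm (x - a)) * ((x - a) \<bullet> b) + W (norm (x - a)) * (h \<bullet> b)) else 0)" for b x h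
  have q'_alt: "q' b x h = 2 * \<phi> x * (gradient \<phi> x \<bullet> h) * (W (norm (x - a)) * ((x - a) \<bullet> b))
     + (\<phi> x)\<^sup>2 * (W1 (norm (x - a)) * (((x - a) \<bullet> h) / norm (x - a)) * ((x - a) \<bullet> b) + W (norm (x - a)) * (h \<bullet> b))" for b x h
    using zS[of x] zG[of x] by (cases "x \<in> S") (auto simp: q'_def)
  have dq: "(q b has_derivative q' b x) (at x)" for b x
  proof (cases "x \<in> S")
    case True
    then have x: "x \<in> D" using S by auto
    have n0: "x - a \<noteq> 0" using Dn[OF x] r by auto
    have d1: "((\<lambda>x. norm (x - a)) has_derivative (\<lambda>h. ((x - a) \<bullet> h) / norm (x - a))) (at x)"
    proof -
      have "((\<lambda>x. norm (x - a)) has_derivative (\<lambda>h. h \<bullet> sgn (x - a))) (at x)"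
        by (rule has_derivative_compose[of "\<lambda>x. x - a" "\<lambda>h. h" x UNIV norm, OF _ has_derivative_norm[OF n0]])
           (auto intro!: derivative_eq_intros)
      then show ?thesis by (simp add: sgn_div_norm inner_commute divide_inverse mult.commute)
    qed
    have d2: "((\<lambda>x. W (norm (x - a))) has_derivative (\<lambda>h. W1 (norm (x - a)) * (((x - a) \<bullet> h) / norm (x - a)))) (at x)"
      by (rule has_derivative_compose[OF d1 dW[OF Dn[OF x], unfolded has_field_derivative_def]])
    have d3: "((\<lambda>x. (x - a) \<bullet> b) has_derivative (\<lambda>h. h \<bullet> b)) (at x)"
      by (auto intro!: derivative_eq_intros)
    have d4: "((\<lambda>x. (\<phi> x)\<^sup>2) has_derivative (\<lambda>h. 2 * \<phi> x * (gradient \<phi> x \<bullet> h))) (at x)"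
      using has_derivative_mult[OF smooth_gradient[OF sm] smooth_gradient[OF sm], of x]
      by (simp add: power2_eq_square algebra_simps)
    have "q' b x = (\<lambda>h. (\<phi> x)\<^sup>2 * (W (norm (x - a)) * (h \<bullet> b) + W1 (norm (x - a)) * (((x - a) \<bullet> h) / norm (x - a)) * ((x - a) \<bullet> b))
        + 2 * \<phi> x * (gradient \<phi> x \<bullet> h) * (W (norm (x - a)) * ((x - a) \<bullet> b)))"
      unfolding q'_alt by (auto simp: fun_eq_iff algebra_simps)
    then show ?thesis
      unfolding q_def using has_derivative_mult[OF d4 has_derivative_mult[OF d2 d3]] by simp
  next
    case False
    have "((\<lambda>x. 0) has_derivative (\<lambda>h. 0)) (at x)" by (rule has_derivative_const)
    then have "(q b has_derivative (\<lambda>h. 0)) (at x)"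
    proof (rule has_derivative_transform_within_open[of _ _ _ _ "- S"])
      show "open (- S)" "x \<in> - S" using S False by auto
      show "0 = q b y" if "y \<in> - S" for y using zS[of y] that by (simp add: q_def)
    qed
    moreover have "q' b x = (\<lambda>h. 0)" using False by (simp add: q'_def fun_eq_iff)
    ultimately show ?thesis by simp
  qed
  have cq: "continuous_on UNIV (\<lambda>x. q' b x b)" for b
  proof -
    have cW: "continuous_on D (\<lambda>x. W (norm (x - a)))"
      using DERIV_isCont[OF dW] Dn
      by (intro continuous_on_compose2[of "{r<..<R}" W D] continuous_intros continuous_at_imp_continuous_on) auto
    have n0: "norm (x - a) \<noteq> 0" if "x \<in> D" for x using Dn[OF that] r by auto
    have "continuous_on D (\<lambda>x. W1 (norm (x - a)))"
      unfolding W1_def using n0 by (intro continuous_intros cW) auto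
    then have "continuous_on D (\<lambda>x. q' b x b)"
      unfolding q'_alt using n0 sm
      by (intro continuous_intros cW continuous_on_subset[OF smooth_continuous[OF sm]] continuous_on_subset[OF smooth_continuous_gradient[OF sm]]) auto
    moreover have "continuous_on (- S) (\<lambda>x. q' b x b)"
      by (rule continuous_on_eq[of _ "\<lambda>x. 0"]) (auto simp: q'_def)
    moreover have "D \<union> - S = UNIV" using S by auto
    ultimately show ?thesis
      using continuous_on_open_Un[OF D, of "- S"] S(1) by (metis open_Compl)
  qed
  have bq: "bounded {x. q b x \<noteq> 0}" for b
    by (rule bounded_subset[OF test_functionD(2)[OF \<phi>]]) (auto simp: q_def)
  note Q = integral_partial_derivative_zero[OF dq cq bq]
  have id: "(norm (gradient \<phi> x))\<^sup>2 - lam * (\<phi> x)\<^sup>2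
      = (norm (gradient \<phi> x - (\<phi> x * W (norm (x - a))) *\<^sub>R (x - a)))\<^sup>2 + (\<Sum>b\<in>Basis. q' b x b)" for x
  proof (cases "x \<in> S")
    case True
    define y where "y = x - a"
    define n where "n = norm y"
    have n: "n > 0" using Dn(1)[of x] S True r by (auto simp: n_def y_def)
    let ?G = "gradient \<phi> x" and ?w = "W n"
    have yy: "y \<bullet> y = n\<^sup>2" by (simp add: n_def power2_norm_eq_inner)
    have "(\<Sum>b\<in>Basis. q' b x b) = (\<Sum>b\<in>Basis. 2 * \<phi> x * ?w * ((?G \<bullet> b) * (y \<bullet> b)) + (\<phi> x)\<^sup>2 * (W1 n / n * ((y \<bullet> b) * (y \<bullet> b)) + ?w))"
      unfolding q'_alt y_def[symmetric] n_def[symmetric] by (intro sum.cong refl) (simp add: algebra_simps)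
    also have "\<dots> = 2 * \<phi> x * ?w * (?G \<bullet> y) + (\<phi> x)\<^sup>2 * (W1 n / n * (y \<bullet> y) + ?w * DIM(real^2))"
      by (simp add: sum.distrib sum_distrib_left[symmetric] sum_divide_distrib[symmetric]
          euclidean_inner[of y y] euclidean_inner[of ?G y])
    \<comment> \<open>The dimension 2 cancels the term \<open>- 2 * W s\<close> of
      \<open>W1\<close>, so the divergence of \<open>X\<close> is
      \<open>- lam - \<bar>X\<bar>^2\<close>.\<close>
    also have "W1 n / n * (y \<bullet> y) + ?w * DIM(real^2) = - lam - ?w\<^sup>2 * n\<^sup>2"
      using n by (simp add: yy W1_def power2_eq_square)
    finally have sum: "(\<Sum>b\<in>Basis. q' b x b) = 2 * \<phi> x * ?w * (?G \<bullet> y) + (\<phi> x)\<^sup>2 * (- lam - ?w\<^sup>2 * n\<^sup>2)" .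
    have "(norm (?G - (\<phi> x * ?w) *\<^sub>R y))\<^sup>2 = (norm ?G)\<^sup>2 - 2 * \<phi> x * ?w * (?G \<bullet> y) + (\<phi> x)\<^sup>2 * ?w\<^sup>2 * n\<^sup>2"
      unfolding power2_norm_eq_inner
      by (simp add: inner_diff_left inner_diff_right yy inner_commute power2_eq_square)
    then show ?thesis unfolding sum by (simp add: y_def n_def algebra_simps)
  next
    case False
    then show ?thesis using zS zG by (simp add: q'_def)
  qed
  have i1: "integrable lborel (\<lambda>x. (norm (gradient \<phi> x))\<^sup>2 - lam * (\<phi> x)\<^sup>2)"
    using test_function_integrable[OF \<phi>] by simp
  have i2: "integrable lborel (\<lambda>x. \<Sum>b\<in>Basis. q' b x b)" using Q(1) by (intro Bochner_Integration.integrable_sum)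
  have "(LINT x|lborel. (norm (gradient \<phi> x))\<^sup>2 - lam * (\<phi> x)\<^sup>2) - (LINT x|lborel. (\<Sum>b\<in>Basis. q' b x b))
    = (LINT x|lborel. (norm (gradient \<phi> x - (\<phi> x * W (norm (x - a))) *\<^sub>R (x - a)))\<^sup>2)"
    using i1 i2 by (subst Bochner_Integration.integral_diff[symmetric]) (auto simp: id)
  also have "\<dots> \<ge> 0" by simp
  finally have "(LINT x|lborel. (\<Sum>b\<in>Basis. q' b x b)) \<le> (LINT x|lborel. (norm (gradient \<phi> x))\<^sup>2 - lam * (\<phi> x)\<^sup>2)"
    by simp
  moreover have "(LINT x|lborel. (\<Sum>b\<in>Basis. q' b x b)) = 0"
    using Q by (subst Bochner_Integration.integral_sum) auto
  ultimately show ?thesis using test_function_integrable[OF \<phi>] by simp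
qed

section \<open>Comparison with the disk\<close>

lemma area_cball: "0 \<le> t \<Longrightarrow> measure lborel (cball (a :: real^2) t) = pi * t\<^sup>2"
  using content_cball[of t a] by (simp add: unit_ball_vol_2)

lemma area_ball: "0 \<le> t \<Longrightarrow> measure lborel (ball (a :: real^2) t) = pi * t\<^sup>2"
  using content_ball[of t a] by (simp add: unit_ball_vol_2)

lemma emeasure_cball_2: "0 \<le> t \<Longrightarrow> emeasure lborel (cball (a :: real^2) t) = ennreal (pi * t\<^sup>2)"
  using area_cball[of t a] emeasure_compact_finite[OF compact_cball, of a t]
  by (subst emeasure_eq_ennreal_measure) (auto simp: less_top)

text \<open>Polar coordinates for radial functions: both measures give the half-line up to
  \<open>t \<ge> 0\<close> the area of a disk, and half-lines generate the Borel sets.\<close>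

lemma distr_norm_real2:
  "distr lborel borel (\<lambda>x :: real^2. dist x a) = density lborel (\<lambda>s. ennreal (2 * pi * s) * indicator {0..} s)"
proof (rule measure_eqI_generator_eq[where E = "range atMost" and \<Omega> = UNIV and A = "\<lambda>n. {..real n}"])
  show "Int_stable (range atMost :: real set set)" by (auto simp: Int_stable_def)
  show "sets (distr lborel borel (\<lambda>x :: real^2. dist x a)) = sigma_sets UNIV (range atMost)"
    "sets (density lborel (\<lambda>s. ennreal (2 * pi * s) * indicator {0..} s)) = sigma_sets UNIV (range atMost)"
    by (simp_all add: borel_eq_atMost)
  show "(\<Union>n. {..real n}) = UNIV" using real_arch_simple by auto
  have e: "emeasure (distr lborel borel (\<lambda>x :: real^2. dist x a)) {..t} = (if t < 0 then 0 else ennreal (pi * t\<^sup>2))" for t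
  proof -
    have "(\<lambda>x. dist x a) -` {..t} = cball a t" by (auto simp: dist_commute)
    then show ?thesis by (simp add: emeasure_distr emeasure_cball_2)
  qed
  show "emeasure (distr lborel borel (\<lambda>x :: real^2. dist x a)) {..real n} \<noteq> \<infinity>" for n
    by (simp add: e)
  fix X assume "X \<in> range (atMost :: real \<Rightarrow> real set)"
  then obtain t where X: "X = {..t}" by auto
  have "emeasure (density lborel (\<lambda>s. ennreal (2 * pi * s) * indicator {0..} s)) {..t}
    = (\<integral>\<^sup>+s. ennreal (2 * pi * s) * indicator {0..t} s \<partial>lborel)"
    by (subst emeasure_density) (auto intro!: nn_integral_cong split: split_indicator)
  also have "\<dots> = (if t < 0 then 0 else ennreal (pi * t\<^sup>2))"
  proof (cases "t < 0")
    case False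
    have "(\<integral>\<^sup>+s. ennreal (2 * pi * s) * indicator {0..t} s \<partial>lborel) = ennreal (pi * t\<^sup>2 - pi * 0\<^sup>2)"
      using False by (intro nn_integral_FTC_Icc) (auto intro!: derivative_eq_intros)
    then show ?thesis using False by simp
  qed simp
  finally show "emeasure (distr lborel borel (\<lambda>x :: real^2. dist x a)) X =
      emeasure (density lborel (\<lambda>s. ennreal (2 * pi * s) * indicator {0..} s)) X"
    unfolding X e by simp
qed auto

lemma radial_integral:
  fixes a :: "real^2"
  assumes rR: "0 \<le> r" "r \<le> R" and cont: "continuous_on {r..R} p"
    and der: "\<And>s. r \<le> s \<Longrightarrow> s \<le> R \<Longrightarrow> (\<Phi> has_real_derivative 2 * pi * s * p s) (at s within {r..R})"
  shows "(LINT x|lborel. indicator {r<..<R} (dist x a) * p (dist x a)) = \<Phi> R - \<Phi> r"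
proof -
  define q where "q s = indicator {r<..<R} s * p s" for s
  have q [measurable]: "q \<in> borel_measurable borel"
  proof -
    have "(\<lambda>s. indicator {r<..<R} s *\<^sub>R p s) \<in> borel_measurable borel"
      by (rule borel_measurable_continuous_on_indicator) (auto intro: continuous_on_subset[OF cont])
    then show ?thesis by (simp add: q_def[abs_def])
  qed
  have "(LINT x|lborel. q (dist x a)) = (LINT s|distr lborel borel (\<lambda>x. dist x a). q s)"
    by (subst integral_distr) auto
  also have "\<dots> = (LINT s|density lborel (\<lambda>s. ennreal (2 * pi * s * indicator {0..} s)). q s)"
  proof -
    have "(\<lambda>s. ennreal (2 * pi * s) * indicator {0..} s) = (\<lambda>s. ennreal (2 * pi * s * indicator {0..} s))"
      by (rule ext) (simp split: split_indicator)
    then show ?thesis unfolding distr_norm_real2 by (rule arg_cong)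
  qed
  also have "\<dots> = (LINT s|lborel. (2 * pi * s * indicator {0..} s) *\<^sub>R q s)"
    by (rule integral_density) (auto split: split_indicator)
  also have "\<dots> = (LINT s|lborel. indicator {r..R} s *\<^sub>R (2 * pi * s * p s))"
  proof (rule integral_cong_AE)
    show "(\<lambda>s. indicator {r..R} s *\<^sub>R (2 * pi * s * p s)) \<in> borel_measurable lborel"
      using borel_measurable_continuous_on_indicator[of "{r..R}" "\<lambda>s. 2 * pi * s * p s"]
      by (simp add: continuous_intros cont)
    have "AE s in lborel. s \<noteq> r" "AE s in lborel. s \<noteq> R" by (rule AE_lborel_singleton)+
    then show "AE s in lborel. (2 * pi * s * indicator {0..} s) *\<^sub>R q s = indicator {r..R} s *\<^sub>R (2 * pi * s * p s)"
    proof eventually_elim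
      case (elim s)
      then show ?case using rR by (auto simp: q_def split: split_indicator)
    qed
  qed measurable
  also have "\<dots> = \<Phi> R - \<Phi> r"
    using rR der
    by (intro integral_FTC_Icc)
       (auto intro!: continuous_intros cont simp: has_real_derivative_iff_has_vector_derivative[symmetric])
  finally show ?thesis by (simp add: q_def)
qed

text \<open>For \<open>K\<close> plus a disk of radius \<open>t\<close>, the lower bound of
  Brunn-Minkowski meets the upper bound of \<open>parallel_set_area_le\<close>. Both contain
  \<open>pi * t\<^sup>2\<close>; the rest is linear in \<open>t\<close>, so \<open>t = 1\<close>
  already gives the claim.\<close>

lemma isoperimetric_content:
  fixes K :: "(real^2) set"
  assumes K: "continuum K" and c: "has_outer_minkowski_content K c" "c \<le> ennreal L" and L: "0 \<le> L"
  shows "4 * pi * measure lebesgue K \<le> L\<^sup>2"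
proof (cases "measure lebesgue K = 0")
  case False
  then have pos: "0 < measure lebesgue K" using measure_nonneg[of lebesgue K] by linarith
  have K': "compact K" "K \<noteq> {}" using K by (auto simp: continuum_def)
  define m where "m = sqrt (measure lebesgue K)"
  have m: "m > 0" "m\<^sup>2 = measure lebesgue K" using pos by (auto simp: m_def)
  have bm: "(m + sqrt pi * t)\<^sup>2 \<le> m\<^sup>2 + L * t + pi * t\<^sup>2" if t: "t > 0" for t
  proof -
    have "measure lebesgue (cball (0 :: real^2) t) = pi * t\<^sup>2" using area_cball[of t 0] t by simp
    then have "(m + sqrt (pi * t\<^sup>2))\<^sup>2 \<le> measure lebesgue (parallel_set K t)"
      using brunn_minkowski_2[OF K'(1) compact_cball, of 0 t] pos t
      by (simp add: m_def parallel_set_eq_plus[OF K'])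
    moreover have "sqrt (pi * t\<^sup>2) = sqrt pi * t" using t by (simp add: real_sqrt_mult)
    ultimately show ?thesis using parallel_set_area_le[OF K c L t] m(2) by simp
  qed
  have "2 * m * sqrt pi \<le> L"
    using bm[of 1] by (simp add: power2_sum)
  then have "(2 * m * sqrt pi)\<^sup>2 \<le> L\<^sup>2" using m by (intro power_mono) auto
  then show ?thesis by (simp add: power_mult_distrib m(2) mult_ac)
qed simp

lemma cball_outer_minkowski_content:
  fixes a :: "real^2"
  assumes r: "0 \<le> r"
  shows "has_outer_minkowski_content (cball a r) (ennreal (2 * pi * r))"
  unfolding has_outer_minkowski_content_def
proof (rule Lim_transform_eventually)
  have "((\<lambda>\<epsilon>. 2 * pi * r + pi * \<epsilon>) \<longlongrightarrow> 2 * pi * r + pi * 0) (at_right 0)"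
    by (intro tendsto_intros)
  then show "((\<lambda>\<epsilon>. ennreal (2 * pi * r + pi * \<epsilon>)) \<longlongrightarrow> ennreal (2 * pi * r)) (at_right 0)"
    by (auto intro!: tendsto_ennrealI)
  have "ennreal (2 * pi * r + pi * e) = emeasure lebesgue (parallel_set (cball a r) e - cball a r) / ennreal e" if e: "e > 0" for e
  proof -
    have p: "parallel_set (cball a r) e = cball a (r + e)"
    proof (intro set_eqI iffI)
      fix x assume "x \<in> parallel_set (cball a r) e"
      then obtain y where y: "dist a y \<le> r" "dist x y \<le> e"
        using r by (auto simp: parallel_set_conv)
      then show "x \<in> cball a (r + e)" using dist_triangle2[of a x y] by simp
    next
      fix x assume x: "x \<in> cball a (r + e)"
      show "x \<in> parallel_set (cball a r) e"
      proof (cases "dist a x \<le> r")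
        case True
        then show ?thesis using subset_parallel_set[of e "cball a r"] e by auto
      next
        case False
        define y where "y = a + (r / dist a x) *\<^sub>R (x - a)"
        have d: "dist a x > 0" using False r by linarith
        have "dist a y = r" using d r by (simp add: y_def dist_norm norm_minus_commute)
        have "x - y = (1 - r / dist a x) *\<^sub>R (x - a)" by (simp add: y_def algebra_simps)
        then have "dist x y = \<bar>1 - r / dist a x\<bar> * dist a x" by (simp add: dist_norm norm_minus_commute)
        moreover have "\<bar>1 - r / dist a x\<bar> = 1 - r / dist a x" using d False by simp
        moreover have "(1 - r / dist a x) * dist a x = dist a x - r" using d by (simp add: left_diff_distrib)
        ultimately have "dist x y = dist a x - r" by simp
        with \<open>dist a y = r\<close> show ?thesis using x r by (auto simp: parallel_set_conv intro!: bexI[of _ y])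
      qed
    qed
    have "emeasure lebesgue (cball a (r + e) - cball a r) = ennreal (pi * (r + e)\<^sup>2 - pi * r\<^sup>2)"
      using emeasure_cball_2[of r a] emeasure_cball_2[of "r + e" a] r e
      by (subst emeasure_Diff) (auto simp: ennreal_minus subset_cball)
    also have "pi * (r + e)\<^sup>2 - pi * r\<^sup>2 = (2 * pi * r + pi * e) * e"
      by (simp add: power2_eq_square algebra_simps)
    finally have "emeasure lebesgue (cball a (r + e) - cball a r) / ennreal e = ennreal ((2 * pi * r + pi * e) * e / e)"
      using e r by (simp only: divide_ennreal mult_nonneg_nonneg add_nonneg_nonneg less_imp_le pi_ge_zero zero_le_numeral)
    then show ?thesis using e unfolding p by simp
  qed
  then show "\<forall>\<^sub>F e in at_right 0. ennreal (2 * pi * r + pi * e) = emeasure lebesgue (parallel_set (cball a r) e - cball a r) / ennreal e"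
    by (auto simp: eventually_at_filter)
qed

text \<open>As \<open>h\<close> decreases, the superlevel sets of the integrands are a parallel set
  of \<open>K\<close> without \<open>K\<close> and an annulus of the same width. The assumption
  \<open>area\<close> compares them, and the layer cake formula integrates over the levels.\<close>

lemma parallel_integral_le:
  fixes K :: "(real^2) set" and h :: "real \<Rightarrow> real" and a :: "real^2"
  assumes K: "compact K" "K \<noteq> {}" and r: "0 \<le> r"
    and area: "\<And>t. 0 < t \<Longrightarrow> measure lebesgue (parallel_set K t) - measure lebesgue K \<le> pi * (r + t)\<^sup>2 - pi * r\<^sup>2"
    and h: "continuous_on UNIV h" "\<And>t. 0 \<le> h t" "\<And>s t. 0 \<le> s \<Longrightarrow> s \<le> t \<Longrightarrow> h t \<le> h s" "\<And>t. \<delta> \<le> t \<Longrightarrow> h t = 0"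
  shows "(\<integral>\<^sup>+x. ennreal (indicator (- K) x * h (infdist x K)) \<partial>lborel)
     \<le> (\<integral>\<^sup>+x. ennreal (indicator (- cball a r) x * h (dist x a - r)) \<partial>lborel)"
proof -
  have [measurable]: "K \<in> sets borel" using K(1) by (rule borel_compact)
  have [measurable]: "h \<in> borel_measurable borel" using h(1) by (rule borel_measurable_continuous_onI)
  have [measurable]: "(\<lambda>x. infdist x K) \<in> borel_measurable borel"
    by (intro borel_measurable_continuous_onI continuous_intros)
  have key: "emeasure lborel {x. s \<le> indicator (- K) x * h (infdist x K)}
    \<le> emeasure lborel {x. s \<le> indicator (- cball a r) x * h (dist x a - r)}" if s: "s > 0" for s
  proof (cases "h 0 < s")
    case True
    have "h t < s" if "0 \<le> t" for t using h(3)[of 0 t] that True by simp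
    then have "{x. s \<le> indicator (- K) x * h (infdist x K)} = {}"
      using s infdist_nonneg[of _ K] by (auto simp: indicator_def not_le)
    then show ?thesis by simp
  next
    case False
    \<comment> \<open>Continuity of \<open>h\<close> makes the level set compact, so its largest
      element \<open>\<tau>\<close> exists and belongs to it.\<close>
    define T where "T = {t\<in>{0..\<bar>\<delta>\<bar>}. s \<le> h t}"
    have "compact T"
    proof -
      have "T = {0..\<bar>\<delta>\<bar>} \<inter> {t. s \<le> h t}" by (auto simp: T_def)
      moreover have "closed {t. s \<le> h t}" by (intro closed_Collect_le h continuous_intros)
      ultimately show ?thesis by (simp add: compact_Int_closed)
    qed
    moreover have "0 \<in> T" using False by (simp add: T_def)
    ultimately obtain \<tau> where \<tau>: "\<tau> \<in> T" "\<And>t. t \<in> T \<Longrightarrow> t \<le> \<tau>"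
      using compact_attains_sup[of T] by blast
    have lev: "s \<le> h t \<longleftrightarrow> t \<le> \<tau>" if "0 \<le> t" for t
    proof
      assume st: "s \<le> h t"
      then have "t < \<bar>\<delta>\<bar>" using h(4)[of t] s by (cases "\<bar>\<delta>\<bar> \<le> t") auto
      then show "t \<le> \<tau>" using \<tau>(2)[of t] st that by (simp add: T_def)
    next
      assume "t \<le> \<tau>" then show "s \<le> h t" using h(3)[of t \<tau>] \<tau>(1) that by (simp add: T_def)
    qed
    have \<tau>0: "0 \<le> \<tau>" using \<tau>(1) by (simp add: T_def)
    have 1: "{x. s \<le> indicator (- K) x * h (infdist x K)} = parallel_set K \<tau> - K"
      using s lev infdist_nonneg[of _ K] by (auto simp: indicator_def parallel_set_def)
    have 2: "{x. s \<le> indicator (- cball a r) x * h (dist x a - r)} = cball a (r + \<tau>) - cball a r"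
      using s lev by (auto simp: indicator_def dist_commute)
    have lm: "K \<in> lmeasurable" "parallel_set K \<tau> \<in> lmeasurable"
      using K compact_parallel_set[OF K] by (auto intro: lmeasurable_compact)
    have bor: "parallel_set K \<tau> \<in> sets borel" using compact_parallel_set[OF K] by (rule borel_compact)
    have "measure lebesgue (parallel_set K \<tau> - K) \<le> pi * (r + \<tau>)\<^sup>2 - pi * r\<^sup>2"
    proof (cases "\<tau> = 0")
      case True
      have "parallel_set K 0 = K"
        using in_closed_iff_infdist_zero[OF compact_imp_closed[OF K(1)] K(2)] infdist_nonneg[of _ K]
        by (auto simp: parallel_set_def intro: antisym)
      then show ?thesis using True by simp
    next
      case False
      then show ?thesis using area[of \<tau>] \<tau>0 lm measurable_measure_Diff[of "parallel_set K \<tau>" lebesgue K] subset_parallel_set[OF \<tau>0, of K]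
        by (simp add: fmeasurableD)
    qed
    moreover have "emeasure lebesgue (parallel_set K \<tau> - K) = ennreal (measure lebesgue (parallel_set K \<tau> - K))"
      using lm by (intro emeasure_eq_measure2 fmeasurable.Diff)
    ultimately have "emeasure lborel (parallel_set K \<tau> - K) \<le> ennreal (pi * (r + \<tau>)\<^sup>2 - pi * r\<^sup>2)"
      using bor by (simp add: ennreal_leI)
    also have "\<dots> = emeasure lborel (cball a (r + \<tau>) - cball a r)"
      using emeasure_cball_2[of r a] emeasure_cball_2[of "r + \<tau>" a] r \<tau>0
      by (subst emeasure_Diff) (auto simp: ennreal_minus subset_cball)
    finally show ?thesis unfolding 1 2 .
  qed
  have 1: "(\<integral>\<^sup>+x. ennreal (f x) \<partial>lborel) = (\<integral>\<^sup>+t. indicator {0<..} t * emeasure lborel {x. t \<le> f x} \<partial>lborel)"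
    if "f \<in> borel_measurable lborel" for f :: "real^2 \<Rightarrow> real"
    using nn_integral_layer_cake[OF lborel.sigma_finite_measure_axioms that] by simp
  have m: "(\<lambda>x. indicator (- K) x * h (infdist x K)) \<in> borel_measurable lborel"
    "(\<lambda>x. indicator (- cball a r) x * h (dist x a - r)) \<in> borel_measurable lborel"
    by measurable
  show ?thesis unfolding 1[OF m(1)] 1[OF m(2)]
    by (intro nn_integral_mono) (auto simp: key split: split_indicator)
qed

section \<open>The test function of an obstacle\<close>

text \<open>Uniformly in \<open>x\<close>, the Lipschitz constant of \<open>w\<close> near \<open>x\<close> is almost bounded by \<open>p x\<close>. This replaces
  the a.e. gradient of \<open>w\<close>, so that Rademacher's theorem is avoided.\<close>

definition slope_bounded :: "('a::metric_space \<Rightarrow> real) \<Rightarrow> ('a \<Rightarrow> real) \<Rightarrow> bool" where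
  "slope_bounded w p \<longleftrightarrow> (\<forall>\<tau>>0. \<exists>\<kappa>>0. \<forall>x y z. dist x y < \<kappa> \<longrightarrow> dist x z < \<kappa> \<longrightarrow>
     \<bar>w y - w z\<bar> \<le> (p x + \<tau>) * dist y z)"

lemma clamp_lipschitz: "\<bar>max \<alpha> (min \<beta> y) - max \<alpha> (min \<beta> z)\<bar> \<le> \<bar>y - z\<bar>" for y z :: real
  by linarith

text \<open>The mean value theorem and uniform continuity of \<open>f'\<close>; clamping is
  1-Lipschitz. Beyond the ends the bound keeps the end value of \<open>\<bar>f'\<bar>\<close>
  instead of 0, which leaves it continuous.\<close>

lemma slope_bounded_clamp:
  fixes f f' :: "real \<Rightarrow> real"
  assumes ab: "\<alpha> \<le> \<beta>" and der: "\<And>s. \<alpha> \<le> s \<Longrightarrow> s \<le> \<beta> \<Longrightarrow> (f has_real_derivative f' s) (at s)"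
    and cont: "continuous_on {\<alpha>..\<beta>} f'"
  shows "slope_bounded (\<lambda>t. f (max \<alpha> (min \<beta> t))) (\<lambda>t. \<bar>f' (max \<alpha> (min \<beta> t))\<bar>)"
    and "\<exists>B\<ge>0. (\<forall>t. \<bar>f' (max \<alpha> (min \<beta> t))\<bar> \<le> B) \<and> (\<forall>y z. \<bar>f (max \<alpha> (min \<beta> y)) - f (max \<alpha> (min \<beta> z))\<bar> \<le> B * dist y z)"
proof -
  define c where "c t = max \<alpha> (min \<beta> t)" for t
  have c: "\<alpha> \<le> c t" "c t \<le> \<beta>" "\<bar>c y - c z\<bar> \<le> \<bar>y - z\<bar>" for t y z
    using ab clamp_lipschitz by (auto simp: c_def)
  have mvt: "\<exists>\<xi>. \<alpha> \<le> \<xi> \<and> \<xi> \<le> \<beta> \<and> min u v \<le> \<xi> \<and> \<xi> \<le> max u v \<and> \<bar>f u - f v\<bar> = \<bar>f' \<xi>\<bar> * \<bar>u - v\<bar>"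
    if uv: "\<alpha> \<le> u" "u \<le> \<beta>" "\<alpha> \<le> v" "v \<le> \<beta>" for u v
  proof -
    have lt: "\<exists>\<xi>. u < \<xi> \<and> \<xi> < v \<and> f v - f u = (v - u) * f' \<xi>" if "\<alpha> \<le> u" "u < v" "v \<le> \<beta>" for u v
      by (rule MVT2) (use that der in auto)
    consider "u < v" | "u = v" | "v < u" by linarith
    then show ?thesis
    proof cases
      case 1
      then obtain \<xi> where "u < \<xi>" "\<xi> < v" "f v - f u = (v - u) * f' \<xi>" using lt[of u v] uv by auto
      then show ?thesis using that
        by (intro exI[of _ \<xi>]) (simp add: abs_minus_commute[of "f u"] abs_minus_commute[of u] abs_mult)
    next
      case 2 then show ?thesis using that by (intro exI[of _ u]) auto
    next
      case 3
      then obtain \<xi> where "v < \<xi>" "\<xi> < u" "f u - f v = (u - v) * f' \<xi>" using lt[of v u] uv by auto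
      then show ?thesis using that by (intro exI[of _ \<xi>]) (simp add: abs_mult)
    qed
  qed
  have uc: "uniformly_continuous_on {\<alpha>..\<beta>} f'" by (rule compact_uniformly_continuous[OF cont]) simp
  show "slope_bounded (\<lambda>t. f (max \<alpha> (min \<beta> t))) (\<lambda>t. \<bar>f' (max \<alpha> (min \<beta> t))\<bar>)"
    unfolding slope_bounded_def c_def[symmetric]
  proof (intro allI impI)
    fix \<tau> :: real assume "0 < \<tau>"
    then obtain \<kappa> where \<kappa>: "\<kappa> > 0" "\<And>s t. s \<in> {\<alpha>..\<beta>} \<Longrightarrow> t \<in> {\<alpha>..\<beta>} \<Longrightarrow> dist t s < \<kappa> \<Longrightarrow> dist (f' t) (f' s) < \<tau>"
      using uc unfolding uniformly_continuous_on_def by metis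
    show "\<exists>\<kappa>>0. \<forall>x y z. dist x y < \<kappa> \<longrightarrow> dist x z < \<kappa> \<longrightarrow> \<bar>f (c y) - f (c z)\<bar> \<le> (\<bar>f' (c x)\<bar> + \<tau>) * dist y z"
    proof (intro exI[of _ \<kappa>] conjI allI impI \<kappa>(1))
      fix x y z :: real assume d: "dist x y < \<kappa>" "dist x z < \<kappa>"
      obtain \<xi> where \<xi>: "\<alpha> \<le> \<xi>" "\<xi> \<le> \<beta>" "min (c y) (c z) \<le> \<xi>" "\<xi> \<le> max (c y) (c z)"
        "\<bar>f (c y) - f (c z)\<bar> = \<bar>f' \<xi>\<bar> * \<bar>c y - c z\<bar>" using mvt[of "c y" "c z"] c by blast
      have "\<bar>\<xi> - c x\<bar> < \<kappa>" using \<xi>(3,4) c(3)[of y x] c(3)[of z x] d by (auto simp: dist_real_def)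
      then have "\<bar>f' \<xi>\<bar> \<le> \<bar>f' (c x)\<bar> + \<tau>" using \<kappa>(2)[of "c x" \<xi>] \<xi> c by (auto simp: dist_real_def)
      then show "\<bar>f (c y) - f (c z)\<bar> \<le> (\<bar>f' (c x)\<bar> + \<tau>) * dist y z"
        unfolding \<xi>(5) dist_real_def using c(3)[of y z] \<open>0 < \<tau>\<close> by (intro mult_mono) auto
    qed
  qed
  have "compact (f' ` {\<alpha>..\<beta>})" by (intro compact_continuous_image cont) simp
  then obtain B where B: "\<And>s. s \<in> {\<alpha>..\<beta>} \<Longrightarrow> \<bar>f' s\<bar> \<le> B" using compact_imp_bounded by (force simp: bounded_iff)
  have "0 \<le> B" using B[of \<alpha>] ab by force
  moreover have "\<bar>f (c y) - f (c z)\<bar> \<le> B * dist y z" for y z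
  proof -
    obtain \<xi> where \<xi>: "\<alpha> \<le> \<xi>" "\<xi> \<le> \<beta>" "\<bar>f (c y) - f (c z)\<bar> = \<bar>f' \<xi>\<bar> * \<bar>c y - c z\<bar>"
      using mvt[of "c y" "c z"] c by blast
    show ?thesis unfolding \<xi>(3) dist_real_def using c(3)[of y z] B[of \<xi>] \<xi> by (intro mult_mono) auto
  qed
  moreover have "\<bar>f' (c t)\<bar> \<le> B" for t using B c by auto
  ultimately show "\<exists>B\<ge>0. (\<forall>t. \<bar>f' (max \<alpha> (min \<beta> t))\<bar> \<le> B) \<and> (\<forall>y z. \<bar>f (max \<alpha> (min \<beta> y)) - f (max \<alpha> (min \<beta> z))\<bar> \<le> B * dist y z)"
    unfolding c_def by blast
qed

lemma slope_bounded_compose: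
  fixes d :: "'a::metric_space \<Rightarrow> real"
  assumes w: "slope_bounded w p" and p: "\<And>t. 0 \<le> p t" and d: "\<And>x y. \<bar>d x - d y\<bar> \<le> dist x y"
  shows "slope_bounded (\<lambda>x. w (d x)) (\<lambda>x. p (d x))"
  unfolding slope_bounded_def
proof (intro allI impI)
  fix \<tau> :: real assume "0 < \<tau>"
  then obtain \<kappa> where \<kappa>: "\<kappa> > 0" "\<And>x y z. dist x y < \<kappa> \<Longrightarrow> dist x z < \<kappa> \<Longrightarrow> \<bar>w y - w z\<bar> \<le> (p x + \<tau>) * dist y z"
    using w unfolding slope_bounded_def by metis
  show "\<exists>\<kappa>>0. \<forall>x y z. dist x y < \<kappa> \<longrightarrow> dist x z < \<kappa> \<longrightarrow> \<bar>w (d y) - w (d z)\<bar> \<le> (p (d x) + \<tau>) * dist y z"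
  proof (intro exI[of _ \<kappa>] conjI allI impI \<kappa>(1))
    fix x y z :: 'a assume "dist x y < \<kappa>" "dist x z < \<kappa>"
    then have "\<bar>w (d y) - w (d z)\<bar> \<le> (p (d x) + \<tau>) * dist (d y) (d z)"
      using d[of x y] d[of x z] by (intro \<kappa>(2)) (auto simp: dist_real_def)
    also have "\<dots> \<le> (p (d x) + \<tau>) * dist y z"
      using p[of "d x"] \<open>0 < \<tau>\<close> d[of y z] by (intro mult_left_mono) (auto simp: dist_real_def)
    finally show "\<bar>w (d y) - w (d z)\<bar> \<le> (p (d x) + \<tau>) * dist y z" .
  qed
qed

text \<open>If one function is the smaller one on the whole ball of radius \<open>\<kappa>\<close>,
  the minimum coincides with it there. Otherwise both are nearly equal at \<open>x\<close>, and the
  larger slope may be paired with either value at small cost.\<close>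

lemma slope_bounded_min_energy:
  fixes w1 w2 :: "'a::metric_space \<Rightarrow> real"
  assumes s1: "slope_bounded w1 p1" and s2: "slope_bounded w2 p2"
    and p: "\<And>x. 0 \<le> p1 x" "\<And>x. 0 \<le> p2 x" "\<And>x. p1 x \<le> B" "\<And>x. p2 x \<le> B"
    and w: "\<And>x. 0 \<le> w1 x" "\<And>x. 0 \<le> w2 x" "\<And>x. w1 x \<le> M" "\<And>x. w2 x \<le> M"
    and lam: "0 \<le> lam" and \<tau>: "0 < \<tau>"
  shows "\<exists>\<kappa>>0. \<forall>x. \<exists>c\<ge>0.
    (\<forall>y z. dist x y < \<kappa> \<longrightarrow> dist x z < \<kappa> \<longrightarrow> \<bar>min (w1 y) (w2 y) - min (w1 z) (w2 z)\<bar> \<le> c * dist y z) \<and>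
    c\<^sup>2 - lam * (min (w1 x) (w2 x))\<^sup>2 \<le> max ((p1 x)\<^sup>2 - lam * (w1 x)\<^sup>2) ((p2 x)\<^sup>2 - lam * (w2 x)\<^sup>2) + \<tau>"
proof -
  have B: "0 \<le> B" and M: "0 \<le> M" using p(1,3) w(1,3) order_trans by blast+
  \<comment> \<open>Adding \<open>\<tau>1\<close> to a slope of at most \<open>B\<close> raises its
    square by at most \<open>\<tau> / 2\<close>.\<close>
  define \<tau>1 where "\<tau>1 = min 1 (\<tau> / (2 * (2 * B + 1)))"
  have \<tau>1: "0 < \<tau>1" "\<tau>1 \<le> 1" using \<tau> B by (auto simp: \<tau>1_def)
  have sq: "(q + \<tau>1)\<^sup>2 \<le> q\<^sup>2 + \<tau> / 2" if "0 \<le> q" "q \<le> B" for q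
  proof -
    have "(q + \<tau>1)\<^sup>2 = q\<^sup>2 + \<tau>1 * (2 * q + \<tau>1)" by (simp add: power2_eq_square algebra_simps)
    also have "\<tau>1 * (2 * q + \<tau>1) \<le> \<tau>1 * (2 * B + 1)" using that \<tau>1 by (intro mult_left_mono) auto
    also have "\<dots> \<le> \<tau> / (2 * (2 * B + 1)) * (2 * B + 1)" using B by (intro mult_right_mono) (auto simp: \<tau>1_def)
    also have "\<dots> = \<tau> / 2"
    proof -
      have "x / (2 * y) * y = x / 2" if "y > 0" for x y :: real using that by simp
      moreover have "2 * B + 1 > 0" using B by simp
      ultimately show ?thesis by blast
    qed
    finally show ?thesis by simp
  qed
  obtain \<kappa>1 where \<kappa>1: "\<kappa>1 > 0" "\<And>x y z. dist x y < \<kappa>1 \<Longrightarrow> dist x z < \<kappa>1 \<Longrightarrow> \<bar>w1 y - w1 z\<bar> \<le> (p1 x + \<tau>1) * dist y z"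
    using s1 \<tau>1(1) unfolding slope_bounded_def by metis
  obtain \<kappa>2 where \<kappa>2: "\<kappa>2 > 0" "\<And>x y z. dist x y < \<kappa>2 \<Longrightarrow> dist x z < \<kappa>2 \<Longrightarrow> \<bar>w2 y - w2 z\<bar> \<le> (p2 x + \<tau>1) * dist y z"
    using s2 \<tau>1(1) unfolding slope_bounded_def by metis
  \<comment> \<open>In the third case below, the two values differ by at most
    \<open>2 * (B + 1) * \<kappa>\<close>. With \<open>\<kappa> * N \<le> \<tau>\<close>, this
    changes \<open>lam\<close> times a squared value by at most \<open>\<tau> / 2\<close>.\<close>
  define N where "N = 8 * (lam + 1) * (M + 1) * (B + 1)"
  have N: "N > 0" using lam M B by (simp add: N_def)
  define \<kappa> where "\<kappa> = min (min \<kappa>1 \<kappa>2) (\<tau> / N)"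
  have \<kappa>: "\<kappa> > 0" "\<kappa> \<le> \<kappa>1" "\<kappa> \<le> \<kappa>2" "\<kappa> * N \<le> \<tau>"
  proof -
    have "\<kappa> \<le> \<tau> / N" by (simp add: \<kappa>_def)
    then show "\<kappa> * N \<le> \<tau>" using N by (simp add: pos_le_divide_eq)
  qed (use \<kappa>1(1) \<kappa>2(1) \<tau> N in \<open>simp_all add: \<kappa>_def\<close>)
  have l1: "\<bar>w1 y - w1 z\<bar> \<le> (p1 x + \<tau>1) * dist y z" and l2: "\<bar>w2 y - w2 z\<bar> \<le> (p2 x + \<tau>1) * dist y z"
    if "dist x y < \<kappa>" "dist x z < \<kappa>" for x y z
    using \<kappa>1(2)[of x y z] \<kappa>2(2)[of x y z] \<kappa> that by auto
  have "\<exists>c\<ge>0. (\<forall>y z. dist x y < \<kappa> \<longrightarrow> dist x z < \<kappa> \<longrightarrow> \<bar>min (w1 y) (w2 y) - min (w1 z) (w2 z)\<bar> \<le> c * dist y z) \<and>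
    c\<^sup>2 - lam * (min (w1 x) (w2 x))\<^sup>2 \<le> max ((p1 x)\<^sup>2 - lam * (w1 x)\<^sup>2) ((p2 x)\<^sup>2 - lam * (w2 x)\<^sup>2) + \<tau>" for x
  proof -
    consider (1) "\<forall>y. dist x y < \<kappa> \<longrightarrow> w1 y \<le> w2 y" | (2) "\<forall>y. dist x y < \<kappa> \<longrightarrow> w2 y \<le> w1 y"
      | (3) y z where "dist x y < \<kappa>" "w1 y \<le> w2 y" "dist x z < \<kappa>" "w2 z \<le> w1 z"
      by (meson linear)
    then show ?thesis
    proof cases
      case 1
      have "min (w1 y) (w2 y) = w1 y" if "dist x y < \<kappa>" for y using 1 that by auto
      moreover have "min (w1 x) (w2 x) = w1 x" using 1 \<kappa>(1) by auto
      ultimately show ?thesis using l1 sq[OF p(1,3), of x] \<tau> \<tau>1 p(1)[of x]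
        by (intro exI[of _ "p1 x + \<tau>1"]) (auto simp: max_def)
    next
      case 2
      have "min (w1 y) (w2 y) = w2 y" if "dist x y < \<kappa>" for y using 2 that by auto
      moreover have "min (w1 x) (w2 x) = w2 x" using 2 \<kappa>(1) by auto
      ultimately show ?thesis using l2 sq[OF p(2,4), of x] \<tau> \<tau>1 p(2)[of x]
        by (intro exI[of _ "p2 x + \<tau>1"]) (auto simp: max_def)
    next
      case 3
      define \<sigma> where "\<sigma> = 2 * (B + 1) * \<kappa>"
      have near: "\<bar>w1 x - w1 u\<bar> \<le> (B + 1) * \<kappa>" "\<bar>w2 x - w2 u\<bar> \<le> (B + 1) * \<kappa>" if "dist x u < \<kappa>" for u
      proof -
        have "(p1 x + \<tau>1) * dist x u \<le> (B + 1) * \<kappa>" "(p2 x + \<tau>1) * dist x u \<le> (B + 1) * \<kappa>"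
          using p \<tau>1 that B by (auto intro!: mult_mono add_mono)
        then show "\<bar>w1 x - w1 u\<bar> \<le> (B + 1) * \<kappa>" "\<bar>w2 x - w2 u\<bar> \<le> (B + 1) * \<kappa>"
          using l1[of x x u] l2[of x x u] that \<kappa>(1) by auto
      qed
      have diff: "\<bar>w1 x - w2 x\<bar> \<le> \<sigma>"
        using near[OF 3(1)] near[OF 3(3)] 3(2,4) unfolding \<sigma>_def by linarith
      have w2d: "\<bar>(w1 x)\<^sup>2 - (w2 x)\<^sup>2\<bar> \<le> \<sigma> * (2 * M)"
      proof -
        have "\<bar>(w1 x)\<^sup>2 - (w2 x)\<^sup>2\<bar> = \<bar>w1 x - w2 x\<bar> * (w1 x + w2 x)"
          using w(1,2)[of x] by (simp add: power2_eq_square square_diff_square_factored abs_mult mult.commute)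
        also have "\<dots> \<le> \<sigma> * (2 * M)" using diff w[of x] by (intro mult_mono) auto
        finally show ?thesis .
      qed
      have small: "lam * (\<sigma> * (2 * M)) \<le> \<tau> / 2"
      proof -
        have "lam * M \<le> (lam + 1) * (M + 1)" using lam M by (intro mult_mono) auto
        then have "(lam * M) * (4 * (B + 1) * \<kappa>) \<le> ((lam + 1) * (M + 1)) * (4 * (B + 1) * \<kappa>)"
          using B \<kappa> by (intro mult_right_mono) auto
        moreover have "lam * (\<sigma> * (2 * M)) = (lam * M) * (4 * (B + 1) * \<kappa>)"
          by (simp add: \<sigma>_def algebra_simps)
        moreover have "\<kappa> * N / 2 = ((lam + 1) * (M + 1)) * (4 * (B + 1) * \<kappa>)"
          by (simp add: N_def algebra_simps)
        ultimately have "lam * (\<sigma> * (2 * M)) \<le> \<kappa> * N / 2" by linarith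
        then show ?thesis using \<kappa>(4) by linarith
      qed
      define c where "c = max (p1 x) (p2 x) + \<tau>1"
      have c: "0 \<le> c" "p1 x + \<tau>1 \<le> c" "p2 x + \<tau>1 \<le> c" using p(1)[of x] \<tau>1 by (auto simp: c_def)
      have "\<bar>min (w1 y) (w2 y) - min (w1 z) (w2 z)\<bar> \<le> c * dist y z" if "dist x y < \<kappa>" "dist x z < \<kappa>" for y z
      proof -
        have "(p1 x + \<tau>1) * dist y z \<le> c * dist y z" "(p2 x + \<tau>1) * dist y z \<le> c * dist y z"
          using c by (auto intro: mult_right_mono)
        then show ?thesis using l1[OF that] l2[OF that] by linarith
      qed
      moreover have "c\<^sup>2 - lam * (min (w1 x) (w2 x))\<^sup>2 \<le> max ((p1 x)\<^sup>2 - lam * (w1 x)\<^sup>2) ((p2 x)\<^sup>2 - lam * (w2 x)\<^sup>2) + \<tau>"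
      proof -
        have low: "lam * (w1 x)\<^sup>2 - \<tau> / 2 \<le> lam * (min (w1 x) (w2 x))\<^sup>2" "lam * (w2 x)\<^sup>2 - \<tau> / 2 \<le> lam * (min (w1 x) (w2 x))\<^sup>2"
        proof -
          have "(w1 x)\<^sup>2 - \<sigma> * (2 * M) \<le> (min (w1 x) (w2 x))\<^sup>2" "(w2 x)\<^sup>2 - \<sigma> * (2 * M) \<le> (min (w1 x) (w2 x))\<^sup>2"
            using w2d order_trans[OF abs_ge_zero w2d] by (auto simp: min_def abs_le_iff)
          then have "lam * ((w1 x)\<^sup>2 - \<sigma> * (2 * M)) \<le> lam * (min (w1 x) (w2 x))\<^sup>2"
             "lam * ((w2 x)\<^sup>2 - \<sigma> * (2 * M)) \<le> lam * (min (w1 x) (w2 x))\<^sup>2"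
            using lam by (auto intro: mult_left_mono)
          then show "lam * (w1 x)\<^sup>2 - \<tau> / 2 \<le> lam * (min (w1 x) (w2 x))\<^sup>2" "lam * (w2 x)\<^sup>2 - \<tau> / 2 \<le> lam * (min (w1 x) (w2 x))\<^sup>2"
            using small unfolding right_diff_distrib by linarith+
        qed
        show ?thesis
        proof (cases "p1 x \<le> p2 x")
          case True
          then have "c\<^sup>2 \<le> (p2 x)\<^sup>2 + \<tau> / 2" using sq[OF p(2,4), of x] by (simp add: c_def)
          then show ?thesis using low(2) by linarith
        next
          case False
          then have "c\<^sup>2 \<le> (p1 x)\<^sup>2 + \<tau> / 2" using sq[OF p(1,3), of x] by (simp add: c_def)
          then show ?thesis using low(1) by linarith
        qed
      qed
      ultimately show ?thesis using c(1) by blast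
    qed
  qed
  then show ?thesis using \<kappa>(1) by blast
qed

text \<open>Subtracting a small height from \<open>v\<close> and truncating at 0 moves the support
  into a compact subset of \<open>D\<close>; mollification then gives a test function. Its energy
  density exceeds \<open>E\<close> by at most a constant, which is affordable because
  \<open>D\<close> is bounded and the integral of \<open>E\<close> is strictly negative.\<close>

lemma test_function_of_energy_bound:
  fixes v E :: "'a::euclidean_space \<Rightarrow> real"
  assumes D: "open D" "bounded D" and v: "\<And>x. 0 \<le> v x" "\<And>x. v x \<le> M" "\<And>x. x \<notin> D \<Longrightarrow> v x = 0"
    and lip: "\<And>y z. \<bar>v y - v z\<bar> \<le> C * dist y z" and lam: "0 \<le> lam"
    and E: "\<And>\<tau>. 0 < \<tau> \<Longrightarrow> \<exists>\<kappa>>0. \<forall>x. \<exists>c\<ge>0. (\<forall>y z. dist x y < \<kappa> \<longrightarrow> dist x z < \<kappa> \<longrightarrow> \<bar>v y - v z\<bar> \<le> c * dist y z)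
       \<and> c\<^sup>2 - lam * (v x)\<^sup>2 \<le> E x + \<tau>"
    and int: "integrable lborel (\<lambda>x. indicator D x * E x)" "(LINT x|lborel. indicator D x * E x) < 0"
  obtains \<phi> where "test_function D \<phi>" "(LINT x|lborel. (norm (gradient \<phi> x))\<^sup>2) < lam * (LINT x|lborel. (\<phi> x)\<^sup>2)"
proof -
  have M: "0 \<le> M" using v(1,2) order_trans by blast
  have C: "0 \<le> C"
  proof -
    obtain b :: 'a where b: "b \<in> Basis" using nonempty_Basis by blast
    then show ?thesis using order_trans[OF abs_ge_zero lip[of b 0]] by simp
  qed
  define m where "m = measure lborel D"
  define J where "J = (LINT x|lborel. indicator D x * E x)"
  \<comment> \<open>The final estimate spends \<open>2 * \<tau>\<close> per unit of area, one
    \<open>\<tau>\<close> on the slope bound and one on replacing \<open>v\<close> by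
    \<open>\<phi>\<close>. This choice uses up at most half of the gap \<open>- J\<close>.\<close>
  define \<tau> where "\<tau> = - J / (4 * (m + 1))"
  have m: "0 \<le> m" by (simp add: m_def)
  have \<tau>: "0 < \<tau>" using int(2) m by (auto simp: \<tau>_def J_def intro!: divide_neg_pos)
  have J\<tau>: "J + 2 * \<tau> * m < 0"
  proof -
    have "2 * \<tau> * m \<le> 2 * \<tau> * (m + 1)" using \<tau> by simp
    also have "\<dots> = - J / 2"
    proof -
      have "2 * (x / (4 * y)) * y = x / 2" if "y > 0" for x y :: real using that by simp
      moreover have "m + 1 > 0" using m by simp
      ultimately show ?thesis unfolding \<tau>_def by blast
    qed
    finally show ?thesis using int(2) by (simp add: J_def)
  qed
  obtain \<kappa>1 where \<kappa>1: "\<kappa>1 > 0" "\<And>x. \<exists>c\<ge>0. (\<forall>y z. dist x y < \<kappa>1 \<longrightarrow> dist x z < \<kappa>1 \<longrightarrow> \<bar>v y - v z\<bar> \<le> c * dist y z)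
       \<and> c\<^sup>2 - lam * (v x)\<^sup>2 \<le> E x + \<tau>" using E[OF \<tau>] by blast
  \<comment> \<open>The final function is at least \<open>v - s\<close>, half of \<open>s\<close>
    going to the truncation and half to the mollification. This lowers \<open>lam\<close> times the
    square by at most \<open>\<tau>\<close>.\<close>
  define s where "s = \<tau> / (2 * (lam + 1) * (M + 1))"
  have s: "0 < s" using \<tau> lam M by (simp add: s_def)
  have lams: "lam * (2 * M * s) \<le> \<tau>"
  proof -
    have "lam * M \<le> (lam + 1) * (M + 1)" using lam M by (intro mult_mono) auto
    then have "(lam * M) * (2 * s) \<le> ((lam + 1) * (M + 1)) * (2 * s)" using s by (intro mult_right_mono) auto
    also have "\<dots> = \<tau>"
    proof -
      have "y * (2 * (x / (2 * y))) = x" if "y > 0" for x y :: real using that by simp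
      moreover have "(lam + 1) * (M + 1) > 0" using lam M by simp
      ultimately show ?thesis unfolding s_def mult.assoc[of 2] by blast
    qed
    finally show ?thesis by (simp add: mult_ac)
  qed
  define u where "u x = max 0 (v x - s / 2)" for x
  define S where "S = {x. s / 2 \<le> v x}"
  have cv: "continuous_on UNIV v"
    by (rule lipschitz_on_continuous_on[of C]) (use lip C in \<open>auto simp: lipschitz_on_def dist_real_def\<close>)
  have SD: "S \<subseteq> D"
  proof
    fix x assume "x \<in> S" then show "x \<in> D" using v(3)[of x] s by (cases "x \<in> D") (auto simp: S_def)
  qed
  have "closed S" unfolding S_def by (intro closed_Collect_le continuous_intros cv)
  then have S: "compact S" using SD D(2) bounded_subset compact_eq_bounded_closed by blast
  obtain \<kappa>2 where \<kappa>2: "\<kappa>2 > 0" "(\<Union>x\<in>S. ball x \<kappa>2) \<subseteq> D"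
    using compact_subset_open_imp_ball_epsilon_subset[OF S D(1) SD] by metis
  \<comment> \<open>The first entry accounts for mollification looking as far as
    \<open>2 * \<kappa>\<close>, the second keeps the support inside \<open>D\<close>, and the third
    bounds the uniform error by \<open>s / 2\<close>.\<close>
  define \<kappa> where "\<kappa> = min (min (\<kappa>1 / 2) (\<kappa>2 / 2)) (s / (2 * (C + 1)))"
  have \<kappa>: "0 < \<kappa>" "2 * \<kappa> \<le> \<kappa>1" "\<kappa> < \<kappa>2" "C * \<kappa> \<le> s / 2"
  proof -
    show "0 < \<kappa>" "2 * \<kappa> \<le> \<kappa>1" "\<kappa> < \<kappa>2" using \<kappa>1 \<kappa>2 s C by (auto simp: \<kappa>_def)
    have "C * \<kappa> \<le> (C + 1) * (s / (2 * (C + 1)))" using C s \<open>0 < \<kappa>\<close> by (intro mult_mono) (auto simp: \<kappa>_def)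
    also have "\<dots> = s / 2"
    proof -
      have "y * (x / (2 * y)) = x / 2" if "y > 0" for x y :: real using that by simp
      moreover have "C + 1 > 0" using C by simp
      ultimately show ?thesis by blast
    qed
    finally show "C * \<kappa> \<le> s / 2" .
  qed
  have uv: "\<bar>u y - u z\<bar> \<le> \<bar>v y - v z\<bar>" for y z by (auto simp: u_def)
  have us: "x \<in> S" if "u x \<noteq> 0" for x using that by (auto simp: u_def S_def max_def split: if_splits)
  have "{x. u x \<noteq> 0} \<subseteq> D" by (rule subsetI) (use us SD in blast)
  then have "bounded {x. u x \<noteq> 0}" by (rule bounded_subset[OF D(2)])
  moreover have "\<bar>u y - u z\<bar> \<le> C * dist y z" for y z by (rule order_trans[OF uv lip])
  ultimately obtain \<phi> where \<phi>: "smooth \<phi>" "\<And>x. \<phi> x \<noteq> 0 \<Longrightarrow> \<exists>y. u y \<noteq> 0 \<and> dist x y < \<kappa>" "\<And>x. \<bar>\<phi> x - u x\<bar> \<le> C * \<kappa>"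
    "\<And>x c. (\<And>y z. dist x y < 2 * \<kappa> \<Longrightarrow> dist x z < 2 * \<kappa> \<Longrightarrow> \<bar>u y - u z\<bar> \<le> c * dist y z) \<Longrightarrow> norm (gradient \<phi> x) \<le> c"
    using mollification[of u C \<kappa>] \<kappa>(1) by metis
  have T: "compact (S + cball 0 \<kappa>)" by (rule compact_set_plus[OF S compact_cball])
  have sub: "{x. \<phi> x \<noteq> 0} \<subseteq> S + cball 0 \<kappa>"
  proof clarify
    fix x assume "\<phi> x \<noteq> 0"
    then obtain y where "y \<in> S" "dist x y < \<kappa>" using \<phi>(2) us by blast
    then show "x \<in> S + cball 0 \<kappa>"
      using set_plus_intro[of y S "x - y" "cball 0 \<kappa>"] by (simp add: dist_norm norm_minus_commute)
  qed
  then have clo: "closure {x. \<phi> x \<noteq> 0} \<subseteq> S + cball 0 \<kappa>"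
    using T by (intro closure_minimal compact_imp_closed)
  have "S + cball 0 \<kappa> \<subseteq> D"
  proof
    fix x assume "x \<in> S + cball 0 \<kappa>"
    then obtain y z where "y \<in> S" "norm z \<le> \<kappa>" "x = y + z" by (auto simp: set_plus_def)
    then have "x \<in> ball y \<kappa>2" using \<kappa> by (simp add: dist_norm)
    then show "x \<in> D" using \<kappa>2(2) \<open>y \<in> S\<close> by blast
  qed
  then have test: "test_function D \<phi>"
    using \<phi>(1) clo T compact_Int_closed[OF T closed_closure, of "{x. \<phi> x \<noteq> 0}"]
    by (auto simp: test_function_def smooth_def Int_absorb1)
  have pw: "(norm (gradient \<phi> x))\<^sup>2 - lam * (\<phi> x)\<^sup>2 \<le> indicator D x * E x + 2 * \<tau> * indicator D x" for x
  proof (cases "x \<in> D")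
    case True
    obtain c where c: "0 \<le> c" "\<And>y z. dist x y < \<kappa>1 \<Longrightarrow> dist x z < \<kappa>1 \<Longrightarrow> \<bar>v y - v z\<bar> \<le> c * dist y z"
      "c\<^sup>2 - lam * (v x)\<^sup>2 \<le> E x + \<tau>" using \<kappa>1(2)[of x] by blast
    have "norm (gradient \<phi> x) \<le> c"
    proof (rule \<phi>(4))
      fix y z assume "dist x y < 2 * \<kappa>" "dist x z < 2 * \<kappa>"
      then show "\<bar>u y - u z\<bar> \<le> c * dist y z" using c(2)[of y z] \<kappa>(2) uv[of y z] by linarith
    qed
    then have "(norm (gradient \<phi> x))\<^sup>2 \<le> c\<^sup>2" by (intro power_mono) auto
    moreover have "(v x)\<^sup>2 - 2 * M * s \<le> (\<phi> x)\<^sup>2"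
    proof -
      have "\<bar>u x - v x\<bar> \<le> s / 2" using v(1)[of x] s unfolding u_def by linarith
      then have close: "v x - s \<le> \<phi> x" using \<phi>(3)[of x] \<kappa>(4) by linarith
      show ?thesis
      proof (cases "s \<le> v x")
        case True
        then have "(v x - s)\<^sup>2 \<le> (\<phi> x)\<^sup>2" using close by (intro power_mono) auto
        moreover have "s * v x \<le> s * M" using v(2) s by (intro mult_left_mono) auto
        moreover have "(v x - s)\<^sup>2 = (v x)\<^sup>2 - 2 * (s * v x) + s\<^sup>2" by (simp add: power2_diff)
        moreover have "2 * M * s = 2 * (s * M)" "0 \<le> s\<^sup>2" by simp_all
        ultimately show ?thesis by linarith
      next
        case False
        then have "(v x)\<^sup>2 \<le> s * M" unfolding power2_eq_square using v s by (intro mult_mono) auto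
        also have "\<dots> \<le> 2 * M * s" using M s by simp
        finally show ?thesis using zero_le_power2[of "\<phi> x"] by linarith
      qed
    qed
    then have "lam * ((v x)\<^sup>2 - 2 * M * s) \<le> lam * (\<phi> x)\<^sup>2" using lam by (rule mult_left_mono)
    then have "lam * (v x)\<^sup>2 - \<tau> \<le> lam * (\<phi> x)\<^sup>2" using lams by (simp add: right_diff_distrib)
    ultimately show ?thesis using c(3) True by simp
  qed (use test_functionD(3,5)[OF test] in simp)
  have fin: "emeasure lborel D < \<infinity>" using emeasure_bounded_finite[OF D(2)] by simp
  have Ds: "D \<in> sets lborel" using D(1) by simp
  have iD: "integrable lborel (\<lambda>x. 2 * \<tau> * indicator D x)" using fin Ds by auto
  note ti = test_function_integrable[OF test]
  have "(LINT x|lborel. (norm (gradient \<phi> x))\<^sup>2) - lam * (LINT x|lborel. (\<phi> x)\<^sup>2)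
    = (LINT x|lborel. (norm (gradient \<phi> x))\<^sup>2 - lam * (\<phi> x)\<^sup>2)" using ti by simp
  also have "\<dots> \<le> (LINT x|lborel. indicator D x * E x + 2 * \<tau> * indicator D x)"
    using ti int(1) iD pw by (intro integral_mono) auto
  also have "\<dots> = J + 2 * \<tau> * m"
    using int(1) iD fin by (simp add: J_def m_def)
  also have "\<dots> < 0" by (rule J\<tau>)
  finally show ?thesis using that[OF test] by simp
qed

section \<open>Energy comparison for an obstacle\<close>

lemma integrable_indicator_continuous:
  fixes F :: "'a::euclidean_space \<Rightarrow> real"
  assumes F: "continuous_on UNIV F" and S: "bounded S" "S \<in> sets borel"
  shows "integrable lborel (\<lambda>x. indicator S x * F x)"
proof -
  obtain b where b: "S \<subseteq> cball 0 b"
    using bounded_subset_ballD[OF S(1), of 0] ball_subset_cball by blast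
  have "integrable lborel (\<lambda>x. indicator (cball 0 b) x *\<^sub>R F x)"
    by (rule borel_integrable_compact) (auto intro: continuous_on_subset[OF F])
  then have "integrable lborel (\<lambda>x. indicator S x *\<^sub>R (indicator (cball 0 b) x *\<^sub>R F x))"
    by (rule integrable_mult_indicator[rotated]) (use S in simp)
  moreover have "(\<lambda>x. indicator S x *\<^sub>R (indicator (cball 0 b) x *\<^sub>R F x)) = (\<lambda>x. indicator S x * F x)"
    using b by (auto simp: fun_eq_iff indicator_def)
  ultimately show ?thesis by simp
qed

lemma fmeasurable_lborel_bounded:
  fixes A :: "'a::euclidean_space set"
  assumes "bounded A" "A \<in> sets borel" shows "A \<in> fmeasurable lborel"
  using assms(2) emeasure_bounded_finite[OF assms(1)] by (intro fmeasurableI) auto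

lemma integral_pos_of_open:
  fixes F :: "'a::euclidean_space \<Rightarrow> real"
  assumes int: "integrable lborel F" and nn: "\<And>x. 0 \<le> F x" and V: "open V" "V \<noteq> {}" and pos: "\<And>x. x \<in> V \<Longrightarrow> 0 < F x"
  shows "0 < (LINT x|lborel. F x)"
proof (rule ccontr)
  assume "\<not> ?thesis"
  moreover have "0 \<le> (LINT x|lborel. F x)" using nn by simp
  ultimately have "(LINT x|lborel. F x) = 0" by simp
  then have "AE x in lborel. F x = 0" using int nn by (simp add: integral_nonneg_eq_0_iff_AE)
  then have "AE x in lborel. x \<notin> V"
  proof eventually_elim
    case (elim x) then show ?case using pos[of x] by auto
  qed
  then have "emeasure lborel V = 0"
    using AE_iff_measurable[of V lborel "\<lambda>x. x \<notin> V"] V(1) by simp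
  then have "negligible V" using V(1) by (simp add: negligible_iff_emeasure0)
  then show False using open_not_negligible V by blast
qed

text \<open>On \<open>D\<close> the energy density of \<open>v\<close> is at most
  \<open>max e1 e2 - lam * M\<^sup>2\<close>. The integrals of \<open>e1\<close> off
  \<open>K\<close> and of \<open>e2\<close> over the ball sum up to at most the value for the disk,
  \<open>lam * M\<^sup>2\<close> times the area of the annulus. What remains is
  \<open>lam * M\<^sup>2 * (mK - pi * r\<^sup>2)\<close> minus the integral of the loss
  \<open>G\<close>, and one of the two is strictly favourable.\<close>

lemma obstacle_rayleigh_lt:
  fixes a :: "real^2" and K :: "(real^2) set" and f g :: "real \<Rightarrow> real"
  assumes r: "0 < r" "r < \<rho>" "\<rho> < R" and lam: "0 < lam"
    and df: "\<And>s. 0 < s \<Longrightarrow> (f has_real_derivative g s / s) (at s)"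
    and dg: "\<And>s. 0 < s \<Longrightarrow> (g has_real_derivative - lam * s * f s) (at s)"
    and f0: "f r = 0" "f R = 0" and fpos: "\<And>s. r < s \<Longrightarrow> s < R \<Longrightarrow> 0 < f s"
    and gs: "\<And>s. r \<le> s \<Longrightarrow> s < \<rho> \<Longrightarrow> 0 < g s" "g \<rho> = 0" "\<And>s. \<rho> < s \<Longrightarrow> s \<le> R \<Longrightarrow> g s < 0"
    and K: "admissible (ball a R) (2 * pi * r) K" and ne: "K \<noteq> cball a r"
  obtains \<phi> where "test_function (ball a R - K) \<phi>"
    "(LINT x|lborel. (norm (gradient \<phi> x))\<^sup>2) < lam * (LINT x|lborel. (\<phi> x)\<^sup>2)"
proof -
  have R0: "0 < R" "0 < \<rho>" using r by auto
  obtain c where cont: "continuum K" "has_outer_minkowski_content K c" "c \<le> ennreal (2 * pi * r)"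
    and KR: "K \<subseteq> cball a R" using K R0 by (auto simp: admissible_def)
  have K': "compact K" "K \<noteq> {}" "closed K" using cont(1) by (auto simp: continuum_def compact_imp_closed)
  have Kb [measurable]: "K \<in> sets borel" using K'(3) by simp
  define mK where "mK = measure lborel K"
  have mK: "mK = measure lebesgue K" by (simp add: mK_def)
  have area: "measure lebesgue (parallel_set K t) - measure lebesgue K \<le> pi * (r + t)\<^sup>2 - pi * r\<^sup>2" if "0 < t" for t
    using parallel_set_area_le[OF cont, of t] r that by (simp add: power2_eq_square algebra_simps)
  have iso: "mK \<le> pi * r\<^sup>2"
  proof -
    have "4 * pi * mK \<le> (2 * pi * r)\<^sup>2" unfolding mK using isoperimetric_content[OF cont] r by simp
    also have "(2 * pi * r)\<^sup>2 = (4 * pi) * (pi * r\<^sup>2)" by (simp add: power2_eq_square)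
    finally have "(4 * pi) * mK \<le> (4 * pi) * (pi * r\<^sup>2)" .
    then show ?thesis by (rule mult_left_le_imp_le) simp
  qed
  define f1 where "f1 s = g s / s" for s
  define M where "M = f \<rho>"
  define \<delta> where "\<delta> = \<rho> - r"
  have \<delta>: "0 < \<delta>" using r by (simp add: \<delta>_def)
  have M: "0 < M" using fpos[of \<rho>] r by (simp add: M_def)
  have df1: "(f has_real_derivative f1 s) (at s)" if "0 < s" for s using df[OF that] by (simp add: f1_def)
  have cf: "continuous_on S f" "continuous_on S g" if "S \<subseteq> {0<..}" for S
    using that DERIV_isCont[OF df] DERIV_isCont[OF dg] by (auto intro!: continuous_at_imp_continuous_on)
  have cf1: "continuous_on S f1" if "S \<subseteq> {0<..}" for S
    unfolding f1_def using that by (intro continuous_intros cf) auto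
  have inc: "f s < f t" if "r \<le> s" "s < t" "t \<le> \<rho>" for s t
  proof (rule DERIV_pos_imp_increasing_open[OF that(2)])
    fix x assume x: "s < x" "x < t"
    then show "\<exists>y. (f has_real_derivative y) (at x) \<and> 0 < y"
      using df[of x] gs(1)[of x] that r by (intro exI[of _ "g x / x"]) auto
  qed (rule cf, use that r in auto)
  have dec: "f t < f s" if "\<rho> \<le> s" "s < t" "t \<le> R" for s t
  proof (rule DERIV_neg_imp_decreasing_open[OF that(2)])
    fix x assume x: "s < x" "x < t"
    then show "\<exists>y. (f has_real_derivative y) (at x) \<and> y < 0"
      using df[of x] gs(3)[of x] that r by (intro exI[of _ "g x / x"]) (auto simp: divide_neg_pos)
  qed (rule cf, use that r in auto)
  have fnn: "0 \<le> f s" if "r \<le> s" "s \<le> R" for s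
    using fpos[of s] f0 that by (cases "s = r \<or> s = R") (auto intro: less_imp_le)
  have fM: "f s \<le> M" if "r \<le> s" "s \<le> R" for s
  proof -
    consider "s < \<rho>" | "s = \<rho>" | "\<rho> < s" by linarith
    then show ?thesis using inc[of s \<rho>] dec[of \<rho> s] that by cases (auto simp: M_def)
  qed
  have fM_less: "f s < M" if "r \<le> s" "s \<le> R" "s \<noteq> \<rho>" for s
    using inc[of s \<rho>] dec[of \<rho> s] that by (cases "s < \<rho>") (auto simp: M_def)
  have f1\<rho>: "f1 \<rho> = 0" using gs(2) by (simp add: f1_def)
  have g_anti: "g t \<le> g s" if "r \<le> s" "s \<le> t" "t \<le> \<rho>" for s t
  proof (rule DERIV_nonpos_imp_nonincreasing[OF that(2)])
    fix x assume x: "s \<le> x" "x \<le> t"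
    have "- lam * x * f x \<le> 0" using fnn[of x] x that r lam by auto
    then show "\<exists>y. (g has_real_derivative y) (at x) \<and> y \<le> 0" using dg[of x] x that r by auto
  qed
  have f1_nn: "0 \<le> f1 s" if "r \<le> s" "s \<le> \<rho>" for s
    using gs(1)[of s] gs(2) that r by (cases "s = \<rho>") (auto simp: f1_def)
  have f1_anti: "f1 t \<le> f1 s" if "r \<le> s" "s \<le> t" "t \<le> \<rho>" for s t
    unfolding f1_def using g_anti[OF that] f1_nn[of t] gs(1)[of s] gs(2) that r
    by (intro frac_le) (auto simp: f1_def zero_le_divide_iff intro: order_trans[OF _ g_anti[OF that]])
  \<comment> \<open>Clamping to the two sides of \<open>\<rho>\<close> extracts the monotone
    branches of \<open>f\<close> and continues them by constants.\<close>
  define cl where "cl t = max r (min \<rho> t)" for t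
  define cu where "cu t = max \<rho> (min R t)" for t
  have cl: "r \<le> cl t" "cl t \<le> \<rho>" and cu: "\<rho> \<le> cu t" "cu t \<le> R" for t using r by (auto simp: cl_def cu_def)
  \<comment> \<open>The argument of \<open>h\<close> is the distance to the obstacle, that of
    \<open>k\<close> the distance to the centre; the shift by \<open>r\<close> turns the former into
    the radius at which \<open>f\<close> is evaluated.\<close>
  define h where "h t = \<bar>f1 (cl (r + t))\<bar>\<^sup>2 + lam * (M\<^sup>2 - (f (cl (r + t)))\<^sup>2)" for t
  define k where "k t = \<bar>f1 (cu t)\<bar>\<^sup>2 + lam * (M\<^sup>2 - (f (cu t))\<^sup>2)" for t
  define d where "d x = r + infdist x K" for x
  have sqM: "(f s)\<^sup>2 \<le> M\<^sup>2" if "r \<le> s" "s \<le> R" for s using fnn[OF that] fM[OF that] by (intro power_mono)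
  have h_nn: "0 \<le> h t" and k_nn: "0 \<le> k t" for t
    using sqM[of "cl (r + t)"] sqM[of "cu t"] cl[of "r + t"] cu[of t] r lam by (auto simp: h_def k_def)
  have h_cont: "continuous_on UNIV h" and k_cont: "continuous_on UNIV k"
  proof -
    have c: "continuous_on UNIV (\<lambda>t. cl (r + t))" "continuous_on UNIV cu"
      unfolding cl_def cu_def by (intro continuous_intros)+
    have "continuous_on UNIV (\<lambda>t. F (cl (r + t)))" "continuous_on UNIV (\<lambda>t. F (cu t))"
      if "continuous_on {0<..} F" for F :: "real \<Rightarrow> real"
      using less_le_trans[OF r(1) cl(1)] less_le_trans[OF R0(2) cu(1)]
      by (auto intro!: continuous_on_compose2[OF that c(1)] continuous_on_compose2[OF that c(2)])
    note cc = this[OF cf(1)[OF order_refl]] this[OF cf1[OF order_refl]]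
    show "continuous_on UNIV h" unfolding h_def by (intro continuous_intros cc)
    show "continuous_on UNIV k" unfolding k_def by (intro continuous_intros cc)
  qed
  have h_zero: "h t = 0" if "\<delta> \<le> t" for t
  proof -
    have "cl (r + t) = \<rho>" using that r by (auto simp: cl_def \<delta>_def)
    then show ?thesis by (simp add: h_def f1\<rho> M_def)
  qed
  have k_zero: "k t = 0" if "t \<le> \<rho>" for t
  proof -
    have "cu t = \<rho>" using that r by (auto simp: cu_def)
    then show ?thesis by (simp add: k_def f1\<rho> M_def)
  qed
  \<comment> \<open>Both terms decrease: the slope \<open>g s / s\<close> since \<open>g\<close>
    decreases and \<open>s\<close> grows, and \<open>M\<^sup>2 - (f s)\<^sup>2\<close> since
    \<open>f\<close> increases up to \<open>\<rho>\<close>.\<close>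
  have h_anti: "h t \<le> h s" if "0 \<le> s" "s \<le> t" for s t
  proof -
    let ?s = "cl (r + s)" and ?t = "cl (r + t)"
    have st: "?s \<le> ?t" using that by (auto simp: cl_def)
    have "f1 ?t \<le> f1 ?s" "0 \<le> f1 ?t" using f1_anti[OF cl(1) st cl(2)] f1_nn[OF cl] by auto
    then have "\<bar>f1 ?t\<bar>\<^sup>2 \<le> \<bar>f1 ?s\<bar>\<^sup>2" by (intro power_mono) auto
    moreover have "f ?s \<le> f ?t"
      using inc[OF cl(1), of "r + s" ?t] st cl(2)[of "r + t"] by (cases "?s = ?t") auto
    then have "(f ?s)\<^sup>2 \<le> (f ?t)\<^sup>2" using fnn[of ?s] cl[of "r + s"] r by (intro power_mono) auto
    then have "lam * (M\<^sup>2 - (f ?t)\<^sup>2) \<le> lam * (M\<^sup>2 - (f ?s)\<^sup>2)" using lam by (intro mult_left_mono) auto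
    ultimately show ?thesis unfolding h_def by linarith
  qed
  have h_pos: "0 < h t" if "0 \<le> t" "t < \<delta>" for t
  proof -
    have "cl (r + t) = r + t" using that by (auto simp: cl_def \<delta>_def)
    then have "f (cl (r + t)) < M" "0 \<le> f (cl (r + t))"
      using fM_less[of "r + t"] fnn[of "r + t"] that r by (auto simp: \<delta>_def)
    then have "(f (cl (r + t)))\<^sup>2 < M\<^sup>2" by (intro power_strict_mono) auto
    then have "0 < lam * (M\<^sup>2 - (f (cl (r + t)))\<^sup>2)" using lam by simp
    then show ?thesis unfolding h_def by (smt (verit) zero_le_power2)
  qed
  have k_pos: "0 < k t" if "\<rho> < t" "t < R" for t
  proof -
    have "cu t = t" using that by (auto simp: cu_def)
    then have "f (cu t) < M" "0 \<le> f (cu t)"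
      using fM_less[of t] fnn[of t] that r by auto
    then have "(f (cu t))\<^sup>2 < M\<^sup>2" by (intro power_strict_mono) auto
    then have "0 < lam * (M\<^sup>2 - (f (cu t))\<^sup>2)" using lam by simp
    then show ?thesis unfolding k_def by (smt (verit) zero_le_power2)
  qed
  define D where "D = ball a R - K"
  have D: "open D" "bounded D" using K'(3) by (auto simp: D_def intro: bounded_subset[OF bounded_ball])
  define w1 where "w1 x = f (cl (d x))" for x
  define w2 where "w2 x = f (cu (dist x a))" for x
  define v where "v x = min (w1 x) (w2 x)" for x
  define e1 where "e1 x = h (infdist x K)" for x
  define e2 where "e2 x = k (dist x a)" for x
  define E where "E x = max (e1 x) (e2 x) - lam * M\<^sup>2" for x
  have w: "0 \<le> w1 x" "0 \<le> w2 x" "w1 x \<le> M" "w2 x \<le> M" for x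
    using fnn[of "cl (d x)"] fnn[of "cu (dist x a)"] fM[of "cl (d x)"] fM[of "cu (dist x a)"] cl[of "d x"] cu[of "dist x a"] r
    by (auto simp: w1_def w2_def)
  have v0: "v x = 0" if "x \<notin> D" for x
  proof (cases "x \<in> K")
    case True
    then have "w1 x = 0" using f0 r by (simp add: w1_def d_def cl_def)
    then show ?thesis using w(2)[of x] by (simp add: v_def)
  next
    case False
    then have "R \<le> dist x a" using that by (auto simp: D_def dist_commute)
    then have "w2 x = 0" using f0 r by (simp add: w2_def cu_def)
    then show ?thesis using w(1)[of x] by (simp add: v_def)
  qed
  have d_lip: "\<bar>d x - d y\<bar> \<le> dist x y" for x y
    using infdist_triangle_abs[of x K y] by (simp add: d_def)
  have a_lip: "\<bar>dist x a - dist y a\<bar> \<le> dist x y" for x y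
    using abs_dist_diff_le[of x a y] by (simp add: dist_commute)
  have cf1': "continuous_on {r..\<rho>} f1" "continuous_on {\<rho>..R} f1"
    by (rule cf1, use r in force)+
  have df1': "\<And>s. r \<le> s \<Longrightarrow> s \<le> \<rho> \<Longrightarrow> (f has_real_derivative f1 s) (at s)"
    "\<And>s. \<rho> \<le> s \<Longrightarrow> s \<le> R \<Longrightarrow> (f has_real_derivative f1 s) (at s)"
    by (rule df1, use r in linarith)+
  note C1 = slope_bounded_clamp[OF less_imp_le[OF r(2)] df1'(1) cf1'(1), folded cl_def]
    and C2 = slope_bounded_clamp[OF less_imp_le[OF r(3)] df1'(2) cf1'(2), folded cu_def]
  have s1: "slope_bounded w1 (\<lambda>x. \<bar>f1 (cl (d x))\<bar>)"
    unfolding w1_def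
    by (intro slope_bounded_compose[OF C1(1)] d_lip) auto
  have s2: "slope_bounded w2 (\<lambda>x. \<bar>f1 (cu (dist x a))\<bar>)"
    unfolding w2_def
    by (intro slope_bounded_compose[OF C2(1)] a_lip) auto
  obtain B1 where B1: "0 \<le> B1" "\<And>t. \<bar>f1 (cl t)\<bar> \<le> B1" "\<And>y z. \<bar>f (cl y) - f (cl z)\<bar> \<le> B1 * dist y z"
    using C1(2) by blast
  obtain B2 where B2: "0 \<le> B2" "\<And>t. \<bar>f1 (cu t)\<bar> \<le> B2" "\<And>y z. \<bar>f (cu y) - f (cu z)\<bar> \<le> B2 * dist y z"
    using C2(2) by blast
  define B where "B = max B1 B2"
  have v_lip: "\<bar>v y - v z\<bar> \<le> B * dist y z" for y z
  proof -
    have "\<bar>w1 y - w1 z\<bar> \<le> B1 * dist y z"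
      using order_trans[OF B1(3) mult_left_mono[OF _ B1(1)], of "d y" "d z" "dist y z"] d_lip[of y z]
      by (simp add: w1_def dist_real_def)
    moreover have "\<bar>w2 y - w2 z\<bar> \<le> B2 * dist y z"
      using order_trans[OF B2(3) mult_left_mono[OF _ B2(1)], of "dist y a" "dist z a" "dist y z"] a_lip[of y z]
      by (simp add: w2_def dist_real_def)
    moreover have "B1 * dist y z \<le> B * dist y z" "B2 * dist y z \<le> B * dist y z"
      by (auto simp: B_def intro: mult_right_mono)
    ultimately show ?thesis unfolding v_def by linarith
  qed
  have E_bound: "\<exists>\<kappa>>0. \<forall>x. \<exists>c\<ge>0. (\<forall>y z. dist x y < \<kappa> \<longrightarrow> dist x z < \<kappa> \<longrightarrow> \<bar>v y - v z\<bar> \<le> c * dist y z)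
       \<and> c\<^sup>2 - lam * (v x)\<^sup>2 \<le> E x + \<tau>" if "0 < \<tau>" for \<tau>
  proof -
    have "max (\<bar>f1 (cl (d x))\<bar>\<^sup>2 - lam * (w1 x)\<^sup>2) (\<bar>f1 (cu (dist x a))\<bar>\<^sup>2 - lam * (w2 x)\<^sup>2) = E x" for x
      by (simp add: E_def e1_def e2_def h_def k_def w1_def w2_def d_def right_diff_distrib max_def)
    then show ?thesis
      using slope_bounded_min_energy[OF s1 s2 _ _ _ _ w less_imp_le[OF lam] that, of B] B1(2) B2(2)
      by (simp add: v_def B_def le_max_iff_disj)
  qed
  have ce: "continuous_on UNIV e1" "continuous_on UNIV e2"
    unfolding e1_def e2_def
    by (intro continuous_on_compose2[OF h_cont] continuous_on_compose2[OF k_cont] continuous_intros; simp)+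
  have Db [measurable]: "D \<in> sets borel" using D(1) by simp
  have cE: "continuous_on UNIV (\<lambda>x. max (e1 x) (e2 x))" by (intro continuous_intros ce)
  have iE: "integrable lborel (\<lambda>x. indicator D x * max (e1 x) (e2 x))"
    by (rule integrable_indicator_continuous[OF cE D(2) Db])
  have fD: "integrable lborel (\<lambda>x. lam * M\<^sup>2 * indicator D x)"
    using D emeasure_bounded_finite[OF D(2)] by auto
  have iE': "integrable lborel (\<lambda>x. indicator D x * E x)"
    using Bochner_Integration.integrable_diff[OF iE fD] by (simp add: E_def right_diff_distrib mult_ac)
  have iI2: "integrable lborel (\<lambda>x. indicator (ball a R) x * e2 x)"
    by (rule integrable_indicator_continuous[OF ce(2)]) auto
  have iI1: "integrable lborel (\<lambda>x. indicator (- K) x * e1 x)"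
  proof -
    have "(\<lambda>x. indicator (- K) x * e1 x) = (\<lambda>x. indicator (parallel_set K \<delta> - K) x * e1 x)"
      using h_zero by (auto simp: fun_eq_iff indicator_def e1_def parallel_set_def)
    moreover have "bounded (parallel_set K \<delta> - K)" "parallel_set K \<delta> - K \<in> sets borel"
      using compact_parallel_set[OF K'(1,2), of \<delta>]
      by (auto intro: bounded_diff compact_imp_bounded borel_compact)
    ultimately show ?thesis using integrable_indicator_continuous[OF ce(1)] by simp
  qed
  define H where "H x = indicator (- cball a r) x * h (dist x a - r)" for x
  have iY: "integrable lborel H"
  proof -
    have "H = (\<lambda>x. indicator (ball a R - cball a r) x * h (dist x a - r))"
      using h_zero r by (auto simp: fun_eq_iff indicator_def H_def dist_commute \<delta>_def)
    moreover have "continuous_on UNIV (\<lambda>x. h (dist x a - r))"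
      by (intro continuous_on_compose2[OF h_cont] continuous_intros) simp
    moreover have "bounded (ball a R - cball a r)" by (auto intro: bounded_subset[OF bounded_ball])
    ultimately show ?thesis
      using integrable_indicator_continuous[of "\<lambda>x. h (dist x a - r)" "ball a R - cball a r"] by auto
  qed
  have H_nn: "0 \<le> H x" for x using h_nn by (simp add: H_def)
  have I1Y: "(LINT x|lborel. indicator (- K) x * e1 x) \<le> (LINT x|lborel. H x)"
  proof -
    have "(\<integral>\<^sup>+x. ennreal (indicator (- K) x * e1 x) \<partial>lborel) \<le> (\<integral>\<^sup>+x. ennreal (H x) \<partial>lborel)"
      unfolding e1_def H_def using r
      by (intro parallel_integral_le[OF K'(1,2) _ area h_cont h_nn h_anti h_zero]) auto
    moreover have "(\<integral>\<^sup>+x. ennreal (indicator (- K) x * e1 x) \<partial>lborel) = ennreal (LINT x|lborel. indicator (- K) x * e1 x)"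
      using iI1 h_nn by (intro nn_integral_eq_integral) (auto simp: e1_def)
    moreover have "(\<integral>\<^sup>+x. ennreal (H x) \<partial>lborel) = ennreal (LINT x|lborel. H x)"
      using iY H_nn by (intro nn_integral_eq_integral) auto
    ultimately have "ennreal (LINT x|lborel. indicator (- K) x * e1 x) \<le> ennreal (LINT x|lborel. H x)" by simp
    then show ?thesis using H_nn by (subst (asm) ennreal_le_iff) auto
  qed
  have total: "(LINT x|lborel. H x) + (LINT x|lborel. indicator (ball a R) x * e2 x) = lam * M\<^sup>2 * (pi * R\<^sup>2 - pi * r\<^sup>2)"
  proof -
    define p where "p s = (f1 s)\<^sup>2 - lam * (f s)\<^sup>2" for s
    have pw: "H x + indicator (ball a R) x * e2 x
       = indicator {r<..<R} (dist x a) * p (dist x a) + lam * M\<^sup>2 * indicator (ball a R - cball a r) x" for x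
    proof -
      define s where "s = dist x a"
      consider "s \<le> r" | "r < s" "s \<le> \<rho>" | "\<rho> < s" "s < R" | "R \<le> s" by linarith
      then show ?thesis
      proof cases
        case 1
        then show ?thesis using k_zero[of s] r by (auto simp: H_def e2_def s_def indicator_def dist_commute)
      next
        case 2
        then have "cl (r + (s - r)) = s" by (auto simp: cl_def)
        then have "h (s - r) = p s + lam * M\<^sup>2" by (simp add: h_def p_def right_diff_distrib)
        then show ?thesis using 2 k_zero[of s] r by (auto simp: H_def e2_def s_def indicator_def dist_commute)
      next
        case 3
        then have "cu s = s" by (auto simp: cu_def)
        then have "k s = p s + lam * M\<^sup>2" by (simp add: k_def p_def right_diff_distrib)
        moreover have "h (s - r) = 0" using 3 by (intro h_zero) (simp add: \<delta>_def)
        ultimately show ?thesis using 3 r by (auto simp: H_def e2_def s_def indicator_def dist_commute)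
      next
        case 4
        then have "h (s - r) = 0" using r by (intro h_zero) (simp add: \<delta>_def)
        then show ?thesis using 4 r by (auto simp: H_def e2_def s_def indicator_def dist_commute)
      qed
    qed
    define A where "A = ball a R - cball a r"
    have iA: "integrable lborel (\<lambda>x. lam * M\<^sup>2 * indicator A x)"
    proof (intro integrable_mult_right integrable_real_indicator)
      show "emeasure lborel A < \<infinity>"
        unfolding A_def by (intro emeasure_bounded_finite bounded_subset[OF bounded_ball]) auto
    qed (simp add: A_def)
    have mA: "measure lborel A = pi * R\<^sup>2 - pi * r\<^sup>2"
    proof -
      have "cball a r \<subseteq> ball a R" using r by (auto simp: subset_eq)
      then have "measure lborel A = measure lborel (ball a R) - measure lborel (cball a r)"
        unfolding A_def by (intro measurable_measure_Diff fmeasurable_lborel_bounded) auto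
      then show ?thesis using area_ball[of R a] area_cball[of r a] r R0 by simp
    qed
    have ip: "integrable lborel (\<lambda>x. indicator {r<..<R} (dist x a) * p (dist x a))"
      using Bochner_Integration.integrable_diff[OF Bochner_Integration.integrable_add[OF iY iI2] iA] pw
      by (simp add: A_def)
    \<comment> \<open>By the radial equation, \<open>f * g\<close> has derivative
      \<open>s * ((f1 s)\<^sup>2 - lam * (f s)\<^sup>2)\<close>, and it vanishes at both radii
      together with \<open>f\<close>.\<close>
    have "(LINT x|lborel. indicator {r<..<R} (dist x a) * p (dist x a)) = 2 * pi * (f R * g R) - 2 * pi * (f r * g r)"
    proof (rule radial_integral)
      show "continuous_on {r..R} p" unfolding p_def using r by (intro continuous_intros cf cf1) auto
      fix s assume s: "r \<le> s" "s \<le> R"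
      then have s0: "0 < s" using r by simp
      have "((\<lambda>s. 2 * pi * (f s * g s)) has_real_derivative 2 * pi * (f s * (- lam * s * f s) + f1 s * g s)) (at s)"
        using df1[OF s0] dg[OF s0] by (auto intro!: derivative_eq_intros)
      moreover have "2 * pi * (f s * (- lam * s * f s) + f1 s * g s) = 2 * pi * s * p s"
        using s0 by (simp add: p_def f1_def power2_eq_square field_simps)
      ultimately show "((\<lambda>s. 2 * pi * (f s * g s)) has_real_derivative 2 * pi * s * p s) (at s within {r..R})"
        by (metis has_field_derivative_at_within)
    qed (use r in auto)
    then have zero: "(LINT x|lborel. indicator {r<..<R} (dist x a) * p (dist x a)) = 0" using f0 by simp
    have "(LINT x|lborel. H x) + (LINT x|lborel. indicator (ball a R) x * e2 x)
      = (LINT x|lborel. H x + indicator (ball a R) x * e2 x)" using iY iI2 by simp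
    also have "\<dots> = (LINT x|lborel. indicator {r<..<R} (dist x a) * p (dist x a) + lam * M\<^sup>2 * indicator A x)"
      unfolding pw A_def ..
    also have "\<dots> = lam * M\<^sup>2 * measure lborel A" using ip iA zero by (simp add: A_def)
    finally show ?thesis by (simp add: mA)
  qed
  \<comment> \<open>The loss is the smaller of \<open>e1\<close> and \<open>e2\<close> on
    \<open>D\<close>, \<open>e2\<close> on the part of \<open>K\<close> in the ball,
    \<open>e1\<close> off \<open>K\<close> outside the ball, and 0 elsewhere.\<close>
  define G where "G x = indicator (- K) x * e1 x + indicator (ball a R) x * e2 x - indicator D x * max (e1 x) (e2 x)" for x
  have G_nn: "0 \<le> G x" for x
    using h_nn k_nn by (auto simp: G_def D_def e1_def e2_def indicator_def max_def)
  have iG: "integrable lborel G" unfolding G_def using iI1 iI2 iE by simp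
  have IG: "(LINT x|lborel. indicator D x * max (e1 x) (e2 x))
     = (LINT x|lborel. indicator (- K) x * e1 x) + (LINT x|lborel. indicator (ball a R) x * e2 x) - (LINT x|lborel. G x)"
    unfolding G_def using iI1 iI2 iE by simp
  have mD: "pi * R\<^sup>2 - mK \<le> measure lborel D"
  proof -
    have "measure lborel (ball a R) \<le> measure lborel (D \<union> K)"
      using K'(1) D by (intro measure_mono_fmeasurable fmeasurable_lborel_bounded)
        (auto simp: D_def compact_imp_bounded)
    also have "\<dots> \<le> measure lborel D + mK"
      unfolding mK_def using K'(1) D
      by (intro measure_Un_le) auto
    finally show ?thesis using area_ball[of R a] R0 by simp
  qed
  have "(LINT x|lborel. indicator D x * E x) = (LINT x|lborel. indicator D x * max (e1 x) (e2 x)) - lam * M\<^sup>2 * measure lborel D"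
  proof -
    have "(LINT x|lborel. indicator D x * E x) = (LINT x|lborel. indicator D x * max (e1 x) (e2 x) - lam * M\<^sup>2 * indicator D x)"
      by (intro Bochner_Integration.integral_cong) (auto simp: E_def right_diff_distrib)
    also have "\<dots> = (LINT x|lborel. indicator D x * max (e1 x) (e2 x)) - lam * M\<^sup>2 * measure lborel D"
      using iE fD by simp
    finally show ?thesis .
  qed
  also have "\<dots> \<le> lam * M\<^sup>2 * (pi * R\<^sup>2 - pi * r\<^sup>2) - (LINT x|lborel. G x) - lam * M\<^sup>2 * (pi * R\<^sup>2 - mK)"
  proof -
    have "lam * M\<^sup>2 * (pi * R\<^sup>2 - mK) \<le> lam * M\<^sup>2 * measure lborel D" using mD lam by (intro mult_left_mono) auto
    then show ?thesis using I1Y total IG by linarith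
  qed
  also have "\<dots> = lam * M\<^sup>2 * (mK - pi * r\<^sup>2) - (LINT x|lborel. G x)" by (simp add: algebra_simps)
  also have "\<dots> < 0"
  proof (cases "mK = pi * r\<^sup>2")
    case False
    then have "lam * M\<^sup>2 * (mK - pi * r\<^sup>2) < 0" using iso lam M by (intro mult_pos_neg) auto
    moreover have "0 \<le> (LINT x|lborel. G x)" using G_nn by simp
    ultimately show ?thesis by linarith
  next
    case True
    \<comment> \<open>Inside the disk, equal area would make the part of the open disk missed by the
      closed set \<open>K\<close> an open null set, hence empty, and \<open>K\<close> would be the
      whole disk.\<close>
    have "\<not> K \<subseteq> cball a r"
    proof
      assume sub: "K \<subseteq> cball a r"
      have "measure lborel (cball a r - K) = measure lborel (cball a r) - mK"
        unfolding mK_def using sub K'(1)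
        by (intro measurable_measure_Diff fmeasurable_lborel_bounded) auto
      then have z: "measure lborel (cball a r - K) = 0" using True area_cball[of r a] r by simp
      have "ball a r - K = {}"
      proof (rule ccontr)
        assume ne: "ball a r - K \<noteq> {}"
        have op: "open (ball a r - K)" using K'(3) by (intro open_Diff) auto
        have "measure lborel (ball a r - K) \<le> measure lborel (cball a r - K)"
          by (intro measure_mono_fmeasurable fmeasurable_lborel_bounded) (auto intro: bounded_subset[OF bounded_cball])
        then have "measure lborel (ball a r - K) = 0" using z measure_nonneg[of lborel "ball a r - K"] by linarith
        moreover have "emeasure lborel (ball a r - K) < \<infinity>"
          by (intro emeasure_bounded_finite bounded_subset[OF bounded_ball]) auto
        ultimately have "emeasure lborel (ball a r - K) = 0" by (auto simp: measure_def enn2real_eq_0_iff)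
        then have "negligible (ball a r - K)" using op by (simp add: negligible_iff_emeasure0)
        then show False using open_not_negligible[OF op ne] by blast
      qed
      then have "closure (ball a r) \<subseteq> K" using K'(3) by (intro closure_minimal) auto
      then show False using sub ne r by auto
    qed
    then obtain y where y: "y \<in> K" "r < dist y a" by (metis dist_commute mem_cball not_le subsetI)
    \<comment> \<open>Both densities are positive here: the distance to \<open>K\<close> is less
      than \<open>\<delta>\<close> and the radius lies strictly between \<open>\<rho>\<close> and
      \<open>R\<close>.\<close>
    define V where "V = {x. infdist x K < \<delta>} \<inter> ({x. \<rho> < dist x a} \<inter> {x. dist x a < R})"
    have "open V" unfolding V_def
      by (intro open_Int open_Collect_less continuous_intros)
    moreover have "V \<noteq> {}"
    proof -
      define m where "m = dist y a"
      have m: "r < m" "m \<le> R" using y KR by (auto simp: m_def dist_commute)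
      \<comment> \<open>The point \<open>y\<close> is moved along its ray by less than
        \<open>\<delta>\<close> to a radius between \<open>\<rho>\<close> and \<open>R\<close>.
        There is room because \<open>r < m\<close> and \<open>\<delta> = \<rho> - r\<close> give
        \<open>\<rho> < m + \<delta>\<close>.\<close>
      have "max \<rho> (m - \<delta>) < min R (m + \<delta>)" using m r \<delta> by (auto simp: \<delta>_def)
      then obtain s where s: "max \<rho> (m - \<delta>) < s" "s < min R (m + \<delta>)" using dense by blast
      define x where "x = a + (s / m) *\<^sub>R (y - a)"
      have m0: "m > 0" using m r by simp
      have na: "norm (y - a) = m" by (simp add: m_def dist_norm)
      have "dist x a = \<bar>s\<bar>" using m0 na by (simp add: x_def dist_norm)
      then have "dist x a = s" using s R0 by auto
      moreover have "infdist x K < \<delta>"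
      proof -
        have "x - y = (s / m - 1) *\<^sub>R (y - a)" by (simp add: x_def algebra_simps)
        then have "dist x y = \<bar>s / m - 1\<bar> * m" by (simp add: dist_norm na)
        also have "\<dots> = \<bar>(s / m - 1) * m\<bar>" using m0 by (simp add: abs_mult)
        also have "(s / m - 1) * m = s - m" using m0 by (simp add: left_diff_distrib)
        finally have "dist x y < \<delta>" using s by auto
        then show ?thesis using infdist_le[OF y(1), of x] by linarith
      qed
      ultimately have "x \<in> V" using s by (auto simp: V_def)
      then show ?thesis by blast
    qed
    moreover have "0 < G x" if x: "x \<in> V" for x
    proof -
      have e: "0 < e1 x" "0 < e2 x" "x \<in> ball a R"
        using x h_pos[of "infdist x K"] k_pos[of "dist x a"] infdist_nonneg[of x K]
        by (auto simp: V_def e1_def e2_def dist_commute)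
      then show ?thesis by (cases "x \<in> K") (auto simp: G_def D_def max_def)
    qed
    ultimately have "0 < (LINT x|lborel. G x)" by (intro integral_pos_of_open[OF iG G_nn])
    then show ?thesis using True by simp
  qed
  finally have neg: "(LINT x|lborel. indicator D x * E x) < 0" .
  obtain \<phi> where "test_function D \<phi>" "(LINT x|lborel. (norm (gradient \<phi> x))\<^sup>2) < lam * (LINT x|lborel. (\<phi> x)\<^sup>2)"
  proof (rule test_function_of_energy_bound[OF D _ _ v0 v_lip less_imp_le[OF lam] E_bound iE' neg])
    show "0 \<le> v x" "v x \<le> M" for x using w[of x] by (auto simp: v_def)
  qed auto
  then show ?thesis using that by (simp add: D_def)
qed

theorem theorem4p2:
  fixes a :: "real^2" and r0 L :: real
  assumes "r0 > 0" and "0 < L" and "L < 2 * pi * r0"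
  shows "\<forall>K. is_arg_max (\<lambda>K. dirichlet_eigenvalue_1 (ball a r0 - K)) (admissible (ball a r0) L) K
           \<longleftrightarrow> K = cball a (L / (2 * pi))"
proof -
  define r where "r = L / (2 * pi)"
  have r: "0 < r" "r < r0" "2 * pi * r = L" using assms by (auto simp: r_def field_simps)
  obtain lam \<rho> f g where ode: "0 < lam" "r < \<rho>" "\<rho> < r0"
    "\<And>s. 0 < s \<Longrightarrow> (f has_real_derivative g s / s) (at s)"
    "\<And>s. 0 < s \<Longrightarrow> (g has_real_derivative - lam * s * f s) (at s)"
    "f r = 0" "f r0 = 0" "\<And>s. r < s \<Longrightarrow> s < r0 \<Longrightarrow> 0 < f s"
    "\<And>s. r \<le> s \<Longrightarrow> s < \<rho> \<Longrightarrow> 0 < g s" "g \<rho> = 0" "\<And>s. \<rho> < s \<Longrightarrow> s \<le> r0 \<Longrightarrow> g s < 0"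
    by (rule annulus_eigenfunction[OF r(1,2)]) blast
  let ?\<Lambda> = "\<lambda>K. dirichlet_eigenvalue_1 (ball a r0 - K)"
  have low: "ennreal lam \<le> ?\<Lambda> (cball a r)"
    by (rule dirichlet_eigenvalue_1_ge)
       (use ode(1) annulus_poincare[OF r(1) ode(4,5,8)] in \<open>auto intro: open_Diff\<close>)
  have up: "?\<Lambda> K < ennreal lam" if K: "admissible (ball a r0) L K" "K \<noteq> cball a r" for K
  proof -
    obtain \<phi> where \<phi>: "test_function (ball a r0 - K) \<phi>"
      "(LINT x|lborel. (norm (gradient \<phi> x))\<^sup>2) < lam * (LINT x|lborel. (\<phi> x)\<^sup>2)"
      by (rule obstacle_rayleigh_lt[OF r(1) ode(2,3,1,4-11) K(1)[folded r(3)] K(2)]) blast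
    have "0 \<le> (LINT x|lborel. (norm (gradient \<phi> x))\<^sup>2)" by simp
    then have "0 < lam * (LINT x|lborel. (\<phi> x)\<^sup>2)" using \<phi>(2) by linarith
    then have pos: "0 < (LINT x|lborel. (\<phi> x)\<^sup>2)" using ode(1) by (simp add: zero_less_mult_iff)
    have "open (ball a r0 - K)"
      using K by (intro open_Diff) (auto simp: admissible_def continuum_def compact_imp_closed)
    then have "?\<Lambda> K \<le> ennreal ((LINT x|lborel. (norm (gradient \<phi> x))\<^sup>2) / (LINT x|lborel. (\<phi> x)\<^sup>2))"
      using \<phi>(1) pos by (intro dirichlet_eigenvalue_1_le_rayleigh)
    also have "\<dots> < ennreal lam"
      using \<phi>(2) pos ode(1) by (intro ennreal_lessI) (auto simp: pos_divide_less_eq)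
    finally show ?thesis .
  qed
  have adm: "admissible (ball a r0) L (cball a r)"
    unfolding admissible_def
  proof (intro conjI exI)
    show "cball a r \<subseteq> closure (ball a r0)" using r by auto
    show "continuum (cball a r)" using r by (auto simp: continuum_def)
    show "has_outer_minkowski_content (cball a r) (ennreal (2 * pi * r))"
      using r by (intro cball_outer_minkowski_content) auto
    show "ennreal (2 * pi * r) \<le> ennreal L" using r by simp
  qed
  \<comment> \<open>The number \<open>lam\<close> separates the disk from all its competitors,
    strictly on their side, which yields optimality and uniqueness together.\<close>
  have "is_arg_max ?\<Lambda> (admissible (ball a r0) L) K \<longleftrightarrow> K = cball a r" for K
  proof
    assume "is_arg_max ?\<Lambda> (admissible (ball a r0) L) K"
    then have "admissible (ball a r0) L K" "\<not> ?\<Lambda> K < ?\<Lambda> (cball a r)"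
      using adm by (auto simp: is_arg_max_def)
    then show "K = cball a r" using up[of K] low by (meson less_le_trans)
  next
    assume "K = cball a r"
    moreover have "\<not> ?\<Lambda> (cball a r) < ?\<Lambda> K" if "admissible (ball a r0) L K" for K
      using up[OF that] low by (cases "K = cball a r") (auto simp: not_less intro: less_imp_le order_trans)
    ultimately show "is_arg_max ?\<Lambda> (admissible (ball a r0) L) K"
      using adm by (auto simp: is_arg_max_def)
  qed
  then show ?thesis by (simp add: r_def)
qed

end
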